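(* Let $d\ge3$ be odd. The functions $$\frac{1}{\lambda_{m,l,d}}\,\mathcal D^{(\mathrm{odd})}\widetilde V_{m,l,k},\qquad m\in\mathbb N_0,\; l=0,\dots,m,\; l+m\text{ even},\; k=1,\dots,N_{l,d},$$ are orthonormal in $L^2(\mathbb S^{d-1}\times\mathbb S^{d-1})$, where $$\lambda_{m,l,d}=\sqrt{\frac{N_{m+1,d}\,\mu_{m,d}^2\,|\mathbb S^{d-2}|}{|\mathbb S^{d-1}|^2}\;\sum_{n=m+1-l,\ n\text{ odd}}^{m+1+l}\nu_{n,d}^2\,N_{n,d}\,\langle P_{m+1,d}P_{l,d},P_{n,d}\rangle_{w_d}}$$ and $$\langle P_{m+1,d}P_{l,d},P_{n,d}\rangle_{w_d}=\int_{-1}^1P_{m+1,d}(t)\,P_{l,d}(t)\,P_{n,d}(t)\,(1-t^2)^{\frac{d-3}{2}}\,dt.$$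
   Context: $\mathbb S^{d-1}$ and $\mathbb B^d$ are the unit sphere and closed unit ball in $\mathbb R^d$; $|\mathbb S^{d-1}|=2\pi^{d/2}/\Gamma(d/2)$ is the surface measure. For a function $f$ on $\mathbb R^d$ supported in $\mathbb B^d$ (functions on $\mathbb B^d$ are extended by $0$), $\mathcal Df(a,\omega)=\int_0^\infty f(a+t\omega)\,dt$, $a,\omega\in\mathbb S^{d-1}$, and $\mathcal D^{(\mathrm{odd})}f(a,\omega)=\frac12\big(\mathcal Df(a,\omega)-\mathcal Df(a,-\omega)\big)$. $Y_{n,d}^k$, $k=1,\dots,N_{n,d}$, with $N_{n,d}=\frac{(2n+d-2)(n+d-3)!}{n!(d-2)!}$, is an orthonormal basis in $L^2(\mathbb S^{d-1})$ of the space of restrictions to $\mathbb S^{d-1}$ of harmonic polynomials homogeneous of degree $n$. $$\widetilde V_{m,l,k}(s\omega)=\sqrt{2m+d}\;s^l\,P^{(0,\,l+\frac{d-2}{2})}_{\frac{m-l}{2}}(2s^2-1)\,Y_{l,d}^k(\omega),\quad s\in[0,1],\ \omega\in\mathbb S^{d-1},$$ where $P_n^{(\alpha,\beta)}$ is the Jacobi polynomial of degree $n$ (standard normalization $P_n^{(\alpha,\beta)}(1)=\binom{n+\alpha}{n}$). $P_{n,d}$ is the Legendre polynomial of degree $n$ in dimension $d$: $$P_{n,d}(t)=(-1)^n\frac{(d-3)!!}{(2n+d-3)!!}(1-t^2)^{\frac{3-d}{2}}\left(\frac{d}{dt}\right)^n(1-t^2)^{n+\frac{d-3}{2}}$$ (so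 $P_{n,d}(1)=1$). $$\mu_{m,d}=\sqrt{\frac{2^{d+1}\pi^{d-1}}{2m+d}},\qquad \nu_{n,d}=\frac{(-1)^{\frac{n+1}{2}}(n-1)!!}{(n+d-3)!!}.$$ Double factorials: $n!!=n(n-2)\cdots$ down to $2$ or $1$, with $0!!=1$. *)

theory Defs
  imports "HOL-Analysis.Analysis" "HOL-Computational_Algebra.Polynomial"
begin

section \<open>Constants\<close>

fun double_fact :: "nat \<Rightarrow> nat" where
  "double_fact 0 = 1"
| "double_fact (Suc 0) = 1"
| "double_fact (Suc (Suc n)) = Suc (Suc n) * double_fact n"

(* |S^(d-1)| *)
definition sphere_area :: "nat \<Rightarrow> real" where
  "sphere_area d = 2 * pi powr (real d / 2) / Gamma (real d / 2)"

(* N_{n,d}, for d \<ge> 3; it is used as an index bound, hence a natural number. The division is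
   exact, see of_nat_harmonic_dim. *)
definition harmonic_dim :: "nat \<Rightarrow> nat \<Rightarrow> nat" where
  "harmonic_dim n d = ((2 * n + d - 2) * fact (n + d - 3)) div (fact n * fact (d - 2))"

definition mu :: "nat \<Rightarrow> nat \<Rightarrow> real" where
  "mu m d = sqrt (2 ^ (d + 1) * pi ^ (d - 1) / real (2 * m + d))"

(* used for odd n only *)
definition nu :: "nat \<Rightarrow> nat \<Rightarrow> real" where
  "nu n d = (-1) ^ ((n + 1) div 2) * real (double_fact (n - 1)) / real (double_fact (n + d - 3))"


section \<open>Legendre and Jacobi polynomials\<close>

(* The Legendre polynomial of degree n in odd dimension d \<ge> 3. As d is odd, the exponents in
   Rodrigues' formula are integers; the factor (1 - t^2) powr ((3 - d) / 2) is rendered as an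
   exact polynomial division, so that the value at t = 1, -1 is the correct one as well.
   See poly_legendre for the formula with real powers and derivatives. *)
definition legendre :: "nat \<Rightarrow> nat \<Rightarrow> real poly" where
  "legendre n d = smult ((-1) ^ n * real (double_fact (d - 3)) / real (double_fact (2 * n + d - 3)))
     ((pderiv ^^ n) ([:1, 0, -1:] ^ (n + (d - 3) div 2)) div [:1, 0, -1:] ^ ((d - 3) div 2))"

(* the integral of P_{i,d} P_{j,d} P_{n,d} against the weight (1 - t^2) powr ((d - 3) / 2),
   d odd *)
definition legendre_triple :: "nat \<Rightarrow> nat \<Rightarrow> nat \<Rightarrow> nat \<Rightarrow> real" where
  "legendre_triple d i j n = integral {-1..1} (\<lambda>t.
     poly (legendre i d) t * poly (legendre j d) t * poly (legendre n d) t
     * (1 - t\<^sup>2) ^ ((d - 3) div 2))"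

definition jacobi :: "nat \<Rightarrow> real \<Rightarrow> real \<Rightarrow> real \<Rightarrow> real" where
  "jacobi n \<alpha> \<beta> x = (\<Sum>s\<le>n. ((real n + \<alpha>) gchoose (n - s)) * ((real n + \<beta>) gchoose s)
     * ((x - 1) / 2) ^ s * ((x + 1) / 2) ^ (n - s))"

definition lambda_sv :: "nat \<Rightarrow> nat \<Rightarrow> nat \<Rightarrow> real" where
  "lambda_sv m l d = sqrt
     (real (harmonic_dim (m + 1) d) * (mu m d)\<^sup>2 * sphere_area (d - 1) / (sphere_area d)\<^sup>2
      * (\<Sum>n | n \<in> {m + 1 - l..m + 1 + l} \<and> odd n.
           (nu n d)\<^sup>2 * real (harmonic_dim n d) * legendre_triple d (m + 1) l n))"


section \<open>The sphere and square-integrable functions\<close>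

(* x / |x|; at the origin, where every direction is admissible in polar coordinates, an
   arbitrary unit vector *)
definition direction :: "'a::euclidean_space \<Rightarrow> 'a" where
  "direction x = (if x = 0 then (SOME u. norm u = 1) else x /\<^sub>R norm x)"

(* The surface measure on the unit sphere: the measure of A is DIM('a) times the Lebesgue
   measure of the cone {r u | 0 \<le> r \<le> 1, u \<in> A}. *)
definition sphere_measure :: "'a::euclidean_space measure" where
  "sphere_measure = scale_measure (of_nat DIM('a))
     (distr (restrict_space lborel (cball 0 1)) (restrict_space borel (sphere 0 1)) direction)"

definition square_integrable :: "'b measure \<Rightarrow> ('b \<Rightarrow> complex) \<Rightarrow> bool" where
  "square_integrable M f \<longleftrightarrow> f \<in> borel_measurable M \<and> integrable M (\<lambda>x. (norm (f x))\<^sup>2)"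

definition orthonormal_L2 :: "'b measure \<Rightarrow> 'i set \<Rightarrow> ('i \<Rightarrow> 'b \<Rightarrow> complex) \<Rightarrow> bool" where
  "orthonormal_L2 M I F \<longleftrightarrow> (\<forall>i\<in>I. square_integrable M (F i)) \<and>
     (\<forall>i\<in>I. \<forall>j\<in>I. (LINT x|M. F i x * cnj (F j x)) = (if i = j then 1 else 0))"


section \<open>Spherical harmonics\<close>

definition partial_deriv ::
    "'a::euclidean_space \<Rightarrow> ('a \<Rightarrow> complex) \<Rightarrow> 'a \<Rightarrow> complex" where
  "partial_deriv b f x = vector_derivative (\<lambda>t. f (x + t *\<^sub>R b)) (at 0)"

definition laplacian :: "('a::euclidean_space \<Rightarrow> complex) \<Rightarrow> 'a \<Rightarrow> complex" where
  "laplacian f x = (\<Sum>b\<in>Basis. partial_deriv b (partial_deriv b f) x)"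

definition harmonic_homogeneous :: "nat \<Rightarrow> ('a::euclidean_space \<Rightarrow> complex) set" where
  "harmonic_homogeneous n = {p. polynomial_function p \<and>
     (\<forall>c x. p (c *\<^sub>R x) = of_real (c ^ n) * p x) \<and> (\<forall>x. laplacian p x = 0)}"

(* Only the values of Y k on the unit sphere matter. *)
definition spherical_harmonic_basis ::
    "nat \<Rightarrow> (nat \<Rightarrow> 'a::euclidean_space \<Rightarrow> complex) \<Rightarrow> bool" where
  "spherical_harmonic_basis n Y \<longleftrightarrow>
     (\<forall>k\<in>{1..harmonic_dim n DIM('a)}. \<exists>p\<in>harmonic_homogeneous n. \<forall>u\<in>sphere 0 1. Y k u = p u) \<and>
     orthonormal_L2 sphere_measure {1..harmonic_dim n DIM('a)} Y \<and>
     (\<forall>p\<in>harmonic_homogeneous n. \<exists>c. \<forall>u\<in>sphere 0 1.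
        p u = (\<Sum>k\<in>{1..harmonic_dim n DIM('a)}. c k * Y k u))"


section \<open>Functions on the ball and the divergent beam transform\<close>

(* extended by 0 outside the closed unit ball *)
definition V_fun :: "(nat \<Rightarrow> nat \<Rightarrow> 'a::euclidean_space \<Rightarrow> complex) \<Rightarrow>
    nat \<Rightarrow> nat \<Rightarrow> nat \<Rightarrow> 'a \<Rightarrow> complex" where
  "V_fun Y m l k x = (if norm x \<le> 1 then
       of_real (sqrt (real (2 * m + DIM('a))) * norm x ^ l
         * jacobi ((m - l) div 2) 0 (real l + (real DIM('a) - 2) / 2) (2 * (norm x)\<^sup>2 - 1))
       * Y l k (direction x)
     else 0)"

definition divergent_beam ::
    "('a::euclidean_space \<Rightarrow> complex) \<Rightarrow> 'a \<Rightarrow> 'a \<Rightarrow> complex" where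
  "divergent_beam f a w = (LINT t:{0..}|lborel. f (a + t *\<^sub>R w))"

definition divergent_beam_odd ::
    "('a::euclidean_space \<Rightarrow> complex) \<Rightarrow> 'a \<Rightarrow> 'a \<Rightarrow> complex" where
  "divergent_beam_odd f a w = (divergent_beam f a w - divergent_beam f a (- w)) / 2"


section \<open>Consistency of the definitions\<close>

lemma of_nat_harmonic_dim:
  assumes "d \<ge> 3"
  shows "real (harmonic_dim n d) =
    real (2 * n + d - 2) * fact (n + d - 3) / (fact n * fact (d - 2))"
proof -
  obtain e where d: "d = e + 3" using assms by (metis le_Suc_ex add.commute)
  have *: "(2 * n + e + 1) * fact (n + e) =
      (fact n * fact (e + 1)) * ((n + e + 1 choose (e + 1)) + (if n = 0 then 0 else (n + e choose (e + 1))))"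
    (is "?L = ?R * ?S")
  proof (cases n)
    case 0
    then show ?thesis by simp
  next
    case (Suc q)
    have a: "fact (e + 1) * fact n * (n + e + 1 choose (e + 1)) = (fact (n + e + 1) :: nat)"
      using binomial_fact_lemma[of "e + 1" "n + e + 1"] by simp
    have "fact (e + 1) * fact q * (n + e choose (e + 1)) = (fact (n + e) :: nat)"
      using binomial_fact_lemma[of "e + 1" "n + e"] Suc by simp
    then have b: "fact (e + 1) * fact n * (n + e choose (e + 1)) = n * (fact (n + e) :: nat)"
      using Suc by (metis (no_types, lifting) fact_Suc mult.assoc mult.left_commute of_nat_id)
    have "?R * ?S = fact (n + e + 1) + n * fact (n + e)"
      using a b Suc by (simp only: distrib_left) (simp add: mult_ac)
    also have "\<dots> = ?L" by (simp add: algebra_simps)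
    finally show ?thesis by simp
  qed
  have "(fact n * fact (e + 1)) dvd ((2 * n + e + 1) * fact (n + e) :: nat)"
    unfolding * by simp
  then have "real (((2 * n + e + 1) * fact (n + e)) div (fact n * fact (e + 1))) =
      real ((2 * n + e + 1) * fact (n + e)) / real (fact n * fact (e + 1))"
    by (rule real_of_nat_div)
  moreover have "2 * n + d - 2 = 2 * n + e + 1" "n + d - 3 = n + e" "d - 2 = e + 1"
    unfolding d by auto
  ultimately show ?thesis
    unfolding harmonic_dim_def by (simp only: of_nat_mult of_nat_fact)
qed

lemma jacobi_1: "jacobi n \<alpha> \<beta> 1 = (real n + \<alpha>) gchoose n"
proof -
  have "jacobi n \<alpha> \<beta> 1 = (\<Sum>s\<le>n. if s = 0 then (real n + \<alpha>) gchoose n else 0)"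
    unfolding jacobi_def by (rule sum.cong) auto
  then show ?thesis by simp
qed

lemma legendre_aux:
  fixes q :: "real poly"
  defines "q \<equiv> [:1, 0, -1:]"
  shows "j \<le> N \<Longrightarrow> \<exists>r. (pderiv ^^ j) (q ^ N) = q ^ (N - j) * r \<and>
    poly r 1 = (-2) ^ j * fact N / fact (N - j)"
proof (induction j)
  case 0
  show ?case by (rule exI[of _ 1]) simp
next
  case (Suc j)
  then obtain r where r: "(pderiv ^^ j) (q ^ N) = q ^ (N - j) * r"
    "poly r 1 = (-2) ^ j * fact N / fact (N - j)" by auto
  obtain i where i: "N - j = Suc i" "N - Suc j = i"
    using Suc.prems by (metis Suc_diff_Suc Suc_le_lessD)
  define r' where "r' = smult (of_nat (Suc i)) (pderiv q) * r + q * pderiv r"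
  have D: "(pderiv ^^ Suc j) (q ^ N) = q ^ i * r'"
    by (simp add: r i pderiv_mult pderiv_power_Suc r'_def algebra_simps del: of_nat_Suc power_Suc)
       (simp add: algebra_simps)
  have P: "poly r' 1 = real (Suc i) * (-2) * ((-2) ^ j * fact N / fact (Suc i))"
    using r(2) by (simp add: r'_def q_def i pderiv_pCons del: of_nat_Suc fact_Suc)
  have "a * (-2) * (b * c / (a * e)) = -2 * b * c / e" if "a \<noteq> 0" for a b c e :: real
    using that by simp
  from this[of "real (Suc i)"] have "poly r' 1 = (-2) ^ Suc j * fact N / fact i"
    unfolding P fact_Suc by (simp del: of_nat_Suc)
  with D show ?case unfolding i(2) by blast
qed

lemma double_fact_even: "double_fact (2 * k) = 2 ^ k * fact k"
  by (induction k) (auto simp: algebra_simps)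

lemma legendre_mult:
  fixes d n :: nat
  assumes "odd d" "d \<ge> 3"
  shows "legendre n d * [:1, 0, -1:] ^ ((d - 3) div 2) =
      smult ((-1) ^ n * real (double_fact (d - 3)) / real (double_fact (2 * n + d - 3)))
        ((pderiv ^^ n) ([:1, 0, -1:] ^ (n + (d - 3) div 2)))"
    and "poly (legendre n d) 1 = 1"
proof -
  define k where "k = (d - 3) div 2"
  have dk: "d = 2 * k + 3" using assms by (auto simp: k_def elim!: oddE)
  obtain r :: "real poly" where r: "(pderiv ^^ n) ([:1, 0, -1:] ^ (n + k)) = [:1, 0, -1:] ^ k * r"
    "poly r 1 = (-2) ^ n * fact (n + k) / fact k"
    using legendre_aux[of n "n + k"] by auto
  have nz: "([:1, 0, -1:] :: real poly) ^ k \<noteq> 0" by simp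
  let ?c = "(-1) ^ n * real (double_fact (d - 3)) / real (double_fact (2 * n + d - 3))"
  have L: "legendre n d = smult ?c r"
    unfolding legendre_def k_def[symmetric] r(1) using nz by simp
  show "legendre n d * [:1, 0, -1:] ^ ((d - 3) div 2) =
      smult ?c ((pderiv ^^ n) ([:1, 0, -1:] ^ (n + (d - 3) div 2)))"
    unfolding k_def[symmetric] r(1) L by (simp add: mult.commute)
  have df: "double_fact (d - 3) = 2 ^ k * fact k"
      "double_fact (2 * n + d - 3) = 2 ^ (n + k) * fact (n + k)"
    using double_fact_even[of k] double_fact_even[of "n + k"] by (simp_all add: dk algebra_simps)
  have "(-1 :: real) ^ n * (-2) ^ n = 2 ^ n"
    by (simp flip: power_mult_distrib)
  then show "poly (legendre n d) 1 = 1"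
    unfolding L df r(2) poly_smult by (simp add: power_add)
qed

lemma poly_legendre:
  fixes t :: real and d n :: nat
  assumes "odd d" "d \<ge> 3" "-1 < t" "t < 1"
  shows "poly (legendre n d) t = (-1) ^ n * real (double_fact (d - 3)) / real (double_fact (2 * n + d - 3))
    * (1 - t\<^sup>2) powr ((3 - real d) / 2)
    * (deriv ^^ n) (\<lambda>s. (1 - s\<^sup>2) powr (real n + (real d - 3) / 2)) t"
proof -
  define k where "k = (d - 3) div 2"
  have dk: "d = 2 * k + 3" using assms(1,2) by (auto simp: k_def elim!: oddE)
  define p :: "real poly" where "p = [:1, 0, -1:] ^ (n + k)"
  have pos: "1 - s\<^sup>2 > 0" if "s \<in> {-1<..<1}" for s :: real
    using that abs_square_less_1[of s] by auto
  have p: "poly p s = (1 - s\<^sup>2) powr (real n + (real d - 3) / 2)" if "s \<in> {-1<..<1}" for s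
  proof -
    have "real n + (real d - 3) / 2 = real (n + k)" by (simp add: dk)
    then show ?thesis using pos[OF that]
      by (simp only: powr_realpow) (simp add: p_def power2_eq_square)
  qed
  have "deriv (poly q) = poly (pderiv q)" for q :: "real poly"
    by (rule ext) (rule DERIV_imp_deriv, rule poly_DERIV)
  then have pd: "(deriv ^^ j) (poly p) = poly ((pderiv ^^ j) p)" for j
    by (induction j) simp_all
  have "eventually (\<lambda>s. s \<in> {-1<..<1}) (nhds t)"
    using assms by (intro eventually_nhds_in_open) auto
  then have "eventually (\<lambda>s. (1 - s\<^sup>2) powr (real n + (real d - 3) / 2) = poly p s) (nhds t)"
    by eventually_elim (use p in auto)
  then have D: "(deriv ^^ n) (\<lambda>s. (1 - s\<^sup>2) powr (real n + (real d - 3) / 2)) t = poly ((pderiv ^^ n) p) t"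
    using higher_deriv_cong_ev[of "\<lambda>s. (1 - s\<^sup>2) powr (real n + (real d - 3) / 2)" "poly p" t t n]
    by (simp add: pd)
  have "(3 - real d) / 2 = - real k" by (simp add: dk)
  moreover have t: "1 - t\<^sup>2 > 0" using pos assms by auto
  ultimately have W: "(1 - t\<^sup>2) powr ((3 - real d) / 2) = 1 / (1 - t\<^sup>2) ^ k"
    by (simp only: powr_minus powr_realpow) (simp add: field_simps)
  have "poly (legendre n d) t * (1 - t\<^sup>2) ^ k =
      (-1) ^ n * real (double_fact (d - 3)) / real (double_fact (2 * n + d - 3)) * poly ((pderiv ^^ n) p) t"
    using arg_cong[OF legendre_mult(1)[OF assms(1,2), of n], of "\<lambda>q. poly q t"]
    by (simp add: k_def[symmetric] p_def power2_eq_square)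
  then have "poly (legendre n d) t =
      (-1) ^ n * real (double_fact (d - 3)) / real (double_fact (2 * n + d - 3)) * poly ((pderiv ^^ n) p) t
      / (1 - t\<^sup>2) ^ k"
    using t by (subst eq_divide_eq) auto
  then show ?thesis unfolding D W by simp
qed

lemma norm_direction [simp]: "norm (direction (x::'a::euclidean_space)) = 1"
proof -
  obtain b :: 'a where "b \<in> Basis" using nonempty_Basis by blast
  then have "norm (SOME u::'a. norm u = 1) = 1"
    by (intro someI[of "\<lambda>u. norm u = 1" b]) simp
  then show ?thesis by (simp add: direction_def)
qed

lemma measurable_direction:
  "(direction :: 'a::euclidean_space \<Rightarrow> 'a) \<in>
     measurable (restrict_space lborel (cball 0 1)) (restrict_space borel (sphere 0 1))"
proof -
  have "(direction :: 'a \<Rightarrow> 'a) \<in> borel_measurable borel"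
    unfolding direction_def by measurable
  then have "(direction :: 'a \<Rightarrow> 'a) \<in> borel_measurable (restrict_space lborel (cball 0 1))"
    by (intro measurable_restrict_space1) (simp add: measurable_lborel1)
  then show ?thesis
    by (intro measurable_restrict_space2) auto
qed

lemma emeasure_sphere_measure:
  fixes A :: "'a::euclidean_space set"
  assumes "A \<in> sets borel" "A \<subseteq> sphere 0 1"
  shows "emeasure sphere_measure A =
    of_nat DIM('a) * emeasure lborel {x \<in> cball 0 1. direction x \<in> A}"
proof -
  have "A \<in> sets (restrict_space borel (sphere 0 1))"
    using assms by (auto simp: sets_restrict_space_iff)
  then have "emeasure sphere_measure A = of_nat DIM('a) *
      emeasure (restrict_space lborel (cball 0 1)) (direction -` A \<inter> cball 0 1)"
    by (simp add: sphere_measure_def emeasure_distr[OF measurable_direction] space_restrict_space)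
  also have "emeasure (restrict_space lborel (cball 0 1)) (direction -` A \<inter> cball 0 1) =
      emeasure lborel (direction -` A \<inter> cball 0 1)"
    by (intro emeasure_restrict_space) auto
  also have "direction -` A \<inter> cball 0 1 = {x \<in> cball 0 1. direction x \<in> A}" by auto
  finally show ?thesis .
qed

lemma emeasure_sphere_measure_sphere:
  "emeasure (sphere_measure :: 'a::euclidean_space measure) (sphere 0 1) = ennreal (sphere_area DIM('a))"
proof -
  have "emeasure (sphere_measure :: 'a measure) (sphere 0 1) =
      of_nat DIM('a) * emeasure lborel (cball (0::'a) 1)"
    by (simp add: emeasure_sphere_measure cball_def)
  also have "\<dots> = ennreal (real DIM('a) * unit_ball_vol (real DIM('a)))"
    by (simp add: emeasure_cball ennreal_mult'' ennreal_of_nat_eq_real_of_nat)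
  also have "real DIM('a) * unit_ball_vol (real DIM('a)) = sphere_area DIM('a)"
  proof -
    have "real DIM('a) / 2 \<notin> \<int>\<^sub>\<le>\<^sub>0"
    proof
      assume "real DIM('a) / 2 \<in> \<int>\<^sub>\<le>\<^sub>0"
      then have "real DIM('a) / 2 \<le> 0" by (rule nonpos_Ints_nonpos)
      then show False by simp
    qed
    then have "Gamma (real DIM('a) / 2 + 1) = real DIM('a) / 2 * Gamma (real DIM('a) / 2)"
      by (intro Gamma_plus1) auto
    then show ?thesis
      unfolding unit_ball_vol_def sphere_area_def by (simp only:) simp
  qed
  finally show ?thesis .
qed

end

theory Submission
  imports Defs
begin

text \<open>
  Write \<open>d = 2 e + 3\<close> and let \<open>P n\<close> be the Legendre polynomials, orthogonal for the weight
  \<open>(1 - t\<^sup>2) ^ e\<close>. The coefficient recursions coming from the differential equation of \<open>P n\<close>,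
  together with the Funk-Hecke formula, give the ridge representation
  \<open>V x = b \<integral> P' (m + 1) (x \<bullet> \<xi>) Y \<xi> d\<xi>\<close> on the ball. Integrating it along the chord from
  \<open>a\<close> in direction \<open>w\<close>, whose other endpoint is the reflection of \<open>a\<close> in the hyperplane
  orthogonal to \<open>w\<close>, yields the difference quotient of \<open>P (m + 1) (a \<bullet> \<xi>)\<close> under this reflection.
  Since polynomials of degree at most \<open>2 m + 1\<close> are orthogonal to \<open>P (2 m + 2) (w \<bullet> \<xi>)\<close>, the singular kernel
  \<open>1 / (w \<bullet> \<xi>)\<close> may be replaced by the polynomial \<open>h t = (1 - P (2 m + 2) t / P (2 m + 2) 0) / t\<close>,
  and the odd divergent beam transform of \<open>V\<close> becomes
  \<open>- b \<integral> P (m + 1) (a \<bullet> \<xi>) h (w \<bullet> \<xi>) Y \<xi> d\<xi>\<close>. Its Gram matrix follows from Funk-Hecke once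
  more: integrating out \<open>a\<close> gives a multiple of \<open>P (m + 1) (\<xi> \<bullet> \<eta>)\<close>, integrating out \<open>w\<close> gives the
  convolution square of \<open>h\<close>, whose Legendre coefficients are, up to a constant, the
  \<open>\<nu>\<^sup>2 N\<close> of the singular value. The singular value is positive because each triple product of Legendre
  polynomials is the norm of such a form, and these products, weighted with \<open>N\<close>, have a positive sum.
\<close>

section \<open>Polynomial integrals and Legendre polynomials\<close>

text \<open>The kernel \<open>1 / (w \<bullet> \<xi>)\<close> is not integrable over the sphere, so
  Fubini and Funk-Hecke do not apply to it directly. The polynomial substitute is exact because the
  difference quotient is itself a polynomial in \<open>\<xi>\<close> of degree \<open>m\<close>, and
  its product with \<open>Y\<close> stays below degree \<open>2 m + 2\<close>. For odd
  \<open>d\<close> the weight is a polynomial too, so integrals become finite sums of moments and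
  continuity settles integrability. The odd part makes one formula valid for all
  \<open>(a, w)\<close>: at most one of the two rays from \<open>a\<close> enters the ball, and the
  chord integral is odd in \<open>w\<close>. Reflections are the only isometries used; they act
  transitively on each sphere, which already determines all moments. The kernel \<open>h\<close>
  depends on \<open>m\<close>, but its Legendre coefficients are those of \<open>1 / t\<close> cut
  off at degree \<open>2 m + 1\<close>, and degrees above \<open>m + 1 + l\<close> do not interact
  with \<open>P (m + 1)\<close> and a \<open>Y\<close> of degree \<open>l\<close>. They equal
  \<open>- (d - 2)!! \<nu> N\<close> for odd degrees, and
  \<open>2 ^ (d + 1) \<pi> ^ (d - 1) = ((d - 2)!! |S ^ (d - 1)|) ^ 2\<close> turns the double
  factorial into \<open>\<mu>\<close>.\<close>

abbreviation (input) hdim :: "nat \<Rightarrow> nat \<Rightarrow> real" where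
  "hdim e n \<equiv> real (harmonic_dim n (2 * e + 3))"

abbreviation quad :: "real poly" where "quad \<equiv> [:1, 0, -1:]"

definition pint :: "real poly \<Rightarrow> real" where
  "pint p = integral {-1..1} (\<lambda>t. poly p t)"

lemma poly_integrable [simp]: "poly p integrable_on {-1..1::real}"
  by (intro integrable_continuous_interval continuous_intros)

lemma pint_add: "pint (p + r) = pint p + pint r"
  by (simp add: pint_def integral_add)

lemma pint_smult: "pint (smult c p) = c * pint p"
  by (simp add: pint_def)

lemma pint_0 [simp]: "pint 0 = 0" by (simp add: pint_def)

lemma pint_minus: "pint (- p) = - pint p" using pint_smult[of "-1" p] by simp

lemma pint_diff: "pint (p - r) = pint p - pint r"
  using pint_add[of p "- r"] pint_minus[of r] by simp

lemma pint_sum: "pint (sum f A) = (\<Sum>i\<in>A. pint (f i))"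
  by (induction A rule: infinite_finite_induct) (auto simp: pint_add)

lemma pint_pderiv: "pint (pderiv p) = poly p 1 - poly p (-1)"
proof -
  have "(poly (pderiv p) has_integral (poly p 1 - poly p (-1))) {-1..1}"
    by (rule fundamental_theorem_of_calculus)
      (auto intro!: DERIV_subset[OF poly_DERIV] simp flip: has_real_derivative_iff_has_vector_derivative)
  then show ?thesis by (simp add: pint_def integral_unique)
qed

lemma pint_by_parts:
  assumes "poly f 1 * poly g 1 = 0" "poly f (-1) * poly g (-1) = 0"
  shows "pint (f * pderiv g) = - pint (pderiv f * g)"
  using pint_pderiv[of "f * g"] assms by (simp add: pderiv_mult pint_add mult.commute)

lemma pint_pcompose_neg: "pint (pcompose p [:0, -1:]) = pint p"
proof -
  have "pint p = integral {- 1.. - (-1)} (poly p)" by (simp add: pint_def)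
  also have "\<dots> = integral {-1..1} (\<lambda>x. poly p (- x))"
    using Henstock_Kurzweil_Integration.integral_reflect_real[of 1 "-1" "poly p"] by simp
  finally show ?thesis by (simp add: pint_def poly_pcompose)
qed

lemma pint_odd:
  assumes "pcompose p [:0, -1:] = - p"
  shows "pint p = 0"
  using pint_pcompose_neg[of p] assms by (simp add: pint_minus)

lemma pint_nonneg:
  assumes "\<And>t. t \<in> {-1..1} \<Longrightarrow> poly p t \<ge> 0"
  shows "pint p \<ge> 0"
  unfolding pint_def by (rule integral_nonneg) (use assms in auto)

lemma pint_pos:
  assumes nn: "\<And>t. t \<in> {-1..1} \<Longrightarrow> poly p t \<ge> 0" and "p \<noteq> 0"
  shows "pint p > 0"
proof -
  have "pint p \<noteq> 0"
  proof
    assume "pint p = 0"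
    then have "\<forall>t\<in>{-1..1}. poly p t = 0"
      using integral_eq_0_iff[of "-1" 1 "poly p"] nn
      by (force simp: pint_def intro!: continuous_intros)
    then have "{-1..1} \<subseteq> {t. poly p t = 0}" by auto
    moreover have "infinite {-1..1::real}" by (simp add: infinite_Icc)
    ultimately show False using poly_roots_finite[OF \<open>p \<noteq> 0\<close>] finite_subset by blast
  qed
  with pint_nonneg[OF nn] show ?thesis by fastforce
qed

text \<open>For \<open>d = 2 e + 3\<close> the exponent \<open>(d - 3) / 2\<close> is the natural
  number \<open>e\<close>, so the Legendre weight is a polynomial and weighted integrals stay
  polynomial integrals. Up to the factor \<open>equator e\<close>, this weight is also the density
  of the surface measure projected onto a diameter (\<open>integral_zonal\<close>).\<close>

definition wint :: "nat \<Rightarrow> real poly \<Rightarrow> real" where "wint e p = pint (p * quad ^ e)"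

definition leg :: "nat \<Rightarrow> nat \<Rightarrow> real poly" where "leg e n = legendre n (2 * e + 3)"

lemma wint_add: "wint e (p + r) = wint e p + wint e r" by (simp add: wint_def algebra_simps pint_add)
lemma wint_diff: "wint e (p - r) = wint e p - wint e r" by (simp add: wint_def algebra_simps pint_diff)
lemma wint_smult: "wint e (smult c p) = c * wint e p" by (simp add: wint_def pint_smult)
lemma wint_0 [simp]: "wint e 0 = 0" by (simp add: wint_def)
lemma wint_sum: "wint e (sum f A) = (\<Sum>i\<in>A. wint e (f i))"
  by (simp add: wint_def sum_distrib_right pint_sum)

lemma quad_nonneg: "t \<in> {-1..1} \<Longrightarrow> poly quad t \<ge> 0"
  by (auto simp: power2_eq_square[symmetric] abs_square_le_1 abs_le_iff)

lemma wint_sq_pos: "p \<noteq> 0 \<Longrightarrow> wint e (p * p) > 0"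
  unfolding wint_def by (rule pint_pos) (auto simp: quad_nonneg simp del: poly_pCons)

lemma pcompose_power_left: "pcompose (p ^ n) r = pcompose p r ^ n"
  by (induction n) (auto simp: pcompose_mult pcompose_1)

lemma quad_reflect: "pcompose quad [:0, -1:] = quad" by (simp add: pcompose_pCons)

lemma wint_odd:
  assumes "pcompose p [:0, -1:] = - p"
  shows "wint e p = 0"
  unfolding wint_def by (rule pint_odd) (simp add: pcompose_mult pcompose_power_left assms quad_reflect)

text \<open>The quotient of double factorials in Rodrigues' formula, rewritten by
  \<open>double_fact_even\<close>; the sign \<open>(-1) ^ n\<close> is kept apart because
  integration by parts cancels it.\<close>

definition rodrigues_const :: "nat \<Rightarrow> nat \<Rightarrow> real" where "rodrigues_const e n = fact e / (2 ^ n
  * fact (n + e))"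

lemma leg_rodrigues:
  "leg e n * quad ^ e = smult ((-1) ^ n * rodrigues_const e n) ((pderiv ^^ n) (quad ^ (n + e)))"
proof -
  have "double_fact (2 * n + (2 * e + 3) - 3) = 2 ^ (n + e) * fact (n + e)"
    using double_fact_even[of "n + e"] by (simp add: algebra_simps)
  moreover have "double_fact (2 * e + 3 - 3) = 2 ^ e * fact e"
    using double_fact_even[of e] by simp
  moreover have "(2 * e + 3 - 3) div 2 = e" by simp
  ultimately show ?thesis using legendre_mult(1)[of "2 * e + 3" n]
    by (simp add: rodrigues_const_def power_add leg_def)
qed

lemma leg_1 [simp]: "poly (leg e n) 1 = 1"
  using legendre_mult(2)[of "2 * e + 3" n] by (simp add: leg_def)

lemma pderiv_quad_vanishes:
  assumes "j < N" "t = 1 \<or> t = -1"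
  shows "poly ((pderiv ^^ j) (quad ^ N)) t = 0"
  using legendre_aux[of j N] assms by (auto simp: zero_power)

text \<open>No boundary terms arise: fewer than \<open>n + e\<close> derivatives of
  \<open>quad ^ (n + e)\<close> leave a factor \<open>quad\<close>, which vanishes at both
  ends.\<close>

lemma rodrigues_parts:
  "j \<le> n \<Longrightarrow> pint (g * (pderiv ^^ n) (quad ^ (n + e)))
     = (-1) ^ j * pint ((pderiv ^^ j) g * (pderiv ^^ (n - j)) (quad ^ (n + e)))"
proof (induction j)
  case (Suc j)
  then have "n - j = Suc (n - Suc j)" by simp
  then have "pint ((pderiv ^^ j) g * (pderiv ^^ (n - j)) (quad ^ (n + e)))
      = - pint ((pderiv ^^ Suc j) g * (pderiv ^^ (n - Suc j)) (quad ^ (n + e)))"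
    using pint_by_parts[of "(pderiv ^^ j) g" "(pderiv ^^ (n - Suc j)) (quad ^ (n + e))"] Suc.prems
    by (simp add: pderiv_quad_vanishes)
  with Suc show ?case by simp
qed simp

text \<open>After \<open>n\<close> integrations by parts the sign cancels that of Rodrigues' formula
  and all derivatives sit on \<open>g\<close>. Orthogonality to lower degrees and the norm are both
  read off from this.\<close>

lemma wint_leg: "wint e (leg e n * g) = rodrigues_const e n * pint ((pderiv ^^ n) g * quad ^ (n + e))"
proof -
  have "wint e (leg e n * g) = pint (g * (leg e n * quad ^ e))" by (simp add: wint_def mult_ac)
  also have "\<dots> = (-1) ^ n * rodrigues_const e n * pint (g * (pderiv ^^ n) (quad ^ (n + e)))"
    by (simp add: leg_rodrigues pint_smult)
  finally show ?thesis using rodrigues_parts[of n n g e] by simp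
qed

lemma degree_higher_pderiv: "degree ((pderiv ^^ n) (p :: real poly)) = degree p - n"
  by (induction n) (auto simp: degree_pderiv)

lemma higher_pderiv_eq_0:
  assumes "degree (g :: real poly) < n"
  shows "(pderiv ^^ n) g = 0"
proof -
  have "degree ((pderiv ^^ degree g) g) = 0" by (simp add: degree_higher_pderiv)
  then have z: "(pderiv ^^ Suc (degree g)) g = 0" by (simp add: pderiv_eq_0_iff)
  have "(pderiv ^^ (k + Suc (degree g))) g = 0" for k
    by (induction k) (use z in auto)
  from this[of "n - Suc (degree g)"] show ?thesis using assms by simp
qed

lemma wint_leg_lower:
  assumes "degree g < n"
  shows "wint e (leg e n * g) = 0"
  by (simp add: wint_leg higher_pderiv_eq_0 assms)


lemma coeff_higher_pderiv_real:
  "coeff ((pderiv ^^ n) p) k = fact (n + k) / fact k * coeff (p :: real poly) (n + k)"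
proof (induction n arbitrary: k)
  case (Suc n)
  have f: "fact (Suc k) = real (Suc k) * fact k" by simp
  have "coeff ((pderiv ^^ Suc n) p) k = real (Suc k) * (fact (n + Suc k) / fact (Suc k) * coeff p (n + Suc k))"
    by (simp add: coeff_pderiv Suc del: of_nat_Suc fact_Suc)
  then show ?case unfolding f by (simp del: of_nat_Suc fact_Suc)
qed simp

lemma rodrigues_const_pos: "rodrigues_const e n > 0" by (simp add: rodrigues_const_def)

lemma leg_nonzero [simp]: "leg e n \<noteq> 0"
  using leg_1[of e n] by force

lemma degree_quad_power: "degree (quad ^ N) = 2 * N"
  by (simp add: degree_power_eq)

lemma degree_leg [simp]: "degree (leg e n) = n"
proof -
  have "degree (leg e n * quad ^ e) = degree (leg e n) + 2 * e"
    by (subst degree_mult_eq) (auto simp: degree_quad_power)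
  moreover have "degree (leg e n * quad ^ e) = n + 2 * e"
    unfolding leg_rodrigues using rodrigues_const_pos[of e n]
    by (simp add: degree_higher_pderiv degree_quad_power)
  ultimately show ?thesis by simp
qed

definition leg_lead :: "nat \<Rightarrow> nat \<Rightarrow> real" where
  "leg_lead e n = rodrigues_const e n * fact (2 * n + 2 * e) / fact (n + 2 * e)"

lemma lead_coeff_quad_power: "coeff (quad ^ N) (2 * N) = (-1) ^ N"
  using lead_coeff_power[of quad N] by (simp add: degree_quad_power)

lemma coeff_leg [simp]: "coeff (leg e n) n = leg_lead e n"
proof -
  have "coeff (leg e n) n * (-1) ^ e = coeff (leg e n * quad ^ e) (n + 2 * e)"
    using coeff_mult_degree_sum[of "leg e n" "quad ^ e"]
    by (simp add: degree_quad_power lead_coeff_quad_power)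
  also have "\<dots> = (-1) ^ n * rodrigues_const e n * (fact (n + (n + 2 * e)) / fact (n + 2 * e) * coeff (quad ^ (n
    + e)) (n + (n + 2 * e)))"
    by (simp add: leg_rodrigues coeff_higher_pderiv_real)
  also have "n + (n + 2 * e) = 2 * (n + e)" by simp
  finally have "coeff (leg e n) n * (-1) ^ e = leg_lead e n * (-1) ^ e * ((-1) ^ n * (-1) ^ n)"
    unfolding lead_coeff_quad_power by (simp add: leg_lead_def power_add algebra_simps)
  then show ?thesis by (simp flip: power_mult_distrib)
qed

lemma leg_lead_pos: "leg_lead e n > 0" by (simp add: leg_lead_def rodrigues_const_pos)

lemma leg_reflect: "pcompose (leg e n) [:0, -1:] = smult ((-1) ^ n) (leg e n)"
proof -
  have *: "pcompose ((pderiv ^^ j) (quad ^ N)) [:0, -1:] = smult ((-1) ^ j) ((pderiv ^^ j) (quad ^ N))" for j N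
  proof (induction j)
    case 0
    show ?case by (simp add: pcompose_power_left quad_reflect)
  next
    case (Suc j)
    have "- pcompose (pderiv ((pderiv ^^ j) (quad ^ N))) [:0, -1:]
      = pderiv (pcompose ((pderiv ^^ j) (quad ^ N)) [:0, -1:])"
      by (simp add: pderiv_pcompose pderiv_pCons)
    then have "pcompose (pderiv ((pderiv ^^ j) (quad ^ N))) [:0, -1:] =
      - pderiv (smult ((-1) ^ j) ((pderiv ^^ j) (quad ^ N)))"
      unfolding Suc by (metis minus_minus)
    then show ?case by (simp add: pderiv_smult)
  qed
  have "pcompose (leg e n) [:0, -1:] * quad ^ e = pcompose (leg e n * quad ^ e) [:0, -1:]"
    by (simp add: pcompose_mult pcompose_power_left quad_reflect)
  also have "\<dots> = smult ((-1) ^ n) (leg e n) * quad ^ e"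
    by (simp only: leg_rodrigues * pcompose_smult mult_smult_left smult_smult mult.commute)
  finally show ?thesis by (subst (asm) mult_cancel_right) simp
qed

lemma poly_leg_minus: "poly (leg e n) (- t) = (-1) ^ n * poly (leg e n) t"
  using arg_cong[OF leg_reflect, of "\<lambda>p. poly p t" e n] by (simp add: poly_pcompose)

lemma coeff_parity:
  assumes "pcompose p [:0, -1:] = smult ((-1) ^ n) (p :: real poly)" "odd (k + n)"
  shows "coeff p k = 0"
proof -
  have "coeff (pcompose p [:0, -1:]) k = (-1) ^ k * coeff p k"
    by (simp add: coeff_pcompose_linear)
  with assms have "(-1) ^ k * coeff p k = (-1) ^ n * coeff p k" by (metis coeff_smult)
  moreover have "(-1 :: real) ^ k \<noteq> (-1) ^ n" using assms(2) by (cases "even n") auto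
  ultimately show ?thesis by simp
qed

lemma wint_leg_leg: "n \<noteq> k \<Longrightarrow> wint e (leg e n * leg e k) = 0"
  using wint_leg_lower[of "leg e k" n e] wint_leg_lower[of "leg e n" k e]
  by (cases n k rule: linorder_cases) (auto simp: mult.commute)

lemma wint_leg_leg_pos: "wint e (leg e n * leg e n) > 0"
  by (simp add: wint_sq_pos)

text \<open>Removing the multiple of \<open>leg e n\<close> with the same coefficient of degree
  \<open>n\<close> leaves a remainder of lower degree that is orthogonal to itself. The recurrence,
  the differential equation and the zonal Funk-Hecke formula all rest on this.\<close>

lemma orth_imp_leg:
  assumes deg: "degree p \<le> n" and orth: "\<And>g. degree g < n \<Longrightarrow> wint e (p * g) = 0"
  shows "p = smult (poly p 1) (leg e n)"
proof -
  define r where "r = p - smult (coeff p n / leg_lead e n) (leg e n)"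
  have "r = 0"
  proof (rule ccontr)
    assume "r \<noteq> 0"
    have "degree r \<le> n" unfolding r_def using deg by (intro degree_diff_le) auto
    moreover have "coeff r n = 0" using leg_lead_pos[of e n] by (simp add: r_def)
    then have "degree r \<noteq> n" using \<open>r \<noteq> 0\<close> by auto
    ultimately have "degree r < n" by simp
    then have "wint e (r * r) = 0"
      \<comment> \<open>Only the left factor of \<open>r * r\<close> is expanded; the right factor
        serves as the test polynomial of degree below \<open>n\<close>.\<close>
      unfolding r_def[THEN arg_cong[where f="\<lambda>x. x * r"]] left_diff_distrib
      by (simp add: wint_diff wint_smult orth wint_leg_lower)
    with wint_sq_pos[OF \<open>r \<noteq> 0\<close>, of e] show False by simp
  qed
  then have p: "p = smult (coeff p n / leg_lead e n) (leg e n)" by (simp add: r_def)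
  have "poly p 1 = coeff p n / leg_lead e n" by (subst p) simp
  with p show ?thesis by metis
qed

lemma leg_expansion:
  assumes "degree p \<le> N"
  shows "p = (\<Sum>n\<le>N. smult (wint e (p * leg e n) / wint e (leg e n * leg e n)) (leg e n))"
proof -
  have "\<exists>c. p = (\<Sum>n\<le>N. smult (c n) (leg e n))" using assms
  proof (induction N arbitrary: p)
    case 0
    then obtain a where "p = [:a:]" by (metis degree_eq_zeroE le_zero_eq)
    moreover obtain b where b: "leg e 0 = [:b:]" by (metis degree_leg degree_eq_zeroE)
    moreover have "b = 1" using leg_1[of e 0] by (simp add: b)
    ultimately show ?case by (intro exI[of _ "\<lambda>_. a"]) simp
  next
    case (Suc N)
    let ?r = "p - smult (coeff p (Suc N) / leg_lead e (Suc N)) (leg e (Suc N))"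
    have "degree ?r \<le> Suc N" using Suc.prems by (intro degree_diff_le) auto
    moreover have "coeff ?r (Suc N) = 0" using leg_lead_pos[of e "Suc N"] by simp
    ultimately have "degree ?r \<le> N"
      by (metis degree_0 le_SucE leading_coeff_0_iff zero_le)
    from Suc.IH[OF this] obtain c where "?r = (\<Sum>n\<le>N. smult (c n) (leg e n))" by auto
    then have "p = (\<Sum>n\<le>N. smult (c n) (leg e n)) + smult (coeff p (Suc N)
      / leg_lead e (Suc N)) (leg e (Suc N))"
      by (simp add: algebra_simps)
    then show ?case
      by (intro exI[of _ "c(Suc N := coeff p (Suc N) / leg_lead e (Suc N))"]) simp
  qed
  then obtain c where c: "p = (\<Sum>n\<le>N. smult (c n) (leg e n))" by blast
  have "wint e (p * leg e n) = c n * wint e (leg e n * leg e n)" if "n \<le> N" for n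
  proof -
    have "wint e (p * leg e n) = (\<Sum>k\<le>N. c k * wint e (leg e k * leg e n))"
      by (simp add: c sum_distrib_right wint_sum wint_smult)
    also have "\<dots> = (\<Sum>k\<le>N. if k = n then c n * wint e (leg e n * leg e n) else 0)"
      by (intro sum.cong) (auto simp: wint_leg_leg)
    finally show ?thesis using that by simp
  qed
  then have "wint e (p * leg e n) / wint e (leg e n * leg e n) = c n" if "n \<le> N" for n
    using that wint_leg_leg_pos[of e n] by simp
  then show ?thesis using c by (metis (no_types, lifting) atMost_iff sum.cong)
qed

text \<open>The derivative of \<open>t * quad ^ Suc p\<close> integrates to zero, which relates
  consecutive powers.\<close>

lemma pint_quad_power: "pint (quad ^ p) = 2 ^ (2 * p + 1) * (fact p)\<^sup>2 / fact (2 * p + 1)"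
proof (induction p)
  case 0
  have "pint (pderiv [:0, 1:]) = 2" unfolding pint_pderiv by simp
  then show ?case by (simp add: pderiv_pCons flip: one_pCons)
next
  case (Suc p)
  have t2: "[:0, 1:] * pderiv quad = smult 2 quad - 2"
    by (simp add: pderiv_pCons numeral_poly)
  have "pderiv ([:0, 1:] * quad ^ Suc p) = quad ^ Suc p + smult (of_nat (Suc p)) (quad ^ p * ([:0, 1:]
    * pderiv quad))"
    by (simp add: pderiv_mult pderiv_power_Suc pderiv_pCons algebra_simps del: power_Suc of_nat_Suc)
  also have "\<dots> = smult (2 * real p + 3) (quad ^ Suc p) - smult (2 * real p + 2) (quad ^ p)"
    unfolding t2 by (subst poly_eq_poly_eq_iff[symmetric], rule ext) (simp add: algebra_simps)
  finally have "(2 * real p + 3) * pint (quad ^ Suc p) = (2 * real p + 2) * pint (quad ^ p)"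
    using pint_pderiv[of "[:0, 1:] * quad ^ Suc p"] by (simp add: pint_diff pint_smult)
  then have "pint (quad ^ Suc p) = (2 * real p + 2) / (2 * real p + 3) * pint (quad ^ p)"
    by (simp add: field_simps)
  also have "\<dots> = 2 ^ (2 * Suc p + 1) * (fact (Suc p))\<^sup>2 / fact (2 * Suc p + 1)"
    unfolding Suc.IH by (simp add: divide_simps power2_eq_square) (simp add: algebra_simps)
  finally show ?case .
qed

lemma higher_pderiv_leg: "(pderiv ^^ n) (leg e n) = [:fact n * leg_lead e n:]"
proof -
  have "degree ((pderiv ^^ n) (leg e n)) = 0" by (simp add: degree_higher_pderiv)
  then obtain a where a: "(pderiv ^^ n) (leg e n) = [:a:]" by (metis degree_eq_zeroE)
  have "coeff ((pderiv ^^ n) (leg e n)) 0 = fact n * leg_lead e n"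
    by (simp add: coeff_higher_pderiv_real)
  with a show ?thesis by simp
qed

text \<open>Apply \<open>wint_leg\<close> to \<open>g = leg e n\<close>: its \<open>n\<close>-th
  derivative is constant, so only the integral of \<open>quad ^ (n + e)\<close> is left. This is how
  the dimension \<open>N\<close> of the space of harmonics enters the normalizations.\<close>

lemma wint_leg_sq: "wint e (leg e n * leg e n) = wint e 1 / hdim e n"
proof -
  have "wint e (leg e n * leg e n) = rodrigues_const e n * (fact n * leg_lead e n * pint (quad ^ (n + e)))"
    by (simp add: wint_leg higher_pderiv_leg pint_smult)
  also have "\<dots> = (fact e)\<^sup>2 * fact n * 2 ^ (2 * e + 1) / (fact (n + 2 * e) * real (2 * n + 2 * e + 1))"
  proof -
    have f: "fact (2 * (n + e) + 1) = real (2 * n + 2 * e + 1) * (fact (2 * n + 2 * e) :: real)"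
      using fact_Suc[of "2 * n + 2 * e", where ?'a = real] by (simp only: distrib_left Suc_eq_plus1 of_nat_id)
    have "2 * (n + e) + 1 = n + n + (2 * e + 1)" by simp
    then have p: "(2::real) ^ (2 * (n + e) + 1) = 2 ^ n * 2 ^ n * 2 ^ (2 * e + 1)"
      by (simp only: power_add)
    have aux: "E / (T * A) * (k * (E / (T * A) * F / G) * ((T * T * S) * A\<^sup>2 / (m * F))) = E\<^sup>2 * k * S
      / (G * m)"
      if "A \<noteq> 0" "F \<noteq> 0" "T \<noteq> 0" for A E F G S T k m :: real
      using that by (simp add: power2_eq_square)
    show ?thesis unfolding pint_quad_power f p rodrigues_const_def leg_lead_def
      by (rule aux) simp_all
  qed
  finally have 1: "wint e (leg e n * leg e n) = (fact e)\<^sup>2 * fact n * 2 ^ (2 * e + 1) / (fact (n + 2 * e)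
    * real (2 * n + 2 * e + 1))" .
  have 2: "wint e 1 = 2 ^ (2 * e + 1) * (fact e)\<^sup>2 / fact (2 * e + 1)"
    by (simp only: wint_def mult_1 pint_quad_power)
  have "hdim e n = real (2 * n + 2 * e + 1) * fact (n + 2 * e) / (fact n * fact (2 * e + 1))"
    by (simp add: of_nat_harmonic_dim)
  then show ?thesis unfolding 1 2
    by (simp add: mult_ac del: of_nat_add of_nat_mult of_nat_Suc fact_Suc)
qed


section \<open>The three-term recurrence and Legendre polynomials divided by
  \<open>t\<close>\<close>

lemma leg_0 [simp]: "leg e 0 = 1"
proof -
  obtain b where b: "leg e 0 = [:b:]" by (metis degree_leg degree_eq_zeroE)
  then show ?thesis using leg_1[of e 0] by (simp add: one_pCons)
qed

lemma leg_Suc_0 [simp]: "leg e (Suc 0) = [:0, 1:]"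
proof -
  have "wint e ([:0, 1:] * g) = 0" if "degree g < Suc 0" for g
  proof -
    have "degree g = 0" using that by simp
    then obtain a where "g = [:a:]" by (rule degree_eq_zeroE)
    then show ?thesis by (intro wint_odd) (simp add: pcompose_pCons)
  qed
  then show ?thesis using orth_imp_leg[of "[:0, 1:]" "Suc 0" e] by simp
qed

text \<open>\<open>t P (n + 1)\<close> minus the multiple of \<open>P (n + 2)\<close> with the same
  leading coefficient has degree at most \<open>n\<close>, since parity removes the coefficient of
  degree \<open>n + 1\<close>. It is orthogonal to degrees below \<open>n\<close>, hence a multiple
  of \<open>P n\<close>, and the value at 1 gives the factor.\<close>

lemma leg_recurrence:
  "pCons 0 (leg e (Suc n)) = smult (real (n + 2 * e + 2) / real (2 * n + 2 * e + 3)) (leg e (n + 2))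
     + smult (real (n + 1) / real (2 * n + 2 * e + 3)) (leg e n)"
proof -
  define \<alpha> where "\<alpha> = leg_lead e (Suc n) / leg_lead e (n + 2)"
  define r where "r = pCons 0 (leg e (Suc n)) - smult \<alpha> (leg e (n + 2))"
  have \<alpha>: "\<alpha> = real (n + 2 * e + 2) / real (2 * n + 2 * e + 3)"
  proof -
    have rod: "rodrigues_const e (Suc n) = rodrigues_const e (n + 2) * (2 * real (n + 2 + e))"
    proof -
      have "n + 2 + e = Suc (Suc n + e)" by simp
      then have f: "fact (n + 2 + e) = real (n + 2 + e) * (fact (Suc n + e) :: real)"
        by (simp only: fact_Suc)
      have "a / (2 * t * F) = a / (2 * (2 * t) * (c * F)) * (2 * c)" if "c \<noteq> 0" for a t F c :: real
        using that by simp
      moreover have "(2::real) ^ Suc n = 2 * 2 ^ n" "(2::real) ^ (n + 2) = 2 * (2 * 2 ^ n)" by simp_all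
      ultimately show ?thesis unfolding rodrigues_const_def f by (simp only:)
    qed
    have f1: "fact (2 * (n + 2) + 2 * e) = real (2 * n + 2 * e + 4) * real (2 * n + 2 * e + 3) * (fact (2 * Suc n + 2
      * e) :: real)"
    proof -
      have "2 * (n + 2) + 2 * e = Suc (Suc (2 * Suc n + 2 * e))" by simp
      then show ?thesis by (simp only: fact_Suc) (simp add: algebra_simps)
    qed
    have f2: "fact (n + 2 + 2 * e) = real (n + 2 * e + 2) * (fact (Suc n + 2 * e) :: real)"
    proof -
      have "n + 2 + 2 * e = Suc (Suc n + 2 * e)" by simp
      then show ?thesis by (simp only: fact_Suc) simp
    qed
    have two: "2 * real (n + 2 + e) = real (2 * n + 2 * e + 4)" by simp
    have aux: "(R * c) * F / G / (R * (c * b * F) / (a * G)) = a / b"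
      if "R \<noteq> 0" "F \<noteq> 0" "G \<noteq> 0" "c \<noteq> 0" for a b c F G R :: real
      using that by simp
    show ?thesis unfolding \<alpha>_def leg_lead_def rod two f1 f2
      by (rule aux) (use rodrigues_const_pos[of e "n + 2"] in auto)
  qed
  have "r = smult (poly r 1) (leg e n)"
  proof (rule orth_imp_leg)
    have "degree r \<le> n + 2" unfolding r_def by (intro degree_diff_le) (auto simp: degree_pCons_le)
    moreover have "coeff r (n + 2) = 0"
      using leg_lead_pos[of e "n + 2"] by (simp add: r_def \<alpha>_def eval_nat_numeral del: coeff_leg flip:
        coeff_leg)
    moreover have "coeff r (Suc n) = 0"
    proof (rule coeff_parity[where n = n])
      show "pcompose r [:0, -1:] = smult ((-1) ^ n) r"
        by (simp add: r_def pcompose_diff pcompose_pCons pcompose_smult leg_reflect smult_diff_right mult.commute)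
    qed simp
    ultimately show "degree r \<le> n"
      by (metis add_2_eq_Suc' degree_0 le_SucE leading_coeff_0_iff zero_le)
    show "wint e (r * g) = 0" if "degree g < n" for g
    proof -
      have "r * g = leg e (Suc n) * pCons 0 g - smult \<alpha> (leg e (n + 2) * g)"
        by (simp add: r_def left_diff_distrib)
      moreover have "degree (pCons 0 g) < Suc n"
        using that degree_pCons_le[of 0 g] by linarith
      ultimately show ?thesis using that
        by (simp only: wint_diff wint_smult wint_leg_lower)
    qed
  qed
  moreover have "poly r 1 = real (n + 1) / real (2 * n + 2 * e + 3)"
    unfolding r_def \<alpha> by (simp add: field_simps)
  ultimately have "r = smult (real (n + 1) / real (2 * n + 2 * e + 3)) (leg e n)" by (simp only:)
  then show ?thesis unfolding r_def \<alpha> by (simp only: diff_eq_eq add.commute)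
qed

text \<open>The recurrence at \<open>t = 0\<close> links the values at steps of two in the degree.
  The division by such a value in \<open>hilbert_kernel\<close> relies on this.\<close>

lemma poly_leg_even_0: "poly (leg e (2 * j)) 0 \<noteq> 0"
proof (induction j)
  case (Suc j)
  have aux: "a * x = - b * y" if "0 = a / c * x + b / c * y" "c \<noteq> 0" for a b c x y :: real
    using that by (simp add: field_simps)
  have "0 = real (2 * j + 2 * e + 2) / real (2 * (2 * j) + 2 * e + 3) * poly (leg e (2 * j + 2)) 0
      + real (2 * j + 1) / real (2 * (2 * j) + 2 * e + 3) * poly (leg e (2 * j)) 0"
    using arg_cong[OF leg_recurrence[of e "2 * j"], of "\<lambda>p. poly p 0"]
    by (simp only: poly_pCons poly_add poly_smult mult_zero_left add_0_left)
  then have "real (2 * j + 2 * e + 2) * poly (leg e (2 * j + 2)) 0 = - real (2 * j + 1) * poly (leg e (2 * j)) 0"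
    by (rule aux) simp
  with Suc show ?case by auto
qed simp

lemma double_fact_pos: "double_fact n > 0"
  by (induction n rule: double_fact.induct) auto

text \<open>The quotient \<open>P n / t\<close> for odd \<open>n\<close>: the constant coefficient
  that \<open>poly_shift\<close> drops is then zero.\<close>

definition legdiv :: "nat \<Rightarrow> nat \<Rightarrow> real poly" where
  "legdiv e n = poly_shift 1 (leg e n)"

lemma pCons_0_poly_shift: "coeff p 0 = 0 \<Longrightarrow> pCons 0 (poly_shift 1 p) = p"
  by (rule poly_eqI) (simp add: coeff_pCons coeff_poly_shift split: nat.split)

lemma legdiv: "odd n \<Longrightarrow> pCons 0 (legdiv e n) = leg e n"
  unfolding legdiv_def using leg_reflect by (intro pCons_0_poly_shift coeff_parity) auto

text \<open>This is the origin of \<open>nu\<close>. Divide the recurrence by \<open>t\<close> and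
  integrate: \<open>P (n + 1)\<close> contributes zero, and the remaining two-term relation is the
  one that \<open>nu\<close> satisfies. The start \<open>P 1 / t = 1\<close> fixes the constant
  \<open>(d - 2)!!\<close>.\<close>

lemma wint_legdiv: "odd n \<Longrightarrow> wint e (legdiv e n) = - real (double_fact (2 * e + 1)) * wint e 1
  * nu n (2 * e + 3)"
proof -
  have "wint e (legdiv e (2 * j + 1)) = - real (double_fact (2 * e + 1)) * wint e 1 * nu (2 * j + 1) (2 * e
    + 3)" for j
  proof (induction j)
    case 0
    have "pCons 0 (legdiv e 1) = pCons 0 1" using legdiv[of 1 e] by (simp add: one_pCons)
    then have "legdiv e 1 = 1" by simp
    moreover have "double_fact (2 * e + 1) > 0" by (rule double_fact_pos)
    ultimately show ?case by (simp add: nu_def)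
  next
    case (Suc j)
    let ?n = "2 * j + 1"
    have "pCons 0 (leg e (Suc ?n)) = pCons 0 (smult (real (?n + 2 * e + 2) / real (2 * ?n + 2 * e + 3)) (legdiv e (?n
      + 2))
       + smult (real (?n + 1) / real (2 * ?n + 2 * e + 3)) (legdiv e ?n))"
    proof -
      have "leg e (?n + 2) = pCons 0 (legdiv e (?n + 2))" "leg e ?n = pCons 0 (legdiv e ?n)"
        by (simp_all add: legdiv)
      then show ?thesis
        by (simp only: leg_recurrence smult_pCons add_pCons mult_zero_right add_0_left)
    qed
    then have "wint e (leg e (Suc ?n) * 1) = wint e (smult (real (?n + 2 * e + 2) / real (2 * ?n + 2 * e
      + 3)) (legdiv e (?n + 2))
       + smult (real (?n + 1) / real (2 * ?n + 2 * e + 3)) (legdiv e ?n))"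
      by simp
    then have "real (?n + 2 * e + 2) * wint e (legdiv e (?n + 2)) = - real (?n + 1) * wint e (legdiv e ?n)"
      by (subst (asm) wint_leg_lower) (simp_all add: wint_add wint_smult divide_simps, simp add: algebra_simps)
    then have 1: "wint e (legdiv e (?n + 2)) = - real (?n + 1) / real (?n + 2 * e + 2) * wint e (legdiv e ?n)"
      by (simp add: field_simps)
    have 2: "nu (?n + 2) (2 * e + 3) = - real (?n + 1) / real (?n + 2 * e + 2) * nu ?n (2 * e + 3)"
    proof -
      have "?n + 2 - 1 = Suc (Suc (2 * j))" "?n + 2 + (2 * e + 3) - 3 = Suc (Suc (2 * j + 2 * e + 1))"
        "?n + (2 * e + 3) - 3 = 2 * j + 2 * e + 1" "(?n + 2 + 1) div 2 = Suc (Suc j)" "(?n + 1) div 2 = Suc j"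
        "?n - 1 = 2 * j"
        by auto
      moreover have "double_fact (Suc (Suc (2 * j))) = (?n + 1) * double_fact (2 * j)"
        "double_fact (Suc (Suc (2 * j + 2 * e + 1))) = (?n + 2 * e + 2) * double_fact (2 * j + 2 * e + 1)"
        by (simp_all only: double_fact.simps) simp_all
      moreover have "- 1 * s * (p * a) / (q * b) = - p / q * (s * a / b)" for s p q a b :: real by simp
      ultimately show ?thesis unfolding nu_def
        by (simp only: of_nat_mult power_Suc[of _ "Suc j"])
    qed
    have "2 * Suc j + 1 = ?n + 2" by simp
    then show ?case unfolding 1 2 Suc.IH by (simp only: 1 2 Suc.IH) simp
  qed
  moreover assume "odd n"
  ultimately show ?thesis by (metis oddE)
qed

section \<open>The Legendre differential operator and the coefficient recursions it yields\<close>

definition ode :: "nat \<Rightarrow> real poly \<Rightarrow> real poly" where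
  "ode e p = quad * pderiv (pderiv p) - smult (2 * real e + 2) (pCons 0 (pderiv p))"

lemma coeff_ode:
  "coeff (ode e p) k = real ((k + 2) * (k + 1)) * coeff p (k + 2) - real (k * (k + 2 * e + 1)) * coeff p k"
proof -
  have q: "quad * r = r - pCons 0 (pCons 0 r)" for r by simp
  consider "k = 0" | "k = 1" | j where "k = Suc (Suc j)" by (metis One_nat_def not0_implies_Suc)
  then show ?thesis
    by cases (simp_all add: ode_def q coeff_pderiv algebra_simps eval_nat_numeral coeff_pCons)
qed

lemma degree_ode: "degree (ode e p) \<le> degree p"
  by (intro degree_le) (auto simp: coeff_ode coeff_eq_0)

text \<open>Divergence form of \<open>(1 - t^2) p'' - (d - 1) t p'\<close>, the operator that the
  Laplacian of the sphere induces on zonal functions. It makes \<open>ode\<close> symmetric for the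
  weight, as \<open>quad ^ Suc e\<close> vanishes at both ends.\<close>

lemma ode_mult_weight: "ode e p * quad ^ e = pderiv (pderiv p * quad ^ Suc e)"
  by (subst poly_eq_poly_eq_iff[symmetric], rule ext)
    (simp add: ode_def pderiv_mult pderiv_power_Suc pderiv_pCons algebra_simps
      del: mult_pCons_left mult_pCons_right power_Suc, simp add: algebra_simps)

lemma wint_ode: "wint e (ode e p * g) = - pint (pderiv p * pderiv g * quad ^ Suc e)"
proof -
  have "wint e (ode e p * g) = pint (g * pderiv (pderiv p * quad ^ Suc e))"
    by (simp only: wint_def mult_ac flip: ode_mult_weight)
  also have "\<dots> = - pint (pderiv g * (pderiv p * quad ^ Suc e))"
    by (rule pint_by_parts) simp_all
  finally show ?thesis by (simp only: mult_ac)
qed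

text \<open>\<open>ode\<close> is symmetric and does not raise degrees, so the image of
  \<open>leg e n\<close> is again orthogonal to all lower degrees; comparing coefficients of degree
  \<open>n\<close> gives the eigenvalue \<open>- n (n + d - 2)\<close>.\<close>

lemma ode_leg: "ode e (leg e n) = smult (- real (n * (n + 2 * e + 1))) (leg e n)"
proof -
  have "ode e (leg e n) = smult (poly (ode e (leg e n)) 1) (leg e n)"
  proof (rule orth_imp_leg)
    show "degree (ode e (leg e n)) \<le> n" using degree_ode[of e "leg e n"] by simp
    show "wint e (ode e (leg e n) * g) = 0" if "degree g < n" for g
    proof -
      have "wint e (ode e (leg e n) * g) = wint e (leg e n * ode e g)"
        using wint_ode[of e "leg e n" g] wint_ode[of e g "leg e n"] by (simp add: mult_ac)
      then show ?thesis using that degree_ode[of e g] by (simp add: wint_leg_lower)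
    qed
  qed
  moreover from arg_cong[OF this, of "\<lambda>p. coeff p n"]
  have "- real (n * (n + 2 * e + 1)) * leg_lead e n = poly (ode e (leg e n)) 1 * leg_lead e n"
  proof -
    have "coeff (leg e n) (n + 2) = 0" by (simp add: coeff_eq_0)
    with \<open>coeff (ode e (leg e n)) n = _\<close> show ?thesis
      by (simp only: coeff_ode coeff_smult coeff_leg mult_zero_right diff_0 mult_minus_left)
  qed
  then have "poly (ode e (leg e n)) 1 = - real (n * (n + 2 * e + 1))"
    using leg_lead_pos[of e n] by (metis less_irrefl mult_right_cancel)
  ultimately show ?thesis by simp
qed

lemma coeff_leg_rec:
  "real ((k + 2) * (k + 1)) * coeff (leg e n) (k + 2)
     = (real (k * (k + 2 * e + 1)) - real (n * (n + 2 * e + 1))) * coeff (leg e n) k"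
  using arg_cong[OF ode_leg[of e n], of "\<lambda>p. coeff p k"] by (simp add: coeff_ode algebra_simps)

text \<open>Coefficient \<open>k\<close> of the derivative is \<open>k + 1\<close> times coefficient
  \<open>k + 1\<close> of \<open>leg e (Suc m)\<close>; the difference of the two eigenvalues then
  factors as \<open>(k - m) (k + m + d)\<close>.\<close>

lemma coeff_pderiv_leg_rec:
  "real ((k + 2) * (k + 1)) * coeff (pderiv (leg e (Suc m))) (k + 2)
     = (real k - real m) * real (k + m + 2 * e + 3) * coeff (pderiv (leg e (Suc m))) k"
proof -
  have "real ((k + 2) * (k + 1)) * coeff (pderiv (leg e (Suc m))) (k + 2)
      = real (k + 1) * (real ((Suc k + 2) * (Suc k + 1)) * coeff (leg e (Suc m)) (Suc k + 2))"
    by (simp add: coeff_pderiv algebra_simps)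
  also have "\<dots> = (real (Suc k * (Suc k + 2 * e + 1)) - real (Suc m * (Suc m + 2 * e + 1)))
    * coeff (pderiv (leg e (Suc m))) k"
    unfolding coeff_leg_rec by (simp add: coeff_pderiv)
  also have "real (Suc k * (Suc k + 2 * e + 1)) - real (Suc m * (Suc m + 2 * e + 1)) = (real k - real m) * real (k
    + m + 2 * e + 3)"
    by (simp add: algebra_simps)
  finally show ?thesis .
qed

text \<open>Move \<open>ode\<close> from \<open>t ^ (k + 2)\<close> to its eigenfunction
  \<open>leg e l\<close>. Together with \<open>coeff_pderiv_leg_rec\<close> this produces the Jacobi
  recursion in \<open>wint_leg_radial\<close>; for \<open>l = 0\<close> it gives the moments of the
  weight.\<close>

lemma wint_monom_leg_rec:
  "(real (k + 2) - real l) * real (k + l + 2 * e + 3) * wint e (monom 1 (k + 2) * leg e l)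
     = real ((k + 1) * (k + 2)) * wint e (monom 1 k * leg e l)"
proof -
  have o: "ode e (monom 1 (k + 2)) = smult (real ((k + 2) * (k + 1))) (monom 1 k)
      - smult (real ((k + 2) * (k + 2 * e + 3))) (monom 1 (k + 2))"
    by (rule poly_eqI) (auto simp: coeff_ode algebra_simps)
  have "wint e (ode e (monom 1 (k + 2)) * leg e l) = wint e (ode e (leg e l) * monom 1 (k + 2))"
    unfolding wint_ode by (simp add: mult_ac)
  then have "real ((k + 2) * (k + 1)) * wint e (monom 1 k * leg e l) - real ((k + 2) * (k + 2 * e + 3))
    * wint e (monom 1 (k + 2) * leg e l)
      = - real (l * (l + 2 * e + 1)) * wint e (monom 1 (k + 2) * leg e l)"
    by (simp only: o ode_leg left_diff_distrib wint_diff mult_smult_left wint_smult) (simp only: mult.commute)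
  moreover have "(real (k + 2) - real l) * real (k + l + 2 * e + 3) = real ((k + 2) * (k + 2 * e + 3)) - real (l * (l
    + 2 * e + 1))"
    by (simp add: algebra_simps)
  moreover have "(k + 1) * (k + 2) = (k + 2) * (k + 1)" by (rule mult.commute)
  ultimately show ?thesis by (simp only: left_diff_distrib)
qed

text \<open>Parity makes \<open>p - p(1) P m\<close> vanish at both ends, so it is a multiple of
  \<open>quad\<close>. Integration by parts then has no boundary terms and pairs
  \<open>P (m + 1)\<close> with a polynomial of lower degree. Hence \<open>p\<close> enters only
  through its value at 1, which is why one constant serves every \<open>l\<close> in
  \<open>V_fun_ridge\<close>.\<close>

lemma wint_pderiv_leg:
  assumes deg: "degree p \<le> m" and par: "pcompose p [:0, -1:] = smult ((-1) ^ m) p"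
  shows "wint e (pderiv (leg e (Suc m)) * p) = poly p 1 * (wint e 1 * real (2 * m + 2 * e + 3) / hdim e (Suc m))"
proof -
  let ?P = "pderiv (leg e (Suc m))"
  define g where "g = p - smult (poly p 1) (leg e m)"
  have "wint e (?P * g) = 0"
  proof -
    have "poly p (-1) = (-1) ^ m * poly p 1"
      using arg_cong[OF par, of "\<lambda>p. poly p 1"] by (simp add: poly_pcompose)
    then have "poly g 1 = 0" "poly g (-1) = 0"
      by (simp_all add: g_def poly_leg_minus)
    then obtain g1 where g1: "g = [:-1, 1:] * g1" by (auto simp: poly_eq_0_iff_dvd elim: dvdE)
    with \<open>poly g (-1) = 0\<close> have "poly g1 (-1) = 0" by simp
    then obtain g2 where g2: "g1 = [:1, 1:] * g2" by (auto simp: poly_eq_0_iff_dvd elim: dvdE)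
    have g: "g = quad * (- g2)" unfolding g1 g2 by simp
    define h where "h = smult (-2 * real e - 2) (pCons 0 (- g2)) + quad * pderiv (- g2)"
    have h: "pderiv (quad ^ Suc e * (- g2)) = h * quad ^ e"
      by (subst poly_eq_poly_eq_iff[symmetric], rule ext)
       (simp add: h_def pderiv_mult pderiv_power_Suc pderiv_pCons pderiv_minus algebra_simps
         del: mult_pCons_left mult_pCons_right power_Suc mult_minus_left mult_minus_right, simp add: algebra_simps)
    have "degree h < Suc m"
    proof (cases "g2 = 0")
      case False
      have "degree g \<le> m" unfolding g_def using deg by (intro degree_diff_le) auto
      moreover have "degree g = degree g2 + 2" unfolding g using False
        by (subst degree_mult_eq) auto
      ultimately have "degree g2 + 2 \<le> m" by simp
      then have "degree (pCons 0 (- g2)) \<le> m" "degree (quad * pderiv (- g2)) \<le> m"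
        using degree_pCons_le[of 0 "- g2"] degree_mult_le[of quad "pderiv (- g2)"] degree_pderiv[of "- g2"]
        by simp_all
      then have "degree h \<le> m" unfolding h_def
        by (intro degree_add_le) (auto intro: order_trans[OF degree_smult_le])
      then show ?thesis by simp
    qed (simp add: h_def)
    have "wint e (?P * g) = pint (quad ^ Suc e * (- g2) * ?P)"
      by (simp only: wint_def g mult_ac power_Suc)
    also have "\<dots> = - pint (pderiv (quad ^ Suc e * (- g2)) * leg e (Suc m))"
      by (rule pint_by_parts) simp_all
    also have "\<dots> = - wint e (leg e (Suc m) * h)" unfolding h by (simp add: wint_def mult_ac)
    also have "\<dots> = 0" using \<open>degree h < Suc m\<close> by (simp add: wint_leg_lower)
    finally show ?thesis .
  qed
  then have 1: "wint e (?P * p) = poly p 1 * wint e (?P * leg e m)"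
    by (simp add: g_def right_diff_distrib wint_diff wint_smult)
  \<comment> \<open>The ratio of the leading coefficients of \<open>P' (m + 1)\<close> and
    \<open>P m\<close>; the lower terms of \<open>P' (m + 1)\<close> are orthogonal to
    \<open>leg e m\<close>.\<close>
  define c where "c = real (Suc m) * leg_lead e (Suc m) / leg_lead e m"
  have "wint e (?P * leg e m) = c * wint e (leg e m * leg e m)"
  proof -
    let ?r = "?P - smult c (leg e m)"
    have "coeff ?r m = 0" using leg_lead_pos[of e m] by (simp add: c_def coeff_pderiv)
    moreover have "degree ?r \<le> m" by (intro degree_diff_le) (auto simp: degree_pderiv)
    ultimately have "?r = 0 \<or> degree ?r < m"
      by (metis leading_coeff_0_iff order_le_imp_less_or_eq)
    then have "wint e (leg e m * ?r) = 0" by (auto simp: wint_leg_lower)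
    then show ?thesis by (simp add: right_diff_distrib wint_diff wint_smult mult.commute)
  qed
  also have "c = real (Suc m) * real (2 * m + 2 * e + 1) / real (m + 2 * e + 1)"
  proof -
    have "fact (Suc m + e) = real (Suc m + e) * (fact (m + e) :: real)" by simp
    then have rod: "rodrigues_const e m = rodrigues_const e (Suc m) * (2 * real (Suc m + e))"
      unfolding rodrigues_const_def by (simp del: of_nat_add of_nat_Suc fact_Suc)
    have f1: "fact (2 * Suc m + 2 * e) = (2 * real (Suc m + e)) * real (2 * m + 2 * e + 1) * (fact (2 * m + 2
      * e) :: real)"
    proof -
      have "2 * Suc m + 2 * e = Suc (Suc (2 * m + 2 * e))" by simp
      then show ?thesis by (simp only: fact_Suc) (simp add: algebra_simps)
    qed
    have f2: "fact (Suc m + 2 * e) = real (m + 2 * e + 1) * (fact (m + 2 * e) :: real)" by simp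
    have aux: "k * (R * (c * b * F) / (a * G)) / (R * c * F / G) = k * b / a"
      if "R \<noteq> 0" "F \<noteq> 0" "G \<noteq> 0" "c \<noteq> 0" for a b c F G R k :: real
      using that by simp
    show ?thesis unfolding c_def leg_lead_def rod f1 f2
      by (rule aux) (use rodrigues_const_pos[of e "Suc m"] in auto)
  qed
  also have "wint e (leg e m * leg e m) = wint e 1 / hdim e m" by (rule wint_leg_sq)
  also have "hdim e m = real (2 * m + 2 * e + 1) * fact (m + 2 * e) / (fact m * fact (2 * e + 1))"
    by (simp add: of_nat_harmonic_dim)
  finally have 2: "wint e (?P * leg e m) = real (Suc m) * real (2 * m + 2 * e + 1) / real (m + 2 * e + 1) *
     (wint e 1 / (real (2 * m + 2 * e + 1) * fact (m + 2 * e) / (fact m * fact (2 * e + 1))))" .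
  have 3: "hdim e (Suc m) = real (2 * m + 2 * e + 3) * (real (m + 2 * e + 1) * fact (m + 2 * e)) / (real (Suc m)
    * fact m * fact (2 * e + 1))"
    by (simp add: of_nat_harmonic_dim)
  show ?thesis unfolding 1 2 3
    by (simp add: mult_ac del: of_nat_add of_nat_mult of_nat_Suc fact_Suc)
qed


section \<open>Jacobi polynomials as radial parts of ridge integrals\<close>

definition jacobi_coeff :: "nat \<Rightarrow> real \<Rightarrow> nat \<Rightarrow> real" where
  "jacobi_coeff n \<beta> j = (-1) ^ (n - j) * ((real n + \<beta>) gchoose (n - j)) * ((real n + \<beta>
    + real j) gchoose j)"

text \<open>The definition mixes powers of \<open>x - 1\<close> and \<open>x + 1\<close>; in the
  variable \<open>u = (x + 1) / 2\<close>, later the squared radius, the coefficients satisfy a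
  first-order recursion.\<close>

lemma jacobi_expansion: "jacobi n 0 \<beta> (2 * u - 1) = (\<Sum>j\<le>n. jacobi_coeff n \<beta> j * u ^ j)"
proof -
  define b where "b = real n + \<beta>"
  \<comment> \<open>Up to sign, the coefficient of \<open>u ^ (n - i)\<close> after expanding
    \<open>(u - 1) ^ s\<close>: trinomial revision takes \<open>b gchoose i\<close> out of the sum,
    and Vandermonde's convolution evaluates the rest.\<close>
  have coef: "(\<Sum>s\<le>n. (real n gchoose (n - s)) * (b gchoose s) * real (s choose i)) = (b gchoose i) * ((b
    + real (n - i)) gchoose (n - i))"
    if "i \<le> n" for i
  proof -
    have "(\<Sum>s\<le>n. (real n gchoose (n - s)) * (b gchoose s) * real (s choose i))
       = (\<Sum>s\<in>{i..n}. (real n gchoose (n - s)) * (b gchoose s) * real (s choose i))"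
      by (rule sum.mono_neutral_right) auto
    also have "\<dots> = (\<Sum>t\<le>n - i. (real n gchoose (n - i - t)) * (b gchoose (t + i)) * real ((t
      + i) choose i))"
      using that by (intro sum.reindex_bij_witness[where i="\<lambda>t. t + i" and j="\<lambda>s. s - i"]) auto
    also have "\<dots> = (\<Sum>t\<le>n - i. (b gchoose i) * (((b - real i) gchoose t) * (real n gchoose (n - i
      - t))))"
    proof (rule sum.cong)
      fix t
      have "(b gchoose (t + i)) * real ((t + i) choose i) = (b gchoose i) * ((b - real i) gchoose t)"
        using gbinomial_trinomial_revision[of i "t + i" b] by (simp add: binomial_gbinomial)
      then show "(real n gchoose (n - i - t)) * (b gchoose (t + i)) * real ((t + i) choose i)
          = (b gchoose i) * (((b - real i) gchoose t) * (real n gchoose (n - i - t)))"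
        by (metis mult.assoc mult.commute)
    qed simp
    also have "\<dots> = (b gchoose i) * ((b - real i + real n) gchoose (n - i))"
      by (simp only: sum_distrib_left[symmetric] gbinomial_Vandermonde flip: atLeast0AtMost)
    finally show ?thesis using that by (simp add: of_nat_diff algebra_simps)
  qed
  have "jacobi n 0 \<beta> (2 * u - 1) = (\<Sum>s\<le>n. (real n gchoose (n - s)) * (b gchoose s) * (u - 1) ^ s
    * u ^ (n - s))"
    unfolding jacobi_def b_def by (intro sum.cong) (auto simp: diff_divide_distrib)
  also have "\<dots> = (\<Sum>s\<le>n. \<Sum>i\<le>n. (real n gchoose (n - s)) * (b gchoose s) * real (s choose i)
    * ((-1) ^ i * u ^ (n - i)))"
  proof (rule sum.cong)
    fix s assume s: "s \<in> {..n}"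
    have "(u - 1) ^ s * u ^ (n - s) = (\<Sum>i\<le>s. real (s choose i) * (-1) ^ i * u ^ (s - i)) * u ^ (n - s)"
      using binomial_ring[of "-1" u s] by simp
    also have "\<dots> = (\<Sum>i\<le>s. real (s choose i) * ((-1) ^ i * u ^ (n - i)))"
      unfolding sum_distrib_right using s
      by (intro sum.cong) (auto simp: mult.assoc simp flip: power_add)
    also have "\<dots> = (\<Sum>i\<le>n. real (s choose i) * ((-1) ^ i * u ^ (n - i)))"
      using s by (intro sum.mono_neutral_left) auto
    finally show "(real n gchoose (n - s)) * (b gchoose s) * (u - 1) ^ s * u ^ (n - s)
      = (\<Sum>i\<le>n. (real n gchoose (n - s)) * (b gchoose s) * real (s choose i) * ((-1) ^ i * u ^ (n - i)))"
      by (simp add: mult.assoc sum_distrib_left)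
  qed simp
  also have "\<dots> = (\<Sum>i\<le>n. ((b gchoose i) * ((b + real (n - i)) gchoose (n - i))) * ((-1) ^ i * u ^ (n
    - i)))"
    by (subst sum.swap) (auto simp: coef simp flip: sum_distrib_right intro!: sum.cong)
  also have "\<dots> = (\<Sum>j\<le>n. jacobi_coeff n \<beta> j * u ^ j)"
    by (rule sum.reindex_bij_witness[where i="\<lambda>j. n - j" and j="\<lambda>i. n - i"])
      (auto simp: jacobi_coeff_def b_def)
  finally show ?thesis .
qed

lemma jacobi_coeff_rec:
  assumes "j < n"
  shows "real (j + 1) * (\<beta> + real j + 1) * jacobi_coeff n \<beta> (Suc j)
     = - real (n - j) * (real n + \<beta> + real j + 1) * jacobi_coeff n \<beta> j"
proof -
  obtain i where i: "n - j = Suc i" "n - Suc j = i" using assms by (metis Suc_diff_Suc)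
  define b where "b = real n + \<beta>"
  have bi: "b - real i = \<beta> + real j + 1" using i assms by (simp add: b_def)
  have 1: "(b gchoose i) * (\<beta> + real j + 1) = real (Suc i) * (b gchoose Suc i)"
    using gbinomial_mult_1[of b i] unfolding bi[symmetric] by (simp add: algebra_simps)
  have 2: "real (Suc j) * ((b + real (Suc j)) gchoose Suc j) = (b + real j + 1) * ((b + real j) gchoose j)"
    using gbinomial_absorption[of j "b + real (Suc j)"] by (simp add: algebra_simps)
  have "real (j + 1) * (\<beta> + real j + 1) * jacobi_coeff n \<beta> (Suc j)
      = (-1) ^ i * ((b gchoose i) * (\<beta> + real j + 1)) * (real (Suc j) * ((b + real (Suc j)) gchoose Suc j))"
    unfolding jacobi_coeff_def b_def[symmetric] i by simp
  also have "\<dots> = - real (n - j) * (real n + \<beta> + real j + 1) * jacobi_coeff n \<beta> j"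
    unfolding 1 2 jacobi_coeff_def b_def[symmetric] i by (simp add: algebra_simps)
  finally show ?thesis .
qed

text \<open>Cross-multiplied, so that neither initial value has to be known to be nonzero at this
  point.\<close>

lemma proportional_by_recurrence:
  fixes s c :: "nat \<Rightarrow> real"
  assumes "\<And>j. j < n \<Longrightarrow> A j * s (Suc j) = B j * s j" "\<And>j. j < n \<Longrightarrow> A j
    * c (Suc j) = B j * c j"
    and "\<And>j. j < n \<Longrightarrow> A j \<noteq> 0" "j \<le> n"
  shows "s j * c 0 = s 0 * c j"
  using \<open>j \<le> n\<close>
proof (induction j)
  case (Suc j)
  then have "j < n" by simp
  have "A j * (s (Suc j) * c 0) = B j * (s j * c 0)" using assms(1)[OF \<open>j < n\<close>] by (metis mult.assoc)
  also have "\<dots> = s 0 * (B j * c j)" using Suc by simp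
  also have "\<dots> = A j * (s 0 * c (Suc j))" using assms(2)[OF \<open>j < n\<close>] by simp
  finally show ?case using assms(3)[OF \<open>j < n\<close>] by simp
qed simp

text \<open>By Funk-Hecke this is the radial part of the ridge integral of \<open>P' (m + 1)\<close>
  at radius \<open>\<rho>\<close>. Only the powers \<open>l, l + 2, ..., m\<close> of
  \<open>\<rho>\<close> survive, by orthogonality below \<open>l\<close> and by parity, and their
  coefficients obey the Jacobi recursion with \<open>\<beta> = l + (d - 2) / 2\<close>. The value at
  radius 1 gives the factor.\<close>

lemma wint_leg_radial:
  fixes \<rho> :: real
  assumes lm: "l \<le> m" "even (l + m)"
  shows "wint e (pcompose (pderiv (leg e (Suc m))) [:0, \<rho>:] * leg e l)
    = wint e (pderiv (leg e (Suc m)) * leg e l) * (\<rho> ^ l * jacobi ((m - l) div 2) 0 (real l + real e + 1 / 2) (2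
      * \<rho>\<^sup>2 - 1))"
proof -
  define Q where "Q = pderiv (leg e (Suc m))"
  define n where "n = (m - l) div 2"
  have m: "m = l + 2 * n" using lm by (auto simp: n_def elim!: evenE)
  define \<beta> where "\<beta> = real l + real e + 1 / 2"
  define s where "s j = coeff Q (l + 2 * j) * wint e (monom 1 (l + 2 * j) * leg e l)" for j
  have degQ: "degree Q \<le> m" by (simp add: Q_def degree_pderiv)
  have parQ: "pcompose Q [:0, -1:] = smult ((-1) ^ m) Q"
  proof -
    have "pderiv (pcompose (leg e (Suc m)) [:0, -1:]) = - pcompose Q [:0, -1:]"
      by (simp add: pderiv_pcompose pderiv_pCons Q_def)
    then have "- pcompose Q [:0, -1:] = - smult ((-1) ^ m) Q"
      unfolding leg_reflect pderiv_smult Q_def[symmetric] by simp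
    then show ?thesis by (simp only: neg_equal_iff_equal)
  qed
  have R: "wint e (pcompose Q [:0, r:] * leg e l) = r ^ l * (\<Sum>j\<le>n. s j * (r\<^sup>2) ^ j)" for r
  proof -
    have "pcompose Q [:0, r:] = (\<Sum>k\<le>m. smult (r ^ k * coeff Q k) (monom 1 k))"
    proof (rule poly_eqI)
      fix i
      have "coeff (\<Sum>k\<le>m. smult (r ^ k * coeff Q k) (monom 1 k)) i = (\<Sum>k\<le>m. if k = i then r ^ i
        * coeff Q i else 0)"
        unfolding coeff_sum by (intro sum.cong) auto
      also have "\<dots> = r ^ i * coeff Q i" using degQ by (auto simp: coeff_eq_0)
      finally show "coeff (pcompose Q [:0, r:]) i = coeff (\<Sum>k\<le>m. smult (r ^ k * coeff Q k) (monom 1 k)) i"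
        by (simp add: coeff_pcompose_linear)
    qed
    then have "wint e (pcompose Q [:0, r:] * leg e l) = (\<Sum>k\<le>m. r ^ k * (coeff Q k * wint e (monom 1 k
      * leg e l)))"
      by (simp add: sum_distrib_right wint_sum wint_smult mult.assoc)
    also have "\<dots> = (\<Sum>k\<in>(\<lambda>j. l + 2 * j) ` {..n}. r ^ k * (coeff Q k * wint e (monom 1 k
      * leg e l)))"
    proof (rule sum.mono_neutral_right)
      show "\<forall>k\<in>{..m} - (\<lambda>j. l + 2 * j) ` {..n}. r ^ k * (coeff Q k * wint e (monom 1 k
        * leg e l)) = 0"
      proof
        fix k assume k: "k \<in> {..m} - (\<lambda>j. l + 2 * j) ` {..n}"
        show "r ^ k * (coeff Q k * wint e (monom 1 k * leg e l)) = 0"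
        proof (cases "k < l")
          case True
          then have "wint e (leg e l * monom 1 k) = 0" by (intro wint_leg_lower) (simp add: degree_monom_eq)
          then show ?thesis by (simp add: mult.commute)
        next
          case False
          have "odd (k + m)"
          proof
            assume "even (k + m)"
            then have "even (k - l)" using m False by simp
            then obtain j where "k = l + 2 * j" using False by (metis evenE le_add_diff_inverse not_less)
            moreover from this have "j \<le> n" using k m by simp
            ultimately show False using k by auto
          qed
          then show ?thesis using coeff_parity[OF parQ] by simp
        qed
      qed
    qed (auto simp: m)
    also have "\<dots> = (\<Sum>j\<le>n. r ^ (l + 2 * j) * s j)"
      by (subst sum.reindex) (auto simp: inj_on_def s_def)
    also have "\<dots> = (\<Sum>j\<le>n. r ^ l * (s j * (r\<^sup>2) ^ j))"
      by (simp only: power_add power_mult) (simp only: mult_ac)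
    finally show ?thesis by (simp only: sum_distrib_left)
  qed
  have rec: "real (j + 1) * (\<beta> + real j + 1) * s (Suc j) = - real (n - j) * (real n + \<beta> + real j + 1)
    * s j"
    if "j < n" for j
  proof -
    let ?k = "l + 2 * j"
    let ?M = "\<lambda>k. wint e (monom 1 k * leg e l)"
    \<comment> \<open>The factor \<open>(k + 2) (k + 1)\<close> occurs in both recursions, that of
      the coefficients of \<open>Q\<close> and that of the moments, and cancels; afterwards a common
      factor 4 remains.\<close>
    have "real ((?k + 2) * (?k + 1)) * ((real (?k + 2) - real l) * real (?k + l + 2 * e + 3) * s (Suc j))
       = (real ((?k + 2) * (?k + 1)) * coeff Q (?k + 2)) * ((real (?k + 2) - real l) * real (?k + l + 2 * e + 3) * ?M
         (?k + 2))"
      by (simp add: s_def algebra_simps)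
    also have "\<dots> = real ((?k + 2) * (?k + 1)) * ((real ?k - real m) * real (?k + m + 2 * e + 3) * s j)"
      unfolding Q_def coeff_pderiv_leg_rec wint_monom_leg_rec by (simp add: s_def Q_def mult_ac)
    finally have "(real (?k + 2) - real l) * real (?k + l + 2 * e + 3) * s (Suc j) = (real ?k - real m) * real (?k
      + m + 2 * e + 3) * s j"
      by (rule mult_left_cancel[THEN iffD1, rotated]) (simp only: of_nat_eq_0_iff, simp)
    moreover have "(real (?k + 2) - real l) * real (?k + l + 2 * e + 3) = 4 * (real (j + 1) * (\<beta> + real j + 1))"
      by (simp add: \<beta>_def algebra_simps)
    moreover have "(real ?k - real m) * real (?k + m + 2 * e + 3) = 4 * (- real (n - j) * (real n + \<beta> + real j
      + 1))"
      using that by (simp add: \<beta>_def m of_nat_diff field_simps)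
    moreover have "a * x = b * y" if "a' * x = b' * y" "a' = 4 * a" "b' = 4 * b" for a b a' b' x y :: real
      using that by simp
    ultimately show ?thesis by blast
  qed
  have propor: "s j * jacobi_coeff n \<beta> 0 = s 0 * jacobi_coeff n \<beta> j" if "j \<le> n" for j
  proof (rule proportional_by_recurrence[where A = "\<lambda>j. real (j + 1) * (\<beta> + real j + 1)"
        and B = "\<lambda>j. - real (n - j) * (real n + \<beta> + real j + 1)", OF rec jacobi_coeff_rec _ that])
    fix j
    have "\<beta> + real j + 1 > 0" by (simp add: \<beta>_def add_pos_nonneg)
    then show "real (j + 1) * (\<beta> + real j + 1) \<noteq> 0" by simp
  qed
  have S: "(\<Sum>j\<le>n. s j * u ^ j) * jacobi_coeff n \<beta> 0 = s 0 * jacobi n 0 \<beta> (2 * u - 1)" for u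
  proof -
    have "(\<Sum>j\<le>n. s j * u ^ j) * jacobi_coeff n \<beta> 0 = (\<Sum>j\<le>n. (s j * jacobi_coeff n \<beta> 0)
      * u ^ j)"
      unfolding sum_distrib_right by (simp add: mult_ac)
    then show ?thesis by (simp add: propor jacobi_expansion sum_distrib_left mult.assoc)
  qed
  have J1: "jacobi n 0 \<beta> 1 = 1" by (simp add: jacobi_1 flip: binomial_gbinomial)
  \<comment> \<open>Otherwise the recursion would make every coefficient zero, against the value 1
    at \<open>u = 1\<close>.\<close>
  have "jacobi_coeff n \<beta> 0 \<noteq> 0"
  proof
    assume z: "jacobi_coeff n \<beta> 0 = 0"
    have "jacobi_coeff n \<beta> j = 0" if "j \<le> n" for j
      using that
    proof (induction j)
      case (Suc j)
      then have "real (j + 1) * (\<beta> + real j + 1) * jacobi_coeff n \<beta> (Suc j) = 0"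
        by (subst jacobi_coeff_rec) auto
      moreover have "\<beta> + real j + 1 > 0" by (simp add: \<beta>_def add_pos_nonneg)
      ultimately show ?case by simp
    qed (rule z)
    then have "jacobi n 0 \<beta> (2 * 1 - 1) = 0" unfolding jacobi_expansion by simp
    with J1 show False by simp
  qed
  moreover have "s 0 = (\<Sum>j\<le>n. s j) * jacobi_coeff n \<beta> 0" using S[of 1] J1 by simp
  ultimately have "(\<Sum>j\<le>n. s j * u ^ j) = (\<Sum>j\<le>n. s j) * jacobi n 0 \<beta> (2 * u - 1)" for u
    using S[of u] by (simp add: mult_ac)
  moreover have "wint e (Q * leg e l) = (\<Sum>j\<le>n. s j)" using R[of 1] by simp
  ultimately show ?thesis
    unfolding Q_def[symmetric] n_def[symmetric] \<beta>_def[symmetric] R by simp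
qed

section \<open>Invariant integration on the sphere\<close>

text \<open>A common frame for the sphere, products of spheres and intervals of integration:
  continuity on \<open>K\<close> alone then gives measurability, integrability and Fubini. Borel
  measurability of the identity says that \<open>M\<close> carries at least the Borel sets of
  \<open>K\<close>.\<close>

definition compact_measure :: "'b::{second_countable_topology, t2_space} measure \<Rightarrow> 'b set \<Rightarrow>
  bool" where
  "compact_measure M K \<longleftrightarrow> finite_measure M \<and> space M
    = K \<and> compact K \<and> (\<lambda>x. x) \<in> borel_measurable M"

context
  fixes M :: "'b::{second_countable_topology, t2_space} measure" and K
  assumes M: "compact_measure M K"
begin

lemma compact_measure_measurable:
  fixes f :: "'b \<Rightarrow> 'c::{second_countable_topology, t2_space}"
  assumes "continuous_on K f"
  shows "f \<in> borel_measurable M"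
proof -
  have "(\<lambda>x. x) \<in> measurable M (restrict_space borel K)"
    using M by (intro measurable_restrict_space2) (auto simp: compact_measure_def)
  from measurable_compose[OF this borel_measurable_continuous_on_restrict[OF assms]] show ?thesis .
qed

lemma compact_measure_integrable:
  fixes f :: "'b \<Rightarrow> 'c::{banach, second_countable_topology}"
  assumes "continuous_on K f"
  shows "integrable M f"
proof -
  interpret finite_measure M using M by (simp add: compact_measure_def)
  have "compact (f ` K)" using assms M by (auto simp: compact_measure_def intro: compact_continuous_image)
  then obtain B where "\<And>x. x \<in> K \<Longrightarrow> norm (f x) \<le> B"
    using compact_imp_bounded bounded_iff by (metis imageI)
  then show ?thesis
    by (intro integrable_const_bound[of _ B] compact_measure_measurable assms)
      (use M in \<open>auto simp: compact_measure_def\<close>)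
qed

end

lemma compact_measure_pair:
  assumes M: "compact_measure M K" and N: "compact_measure N L"
  shows "compact_measure (M \<Otimes>\<^sub>M N) (K \<times> L)"
proof -
  have "(\<lambda>z. (fst z, snd z)) \<in> measurable (M \<Otimes>\<^sub>M N) (borel \<Otimes>\<^sub>M borel)"
    using M N
    by (intro measurable_Pair measurable_compose[OF measurable_fst] measurable_compose[OF measurable_snd])
      (auto simp: compact_measure_def)
  then show ?thesis using M N
    by (auto simp: compact_measure_def borel_prod space_pair_measure
        intro: finite_measure_pair_measure compact_Times)
qed

lemmas lint_cong = Bochner_Integration.integral_cong

lemma compact_measure_fubini:
  fixes f :: "'b::{second_countable_topology, t2_space} \<Rightarrow> 'c::{second_countable_topology, t2_space}
    \<Rightarrow> 'd::{banach, second_countable_topology}"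
  assumes M: "compact_measure M K" and N: "compact_measure N L"
    and f: "continuous_on (K \<times> L) (\<lambda>(x, y). f x y)"
  shows "(LINT x|M. LINT y|N. f x y) = (LINT y|N. LINT x|M. f x y)" (is ?swap)
    and "(LINT x|M. LINT y|N. f x y) = (LINT z|(M \<Otimes>\<^sub>M N). f (fst z) (snd z))" (is ?pair)
    and "integrable M (\<lambda>x. LINT y|N. f x y)" (is ?int)
proof -
  interpret M: finite_measure M using M by (simp add: compact_measure_def)
  interpret N: finite_measure N using N by (simp add: compact_measure_def)
  interpret pair_sigma_finite M N ..
  have i: "integrable (M \<Otimes>\<^sub>M N) (case_prod f)"
    using compact_measure_integrable[OF compact_measure_pair[OF M N]] f by simp
  show ?swap using Fubini_integral[OF i] by simp
  show ?pair using integral_fst[OF i] by (simp add: case_prod_beta')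
  show ?int using integrable_fst'[OF i] by simp
qed

section \<open>Reflections, and the invariance of Lebesgue and surface measure\<close>

definition reflect :: "'a::euclidean_space \<Rightarrow> 'a \<Rightarrow> 'a" where
  "reflect w x = x - (2 * (w \<bullet> x)) *\<^sub>R w"

lemma reflect_reflect [simp]: "norm w = 1 \<Longrightarrow> reflect w (reflect w x) = x"
  by (simp add: reflect_def inner_diff_right dot_square_norm)

lemma reflect_add: "reflect w (x + y) = reflect w x + reflect w y"
  by (simp add: reflect_def inner_add_right algebra_simps)

lemma reflect_scaleR: "reflect w (c *\<^sub>R x) = c *\<^sub>R reflect w x"
  by (simp add: reflect_def algebra_simps)

lemma inner_reflect: "reflect w x \<bullet> y = x \<bullet> reflect w y"
  by (simp add: reflect_def inner_diff_left inner_diff_right inner_commute)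

lemma norm_reflect [simp]: "norm w = 1 \<Longrightarrow> norm (reflect w x) = norm x"
  by (simp add: norm_eq_sqrt_inner inner_reflect)

lemma continuous_on_reflect [continuous_intros]:
  "continuous_on S f \<Longrightarrow> continuous_on S g \<Longrightarrow> continuous_on S (\<lambda>x. reflect (f x)
    (g x))"
  unfolding reflect_def by (intro continuous_intros)

lemma measurable_reflect [measurable]: "reflect w \<in> borel_measurable borel"
  by (intro borel_measurable_continuous_onI continuous_intros)

lemma nn_integral_lborel_translate:
  fixes f :: "'a::euclidean_space \<Rightarrow> ennreal"
  assumes [measurable]: "f \<in> borel_measurable borel"
  shows "(\<integral>\<^sup>+x. f (c + x) \<partial>lborel) = (\<integral>\<^sup>+x. f x \<partial>lborel)"
proof -
  have "(\<integral>\<^sup>+x. f x \<partial>lborel) = (\<integral>\<^sup>+x. f x \<partial>distr lborel borel ((+)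
    c))"
    by (simp add: lborel_distr_plus)
  then show ?thesis by (subst (asm) nn_integral_distr) auto
qed

lemma nn_integral_lborel_minus:
  fixes f :: "'a::euclidean_space \<Rightarrow> ennreal"
  assumes [measurable]: "f \<in> borel_measurable borel"
  shows "(\<integral>\<^sup>+x. f (- x) \<partial>lborel) = (\<integral>\<^sup>+x. f x \<partial>lborel)"
proof -
  have "distr lborel borel (\<lambda>x::'a. - x) = lborel"
    using lborel_affine[of "-1" "0 :: 'a"] by (simp add: density_1)
  then have "(\<integral>\<^sup>+x. f x \<partial>lborel) = (\<integral>\<^sup>+x. f x \<partial>distr lborel borel
    (\<lambda>x::'a. - x))" by simp
  then show ?thesis by (subst (asm) nn_integral_distr) auto
qed

(* Uniqueness of Haar measure: integrate f (T x) g (T x + y) in both orders, g being the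
   indicator of the T-invariant unit ball. *)
lemma nn_integral_reflect:
  fixes f :: "'a::euclidean_space \<Rightarrow> ennreal"
  assumes [measurable]: "f \<in> borel_measurable borel" and w: "norm w = 1"
  shows "(\<integral>\<^sup>+x. f (reflect w x) \<partial>lborel) = (\<integral>\<^sup>+x. f x \<partial>lborel)"
proof -
  define g :: "'a \<Rightarrow> ennreal" where "g = indicator (cball 0 1)"
  have [measurable]: "g \<in> borel_measurable borel" unfolding g_def by (rule borel_measurable_indicator) simp
  let ?T = "reflect w"
  have gT: "g (?T x) = g x" for x using w by (simp add: g_def indicator_def)
  have "(\<integral>\<^sup>+x. f (?T x) \<partial>lborel) * (\<integral>\<^sup>+y. g y \<partial>lborel)
    = (\<integral>\<^sup>+x. f (?T x) * (\<integral>\<^sup>+y. g (?T x + y) \<partial>lborel) \<partial>lborel)"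
    by (simp add: nn_integral_lborel_translate nn_integral_multc)
  also have "\<dots> = (\<integral>\<^sup>+x. (\<integral>\<^sup>+y. f (?T x) * g (?T x
    + y) \<partial>lborel) \<partial>lborel)"
    by (simp add: nn_integral_cmult)
  also have "\<dots> = (\<integral>\<^sup>+y. (\<integral>\<^sup>+x. f (?T x) * g (?T x
    + y) \<partial>lborel) \<partial>lborel)"
    by (rule lborel_pair.Fubini') measurable
  also have "\<dots> = (\<integral>\<^sup>+y. (\<integral>\<^sup>+x. f (?T x - y)
    * g (?T x) \<partial>lborel) \<partial>lborel)"
  proof (rule nn_integral_cong)
    fix y
    \<comment> \<open>Shifting \<open>x\<close> by \<open>- ?T y\<close> turns \<open>?T x\<close>
      into \<open>?T x - y\<close>, because \<open>?T\<close> is a linear involution.\<close>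
    have T: "?T (- ?T y + x) = ?T x - y" for x
      using w reflect_scaleR[of w "-1" "?T y"] reflect_add[of w "- ?T y" x]
      by (simp del: uminus_add_conv_diff)
    show "(\<integral>\<^sup>+x. f (?T x) * g (?T x + y) \<partial>lborel) = (\<integral>\<^sup>+x. f (?T x - y)
      * g (?T x) \<partial>lborel)"
      using nn_integral_lborel_translate[of "\<lambda>x. f (?T x) * g (?T x
        + y)" "- ?T y"] by (simp add: T del: uminus_add_conv_diff)
  qed
  also have "\<dots> = (\<integral>\<^sup>+x. (\<integral>\<^sup>+y. f (?T x - y)
    * g (?T x) \<partial>lborel) \<partial>lborel)"
    by (rule lborel_pair.Fubini') measurable
  also have "\<dots> = (\<integral>\<^sup>+x. (\<integral>\<^sup>+y. f y \<partial>lborel) * g x \<partial>lborel)"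
  proof (rule nn_integral_cong)
    fix x
    have "(\<integral>\<^sup>+y. f (?T x - y) \<partial>lborel) = (\<integral>\<^sup>+y. f y \<partial>lborel)"
      using nn_integral_lborel_minus[of "\<lambda>y. f (?T x + y)"] by (simp add: nn_integral_lborel_translate)
    then show "(\<integral>\<^sup>+y. f (?T x - y) * g (?T x) \<partial>lborel)
      = (\<integral>\<^sup>+y. f y \<partial>lborel) * g x"
      by (simp add: nn_integral_multc gT)
  qed
  also have "\<dots> = (\<integral>\<^sup>+y. f y \<partial>lborel) * (\<integral>\<^sup>+y. g y \<partial>lborel)"
    by (simp add: nn_integral_cmult)
  finally have eq: "(\<integral>\<^sup>+x. f (?T x) \<partial>lborel) * (\<integral>\<^sup>+y. g y \<partial>lborel)
    = (\<integral>\<^sup>+y. f y \<partial>lborel) * (\<integral>\<^sup>+y. g y \<partial>lborel)" .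
  have "(\<integral>\<^sup>+y. g y \<partial>lborel) = emeasure lborel (cball (0::'a) 1)" by (simp add: g_def)
  also have "\<dots> = ennreal (unit_ball_vol (real DIM('a)))" by (simp add: emeasure_cball)
  finally have "(\<integral>\<^sup>+y. g y \<partial>lborel) \<noteq> 0" "(\<integral>\<^sup>+y. g y
    \<partial>lborel) \<noteq> \<infinity>"
    by (auto simp: ennreal_eq_0_iff not_le)
  with eq show ?thesis by (simp add: mult.commute[of _ "integral\<^sup>N lborel g"] ennreal_mult_cancel_left)
qed

lemma sets_sphere_measure: "sets sphere_measure = sets (restrict_space borel (sphere (0::'a::euclidean_space) 1))"
  by (simp add: sphere_measure_def)

lemma space_sphere_measure [simp]: "space sphere_measure = sphere (0::'a::euclidean_space) 1"
  using sets_eq_imp_space_eq[OF sets_sphere_measure] by (simp add: space_restrict_space)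

lemma compact_measure_sphere: "compact_measure sphere_measure (sphere (0::'a::euclidean_space) 1)"
proof -
  have "finite_measure (sphere_measure :: 'a measure)"
    by (intro finite_measureI) (simp add: emeasure_sphere_measure_sphere)
  moreover have "(\<lambda>x. x) \<in> borel_measurable (sphere_measure :: 'a measure)"
    by (simp add: measurable_restrict_space1 sets_sphere_measure cong: measurable_cong_sets)
  ultimately show ?thesis by (simp add: compact_measure_def)
qed

lemmas sphere_fubini = compact_measure_fubini[OF compact_measure_sphere compact_measure_sphere]

lemmas integrable_sphere = compact_measure_integrable[OF compact_measure_sphere]

lemma direction_reflect: "norm w = 1 \<Longrightarrow> x \<noteq> 0 \<Longrightarrow> direction (reflect w x)
  = reflect w (direction x)"
  using norm_reflect[of w x] by (auto simp: direction_def reflect_scaleR simp del: norm_reflect)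

text \<open>The surface measure is a cone volume, and the cone over a reflected set is the reflected
  cone, so the claim reduces to \<open>nn_integral_reflect\<close>.\<close>

lemma distr_sphere_reflect:
  assumes w: "norm (w :: 'a::euclidean_space) = 1"
  shows "distr sphere_measure sphere_measure (reflect w) = sphere_measure"
proof (rule measure_eqI)
  let ?S = "sphere (0::'a) 1"
  have m: "reflect w \<in> measurable sphere_measure (sphere_measure :: 'a measure)"
  proof -
    have "reflect w \<in> measurable (restrict_space borel ?S) (restrict_space borel ?S)"
      using w by (intro measurable_restrict_space2 measurable_restrict_space1) (auto simp: space_restrict_space)
    then show ?thesis by (simp cong: measurable_cong_sets add: sets_sphere_measure)
  qed
  fix A assume "A \<in> sets (distr sphere_measure sphere_measure (reflect w))"
  then have A': "A \<in> sets (sphere_measure :: 'a measure)" by simp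
  then have A: "A \<in> sets borel" "A \<subseteq> ?S"
    by (auto simp: sets_sphere_measure sets_restrict_space_iff)
  let ?B = "{x \<in> cball 0 1. direction x \<in> A}"
  have dir[measurable]: "(direction :: 'a \<Rightarrow> 'a) \<in> borel_measurable borel"
    unfolding direction_def by measurable
  have B[measurable]: "?B \<in> sets borel"
  proof -
    have "?B = cball 0 1 \<inter> (direction -` A \<inter> space borel)" by auto
    moreover have "direction -` A \<inter> space borel \<in> sets (borel :: 'a measure)"
      by (rule measurable_sets[OF dir A(1)])
    ultimately show ?thesis by simp
  qed
  have RA: "reflect w -` A \<inter> ?S \<in> sets borel"
    using measurable_sets[OF measurable_reflect A(1), of w] by simp
  have "emeasure (distr sphere_measure sphere_measure (reflect w)) A
    = emeasure sphere_measure (reflect w -` A \<inter> ?S)"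
    using emeasure_distr[OF m A'] by simp
  also have "\<dots> = of_nat DIM('a) * emeasure lborel {x \<in> cball 0 1. direction x \<in> reflect w -` A \<inter>
    ?S}"
    using RA by (subst emeasure_sphere_measure) auto
  also have "emeasure lborel {x \<in> cball 0 1. direction x \<in> reflect w -` A \<inter> ?S} = emeasure lborel ?B"
  proof -
    have "emeasure lborel {x \<in> cball 0 1. direction x \<in> reflect w -` A \<inter> ?S}
      = (\<integral>\<^sup>+x. indicator {x \<in> cball 0 1. direction x \<in> reflect w -` A \<inter> ?S} x
        \<partial>lborel)"
    proof (rule nn_integral_indicator[symmetric])
      have "{x \<in> cball 0 1. direction x \<in> reflect w -` A \<inter> ?S}
        = cball 0 1 \<inter> (direction -` (reflect w -` A \<inter> ?S) \<inter> space borel)" by auto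
      moreover have "direction -` (reflect w -` A \<inter> ?S) \<inter> space borel \<in> sets (borel :: 'a measure)"
        by (rule measurable_sets[OF dir RA])
      ultimately show "{x \<in> cball 0 1. direction x \<in> reflect w -` A \<inter> ?S} \<in> sets lborel" by simp
    qed
    also have "\<dots> = (\<integral>\<^sup>+x. indicator ?B (reflect w x) \<partial>lborel)"
    proof (rule nn_integral_cong_AE)
      \<comment> \<open>At the origin \<open>direction\<close> is an arbitrary unit vector and need
        not commute with the reflection; a single point is a null set.\<close>
      have "AE x in lborel. x \<noteq> (0::'a)" by (rule AE_lborel_singleton)
      then show "AE x in lborel. indicator {x \<in> cball 0 1. direction x \<in> reflect w -` A \<inter> ?S} x
        = (indicator ?B (reflect w x) :: ennreal)"
        by eventually_elim (auto simp: indicator_def w direction_reflect)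
    qed
    also have "\<dots> = (\<integral>\<^sup>+x. indicator ?B x \<partial>lborel)"
      using w by (intro nn_integral_reflect) measurable
    also have "\<dots> = emeasure lborel ?B" using B by (intro nn_integral_indicator) simp
    finally show ?thesis .
  qed
  also have "of_nat DIM('a) * \<dots> = emeasure sphere_measure A"
    using A by (simp add: emeasure_sphere_measure)
  finally show "emeasure (distr sphere_measure sphere_measure (reflect w)) A = emeasure sphere_measure A" .
qed simp

lemma integral_sphere_reflect:
  fixes f :: "'a::euclidean_space \<Rightarrow> 'b::{banach, second_countable_topology}"
  assumes w: "norm w = 1" and f: "continuous_on (sphere 0 1) f"
  shows "(LINT x|sphere_measure. f (reflect w x)) = (LINT x|sphere_measure. f x)"
proof -
  have m: "reflect w \<in> measurable sphere_measure (sphere_measure :: 'a measure)"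
  proof -
    have "reflect w \<in> measurable (restrict_space borel (sphere 0 1)) (restrict_space borel (sphere 0 1))"
      using w by (intro measurable_restrict_space2 measurable_restrict_space1) (auto simp: space_restrict_space)
    then show ?thesis by (simp cong: measurable_cong_sets add: sets_sphere_measure)
  qed
  have "(LINT x|sphere_measure. f x) = (LINT x|distr sphere_measure sphere_measure (reflect w). f x)"
    by (simp add: distr_sphere_reflect w)
  also have "\<dots> = (LINT x|sphere_measure. f (reflect w x))"
    by (intro integral_distr m compact_measure_measurable[OF compact_measure_sphere] f)
  finally show ?thesis by simp
qed

section \<open>Moments of the surface measure\<close>

lemma Gamma_half_odd: "Gamma (real e + 3 / 2) = fact (2 * e + 1) * sqrt pi / (2 ^ (2 * e + 1) * fact e)"
proof (induction e)
  case 0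
  have "Gamma (1 / 2 + 1 :: real) = 1 / 2 * Gamma (1 / 2)"
    by (rule Gamma_plus1) (auto dest: nonpos_Ints_nonpos)
  then show ?case by (simp add: Gamma_one_half_real)
next
  case (Suc e)
  have "real e + 3 / 2 \<notin> \<int>\<^sub>\<le>\<^sub>0" by (auto dest: nonpos_Ints_nonpos)
  then have "Gamma (real (Suc e) + 3 / 2) = (real e + 3 / 2) * Gamma (real e + 3 / 2)"
    using Gamma_plus1[of "real e + 3 / 2"] by (simp add: add_ac)
  also have "\<dots> = fact (2 * Suc e + 1) * sqrt pi / (2 ^ (2 * Suc e + 1) * fact (Suc e))"
    unfolding Suc by (simp add: divide_simps)
  finally show ?case .
qed

lemma sphere_area_pos: "d > 0 \<Longrightarrow> sphere_area d > 0"
  by (simp add: sphere_area_def)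

text \<open>Slicing the sphere by parallel hyperplanes, verified on closed forms. It provides the
  start \<open>K = 0\<close> of \<open>moment\<close>.\<close>

lemma sphere_area_odd: "sphere_area (2 * e + 3) = sphere_area (2 * e + 2) * wint e 1"
proof -
  have W1: "wint e 1 = 2 ^ (2 * e + 1) * (fact e)\<^sup>2 / fact (2 * e + 1)"
    by (simp only: wint_def mult_1 pint_quad_power)
  have "real (2 * e + 2) / 2 = 1 + real e" by simp
  then have g1: "Gamma (real (2 * e + 2) / 2) = fact e"
    using Gamma_fact[of e, where ?'a = real] by (simp only:)
  have "real (2 * e + 3) / 2 = real e + 3 / 2" by simp
  then have g2: "Gamma (real (2 * e + 3) / 2) = fact (2 * e + 1) * sqrt pi / (2 ^ (2 * e + 1) * fact e)"
    by (simp only: Gamma_half_odd)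
  have p: "pi powr (real (2 * e + 3) / 2) = pi powr (real (2 * e + 2) / 2) * sqrt pi"
    by (simp add: powr_half_sqrt[symmetric] add_divide_distrib add.commute flip: powr_add)
  have "2 * (p * q) / (F * q / (t * E)) = 2 * p / E * (t * E\<^sup>2 / F)"
    if "F > 0" "E > 0" "t > 0" "q > 0" for p q F t E :: real
    using that by (simp add: field_simps power2_eq_square)
  then show ?thesis unfolding sphere_area_def W1 g1 g2 p by (rule) simp_all
qed

text \<open>Meant for \<open>|w + r y| ^ (2 h)\<close> as a polynomial in \<open>r\<close>, with
  \<open>w\<close> a unit vector, \<open>u = w \<bullet> y\<close> and
  \<open>v = y \<bullet> y\<close>; \<open>j\<close> counts the quadratic factors chosen.\<close>

lemma coeff_quadratic_power:
  fixes u v :: real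
  shows "coeff ([:1, 2 * u, v:] ^ h) n
    = (\<Sum>j\<le>n div 2. real ((h choose j) * ((h - j) choose (n - 2 * j)) * 2 ^ (n - 2 * j)) * (v ^ j * u ^ (n -
      2 * j)))"
    (is "_ = sum ?f _")
proof -
  have lin: "coeff ([:1, 2 * u:] ^ N) i = real (N choose i) * (2 * u) ^ i" for N i
  proof (cases "i \<le> N")
    case False
    have "degree ([:1, 2 * u:] ^ N) \<le> 1 * N"
      by (rule order_trans[OF degree_power_le]) (simp add: degree_pCons_le)
    with False show ?thesis by (simp add: coeff_eq_0)
  qed (simp add: coeff_linear_poly_power)
  have "[:1, 2 * u, v:] = monom v 2 + [:1, 2 * u:]"
    by (rule poly_eqI) (auto simp: coeff_pCons split: nat.splits)
  then have "[:1, 2 * u, v:] ^ h = (\<Sum>j\<le>h. of_nat (h choose j) * monom v 2 ^ j * [:1, 2 * u:] ^ (h - j))"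
    by (simp only: binomial_ring)
  also have "\<dots> = (\<Sum>j\<le>h. smult (real (h choose j)) (monom (v ^ j) (2 * j) * [:1, 2 * u:] ^ (h - j)))"
    by (simp add: monom_power of_nat_poly mult.assoc mult.commute[of 2])
  finally have "coeff ([:1, 2 * u, v:] ^ h) n = (\<Sum>j\<le>h. real (h choose j) * (if n < 2 * j then 0 else v ^ j
    * coeff ([:1, 2 * u:] ^ (h - j)) (n - 2 * j)))"
    by (simp add: coeff_sum coeff_monom_mult)
  also have "\<dots> = (\<Sum>j\<le>h. if 2 * j \<le> n then ?f j else 0)"
    by (intro sum.cong) (auto simp: lin power_mult_distrib)
  also have "\<dots> = (\<Sum>j\<in>{..h} \<inter> {..n div 2}. ?f j)"
  proof -
    have "{..h} \<inter> {..n div 2} = {j \<in> {..h}. 2 * j \<le> n}" by auto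
    then show ?thesis by (simp only: sum.inter_filter finite_atMost)
  qed
  also have "\<dots> = sum ?f {..n div 2}"
    by (intro sum.mono_neutral_left) auto
  finally show ?thesis .
qed

abbreviation (input) sph :: "'a::euclidean_space measure" where "sph \<equiv> sphere_measure"

text \<open>A device for polarization: the value at \<open>r\<close> is the \<open>K\<close>-th
  moment of \<open>x + r y\<close> (\<open>poly_moment_poly\<close>), so mixed moments become
  coefficients of a known polynomial.\<close>

definition moment_poly :: "nat \<Rightarrow> 'a::euclidean_space \<Rightarrow> 'a \<Rightarrow> real poly" where
  "moment_poly K x y = (\<Sum>m\<le>K. monom (real (K choose m) * (LINT z|sph. (x \<bullet> z) ^ (K - m)
    * (y \<bullet> z) ^ m)) m)"

context
  fixes e :: nat and T :: "'a::euclidean_space itself"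
  assumes dim: "DIM('a) = 2 * e + 3"
begin

text \<open>Two vectors of equal norm are exchanged by the reflection along their
  difference.\<close>

lemma moment_isotropic:
  fixes x y :: 'a
  assumes "norm x = norm y"
  shows "(LINT z|sph. (x \<bullet> z) ^ K) = (LINT z|sph. (y \<bullet> z) ^ K)"
proof (cases "x = y")
  case False
  define w where "w = (x - y) /\<^sub>R norm (x - y)"
  have w: "norm w = 1" using False by (simp add: w_def)
  have "2 * ((x - y) \<bullet> x) = (norm (x - y))\<^sup>2"
    using assms unfolding power2_norm_eq_inner
    by (simp add: inner_diff_left inner_diff_right norm_eq inner_commute)
  moreover have "w \<bullet> x = ((x - y) \<bullet> x) / norm (x - y)" by (simp add: w_def divide_inverse
    mult.commute)
  ultimately have "2 * (w \<bullet> x) = norm (x - y)"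
    using False by (simp add: power2_eq_square)
  then have "(2 * (w \<bullet> x)) *\<^sub>R w = x - y"
    using False by (simp add: w_def)
  then have "y = reflect w x" by (simp add: reflect_def)
  then have "(LINT z|sph. (y \<bullet> z) ^ K) = (LINT z|sph. (x \<bullet> reflect w z) ^ K)"
    by (simp add: inner_reflect)
  also have "\<dots> = (LINT z|sph. (x \<bullet> z) ^ K)"
    by (rule integral_sphere_reflect[OF w, of "\<lambda>z. (x \<bullet> z) ^ K"]) (intro continuous_intros)
  finally show ?thesis by simp
qed simp

lemma moment_exists: "\<exists>C. \<forall>x::'a. (LINT z|sph. (x \<bullet> z) ^ K) = C * norm x ^ K"
proof -
  obtain b :: 'a where "b \<in> Basis" using nonempty_Basis by blast
  then have b: "norm b = 1" by simp
  have "(LINT z|sph. (x \<bullet> z) ^ K) = (LINT z|sph. (b \<bullet> z) ^ K) * norm x ^ K" for x :: 'a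
  proof -
    have "(LINT z|sph. (x \<bullet> z) ^ K) = (LINT z|sph. ((norm x *\<^sub>R b) \<bullet> z) ^ K)"
      by (rule moment_isotropic) (simp add: b)
    then show ?thesis by (simp add: power_mult_distrib)
  qed
  then show ?thesis by blast
qed

lemma coeff_moment_poly:
  fixes x y :: 'a
  shows "n \<le> K \<Longrightarrow> coeff (moment_poly K x y) n = real (K choose n)
    * (LINT z|sph. (x \<bullet> z) ^ (K - n) * (y \<bullet> z) ^ n)"
proof -
  assume n: "n \<le> K"
  have "coeff (moment_poly K x y) n = (\<Sum>m\<le>K. if m = n then real (K choose n)
    * (LINT z|sph. (x \<bullet> z) ^ (K - n) * (y \<bullet> z) ^ n) else 0)"
    unfolding moment_poly_def coeff_sum by (intro sum.cong) auto
  with n show ?thesis by simp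
qed

lemma poly_moment_poly:
  fixes x y :: 'a
  shows "poly (moment_poly K x y) r = (LINT z|sph. ((x + r *\<^sub>R y) \<bullet> z) ^ K)"
proof -
  have "(LINT z|sph. ((x + r *\<^sub>R y) \<bullet> z) ^ K)
      = (LINT z|sph. (\<Sum>m\<le>K. real (K choose m) * r ^ m * ((x \<bullet> z) ^ (K - m) * (y \<bullet> z) ^ m)))"
  proof (rule lint_cong)
    fix z :: 'a
    have "((x + r *\<^sub>R y) \<bullet> z) ^ K = (r * (y \<bullet> z) + x \<bullet> z) ^ K"
      by (simp add: inner_add_left add.commute)
    then show "((x + r *\<^sub>R y) \<bullet> z) ^ K = (\<Sum>m\<le>K. real (K choose m) * r ^ m
      * ((x \<bullet> z) ^ (K - m) * (y \<bullet> z) ^ m))"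
      by (simp only: binomial_ring) (simp add: power_mult_distrib mult_ac)
  qed simp
  also have "\<dots> = (\<Sum>m\<le>K. real (K choose m) * r ^ m * (LINT z|sph. (x \<bullet> z) ^ (K - m)
    * (y \<bullet> z) ^ m))"
    by (subst Bochner_Integration.integral_sum) (auto intro!: integrable_sphere continuous_intros)
  also have "\<dots> = poly (moment_poly K x y) r" by (simp add: moment_poly_def poly_sum poly_monom mult_ac)
  finally show ?thesis by simp
qed

lemma moment_polarize_aux:
  fixes x y :: 'a
  assumes C: "\<And>x::'a. (LINT z|sph. (x \<bullet> z) ^ (2 * h)) = C * norm x ^ (2 * h)" and n: "n \<le> 2 * h"
  shows "real (2 * h choose n) * (LINT z|sph. (x \<bullet> z) ^ (2 * h - n) * (y \<bullet> z) ^ n)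
     = C * coeff ([:x \<bullet> x, 2 * (x \<bullet> y), y \<bullet> y:] ^ h) n"
proof -
  have "poly (moment_poly (2 * h) x y) r = poly (smult C ([:x \<bullet> x, 2
    * (x \<bullet> y), y \<bullet> y:] ^ h)) r" for r
  proof -
    have "(norm (x + r *\<^sub>R y))\<^sup>2 = poly [:x \<bullet> x, 2 * (x \<bullet> y), y \<bullet> y:] r"
      unfolding power2_norm_eq_inner by (simp add: inner_add_left inner_add_right inner_commute algebra_simps)
    then show ?thesis unfolding poly_moment_poly C by (simp only: power_mult poly_power poly_smult)
  qed
  then have "poly (moment_poly (2 * h) x y) = poly (smult C ([:x \<bullet> x, 2
    * (x \<bullet> y), y \<bullet> y:] ^ h))"
    by (rule ext)
  then have "moment_poly (2 * h) x y = smult C ([:x \<bullet> x, 2 * (x \<bullet> y), y \<bullet> y:] ^ h)"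
    by (simp only: poly_eq_poly_eq_iff)
  with coeff_moment_poly[OF n, of x y] show ?thesis by simp
qed

lemma sphere_total: "(LINT z|(sph :: 'a measure). (1::real)) = sphere_area (2 * e + 3)"
  using emeasure_sphere_measure_sphere[where ?'a = 'a] sphere_area_pos[of "2 * e + 3"]
  by (simp add: measure_def dim)

text \<open>By isotropy only a constant \<open>C K\<close> is unknown, and it vanishes for odd
  \<open>K\<close>. Inserting the sum of \<open>(c \<bullet> z) ^ 2\<close> over the basis, which is
  1 on the sphere, and polarizing relates \<open>C (2 h + 2)\<close> to \<open>C (2 h)\<close> by
  the recursion that the weighted integrals of \<open>t ^ K\<close> satisfy.\<close>

theorem moment:
  fixes x :: 'a
  shows "(LINT z|sph. (x \<bullet> z) ^ K) = sphere_area (2 * e + 2) * wint e (monom 1 K) * norm x ^ K"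
proof -
  from moment_exists have "\<forall>K. \<exists>C. \<forall>x::'a. (LINT z|sph. (x \<bullet> z) ^ K) = C
    * norm x ^ K" by blast
  then obtain C where C: "(LINT z|sph. (x \<bullet> z) ^ K) = C K * norm x ^ K" for x :: 'a and K
    by metis
  obtain b :: 'a where "b \<in> Basis" using nonempty_Basis by blast
  then have b: "norm b = 1" by simp
  have odd: "C K = 0" if "odd K" for K
    using C[of b K] C[of "- b" K] that b by simp
  have rec: "real (2 * h + 2 * e + 3) * C (2 * Suc h) = real (2 * h + 1) * C (2 * h)" for h
  proof -
    \<comment> \<open>A mixed moment of second order in \<open>c\<close>, read off from
      \<open>|b + r c| ^ (2 h + 2)\<close> by polarization.\<close>
    have square_term: "real (2 * Suc h choose 2) * (LINT z|sph. (b \<bullet> z) ^ (2 * h) * (c \<bullet> z)\<^sup>2)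
        = C (2 * Suc h) * (real (Suc h choose 2) * 4 * (b \<bullet> c)\<^sup>2 + real (Suc h))"
      if "c \<in> Basis" for c
    proof -
      have "coeff ([:b \<bullet> b, 2 * (b \<bullet> c), c \<bullet> c:] ^ Suc h) 2 = real (Suc h choose 2) * 4
        * (b \<bullet> c)\<^sup>2 + real (Suc h)"
      proof -
        have "b \<bullet> b = 1" "c \<bullet> c = 1" using b that by (simp_all add: dot_square_norm)
        then show ?thesis by (simp only: coeff_quadratic_power) (simp add: eval_nat_numeral)
      qed
      moreover have "2 * Suc h - 2 = 2 * h" "2 \<le> 2 * Suc h" by simp_all
      ultimately show ?thesis
        using moment_polarize_aux[where h = "Suc h" and n = 2, OF C, of b c] by (simp only:)
    qed
    have "real (2 * Suc h choose 2) * C (2 * h) = real (2 * Suc h choose 2) * (LINT z|sph. (b \<bullet> z) ^ (2 * h))"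
      using C[of b "2 * h"] b by simp
    also have "(LINT z|sph. (b \<bullet> z) ^ (2 * h)) = (LINT z|sph. (\<Sum>c\<in>Basis. (b \<bullet> z) ^ (2 * h)
      * (c \<bullet> z)\<^sup>2))"
    proof (rule lint_cong)
      fix z :: 'a assume "z \<in> space sph"
      then have "z \<bullet> z = 1" by (simp add: dot_square_norm)
      then have "(\<Sum>c\<in>Basis. (c \<bullet> z)\<^sup>2) = 1"
        by (subst (asm) euclidean_inner) (simp add: power2_eq_square inner_commute)
      then show "(b \<bullet> z) ^ (2 * h) = (\<Sum>c\<in>Basis. (b \<bullet> z) ^ (2 * h) * (c \<bullet> z)\<^sup>2)"
        by (simp flip: sum_distrib_left)
    qed simp
    also have "\<dots> = (\<Sum>c\<in>Basis. LINT z|sph. (b \<bullet> z) ^ (2 * h) * (c \<bullet> z)\<^sup>2)"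
      by (subst Bochner_Integration.integral_sum) (auto intro!: integrable_sphere continuous_intros)
    also have "real (2 * Suc h choose 2) * \<dots> = (\<Sum>c\<in>Basis. C (2 * Suc h) * (real (Suc h choose 2) * 4
      * (b \<bullet> c)\<^sup>2 + real (Suc h)))"
      unfolding sum_distrib_left by (intro sum.cong square_term) auto
    also have "\<dots> = C (2 * Suc h) * (real (Suc h choose 2) * 4 * (\<Sum>c\<in>Basis. (b \<bullet> c)\<^sup>2)
      + real (Suc h) * real (2 * e + 3))"
      by (simp add: sum.distrib dim flip: sum_distrib_left)
    also have "(\<Sum>c\<in>Basis. (b \<bullet> c)\<^sup>2) = 1"
      using b euclidean_inner[of b b] by (simp add: power2_eq_square dot_square_norm)
    finally have *: "real (2 * Suc h choose 2) * C (2 * h) = C (2 * Suc h) * (real (Suc h choose 2) * 4 * 1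
      + real (Suc h) * real (2 * e + 3))" .
    have "2 * Suc h choose 2 = Suc h * (2 * h + 1)" by (simp add: choose_two)
    moreover have "real (Suc h choose 2) = real (Suc h) * real h / 2"
      by (simp add: choose_two real_of_nat_div algebra_simps)
    moreover have "a * (2 * k + 1) * A = B * (a * k / 2 * 4 * 1 + a * D) \<Longrightarrow> a * ((2 * k + 1) * A) = a
      * ((2 * k + D) * B)"
      for a k A B D :: real by (simp add: algebra_simps)
    ultimately have "real (Suc h) * (real (2 * h + 1) * C (2 * h)) = real (Suc h) * ((2 * real h + real (2 * e + 3))
      * C (2 * Suc h))"
      using * by (simp only: of_nat_mult of_nat_add of_nat_1 of_nat_numeral)
    then have "real (2 * h + 1) * C (2 * h) = (2 * real h + real (2 * e + 3)) * C (2 * Suc h)"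
      by (rule mult_left_cancel[THEN iffD1, rotated]) simp
    then show ?thesis by simp
  qed
  have even: "C (2 * h) = sphere_area (2 * e + 2) * wint e (monom 1 (2 * h))" for h
  proof (induction h)
    case 0
    have "C 0 = sphere_area (2 * e + 3)" using C[of b 0] sphere_total by simp
    then show ?case by (simp add: sphere_area_odd monom_0 one_pCons)
  next
    case (Suc h)
    have "real (2 * h + 2) * real (2 * h + 2 * e + 3) * wint e (monom 1 (2 * h + 2)) = real ((2 * h + 1) * (2 * h
      + 2)) * wint e (monom 1 (2 * h))"
      using wint_monom_leg_rec[of "2 * h" 0 e] by simp
    then have "real (2 * h + 2) * (real (2 * h + 2 * e + 3) * wint e (monom 1 (2 * Suc h))) = real (2 * h + 2)
      * (real (2 * h + 1) * wint e (monom 1 (2 * h)))"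
      by (simp add: algebra_simps)
    then have wint: "real (2 * h + 2 * e + 3) * wint e (monom 1 (2 * Suc h)) = real (2 * h + 1) * wint e (monom 1 (2
      * h))"
      by (rule mult_left_cancel[THEN iffD1, rotated]) simp
    have "real (2 * h + 2 * e + 3) * C (2 * Suc h) = real (2 * h + 2 * e + 3) * (sphere_area (2 * e + 2)
      * wint e (monom 1 (2 * Suc h)))"
      unfolding rec Suc using wint by (simp only: mult.left_commute)
    then show ?case by (rule mult_left_cancel[THEN iffD1, rotated]) simp
  qed
  have "C K = sphere_area (2 * e + 2) * wint e (monom 1 K)"
  proof (cases "even K")
    case True
    then show ?thesis using even by (auto elim: evenE)
  next
    case False
    have "wint e (monom 1 K) = 0"
    proof (rule wint_odd)
      show "pcompose (monom 1 K) [:0, -1:] = - monom (1::real) K"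
        using False by (intro poly_eqI) (auto simp: coeff_pcompose_linear)
    qed
    with False odd show ?thesis by simp
  qed
  then show ?thesis by (simp add: C)
qed

lemma moment_product:
  fixes x y :: 'a
  shows "(LINT z|sph. (x \<bullet> z) ^ k * (y \<bullet> z) ^ n)
     = (if even (k + n) then sphere_area (2 * e + 2) * wint e (monom 1 (k + n)) / real (k + n choose n)
          * coeff ([:x \<bullet> x, 2 * (x \<bullet> y), y \<bullet> y:] ^ ((k + n) div 2)) n else 0)"
proof (cases "even (k + n)")
  case True
  then obtain h where h: "k + n = 2 * h" by (rule evenE)
  then have k: "k = 2 * h - n" "n \<le> 2 * h" by auto
  have "real (2 * h choose n) > 0" using k(2) by simp
  then show ?thesis
    using moment_polarize_aux[OF moment k(2), of x y] unfolding h k(1)[symmetric]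
    by (simp add: field_simps)
next
  case False
  have W0: "wint e (monom 1 (k + n)) = 0"
  proof (rule wint_odd)
    show "pcompose (monom 1 (k + n)) [:0, -1:] = - monom (1::real) (k + n)"
      using False by (intro poly_eqI) (auto simp: coeff_pcompose_linear)
  qed
  have "moment_poly (k + n) x y = 0"
    by (simp add: poly_all_0_iff_0[symmetric] poly_moment_poly moment W0)
  with False coeff_moment_poly[of n "k + n" x y] show ?thesis by simp
qed

end

section \<open>Zonal functions\<close>

(* the area of the unit sphere of dimension d - 2, where d = 2 e + 3 *)
abbreviation (input) equator :: "nat \<Rightarrow> real" where "equator e \<equiv> sphere_area (2 * e + 2)"

context
  fixes e :: nat and T :: "'a::euclidean_space itself"
  assumes dim: "DIM('a) = 2 * e + 3"
begin

lemma integral_zonal: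
  fixes x :: 'a
  assumes "norm x = 1"
  shows "(LINT z|sph. poly p (x \<bullet> z)) = equator e * wint e p"
proof -
  have "(LINT z|sph. poly p (x \<bullet> z)) = (LINT z|sph. (\<Sum>k\<le>degree p. coeff p k * (x \<bullet> z) ^ k))"
    by (simp add: poly_altdef)
  also have "\<dots> = (\<Sum>k\<le>degree p. coeff p k * (LINT z|sph. (x \<bullet> z) ^ k))"
    by (subst Bochner_Integration.integral_sum) (auto intro!: integrable_sphere continuous_intros)
  also have "\<dots> = equator e * wint e (\<Sum>k\<le>degree p. smult (coeff p k) (monom 1 k))"
    by (simp add: moment[OF dim] assms wint_sum wint_smult sum_distrib_left mult_ac)
  also have "(\<Sum>k\<le>degree p. smult (coeff p k) (monom 1 k)) = p"
    by (simp add: smult_monom poly_as_sum_of_monoms)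
  finally show ?thesis .
qed

text \<open>The mixed moment contains \<open>w \<bullet> x\<close> only in powers
  \<open>n - 2 j\<close>, whatever \<open>k\<close> is. So convolution with a zonal polynomial does
  not raise degrees, which the Funk-Hecke argument needs.\<close>

lemma zonal_convolution_monom:
  "\<exists>r. degree r \<le> n \<and> (\<forall>w x::'a. norm w = 1 \<longrightarrow> norm x = 1 \<longrightarrow>
     (LINT z|sph. (w \<bullet> z) ^ k * (x \<bullet> z) ^ n) = poly r (w \<bullet> x))"
proof (cases "even (k + n)")
  case True
  define h where "h = (k + n) div 2"
  define r :: "real poly" where "r = smult (equator e * wint e (monom 1 (k + n)) / real (k + n choose n))
      (\<Sum>j\<le>n div 2. monom (real ((h choose j) * ((h - j) choose (n - 2 * j)) * 2 ^ (n - 2 * j))) (n - 2 * j))"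
  have "(LINT z|sph. (w \<bullet> z) ^ k * (x \<bullet> z) ^ n) = poly r (w \<bullet> x)" if "norm w = 1" "norm x
    = 1" for w x :: 'a
  proof -
    have "w \<bullet> w = 1" "x \<bullet> x = 1" using that by (simp_all add: dot_square_norm)
    then show ?thesis using True
      by (simp only: moment_product[OF dim] if_True coeff_quadratic_power r_def h_def)
        (simp add: poly_sum poly_monom)
  qed
  moreover have "degree r \<le> n" unfolding r_def
    by (intro order_trans[OF degree_smult_le] degree_sum_le) (auto intro: order_trans[OF degree_monom_le])
  ultimately show ?thesis by blast
next
  case False
  then show ?thesis by (intro exI[of _ 0]) (simp add: moment_product[OF dim])
qed

lemma zonal_convolution:
  "\<exists>r. degree r \<le> degree q \<and> (\<forall>w x::'a. norm w = 1 \<longrightarrow> norm x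
    = 1 \<longrightarrow>
     (LINT z|sph. poly p (w \<bullet> z) * poly q (x \<bullet> z)) = poly r (w \<bullet> x))"
proof -
  from zonal_convolution_monom have "\<forall>n k. \<exists>r. degree r \<le> n \<and> (\<forall>w x::'a. norm w
    = 1 \<longrightarrow> norm x = 1 \<longrightarrow>
     (LINT z|sph. (w \<bullet> z) ^ k * (x \<bullet> z) ^ n) = poly r (w \<bullet> x))" by blast
  then obtain r where deg: "\<And>n k. degree (r n k) \<le> n" and
    r: "\<And>n k w x. norm (w::'a) = 1 \<Longrightarrow> norm x = 1
      \<Longrightarrow> (LINT z|sph. (w \<bullet> z) ^ k * (x \<bullet> z) ^ n) = poly (r n k) (w \<bullet> x)"
    by metis
  define R where "R = (\<Sum>k\<le>degree p. \<Sum>n\<le>degree q. smult (coeff p k * coeff q n) (r n k))"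
  have "(LINT z|sph. poly p (w \<bullet> z) * poly q (x \<bullet> z)) = poly R (w \<bullet> x)" if "norm w
    = 1" "norm x = 1" for w x :: 'a
  proof -
    have "(LINT z|sph. poly p (w \<bullet> z) * poly q (x \<bullet> z))
      = (LINT z|sph. (\<Sum>k\<le>degree p. \<Sum>n\<le>degree q. (coeff p k * coeff q n) * ((w \<bullet> z) ^ k * (x
        \<bullet> z) ^ n)))"
      by (simp add: poly_altdef sum_product mult_ac)
    also have "\<dots> = (\<Sum>k\<le>degree p. \<Sum>n\<le>degree q. (coeff p k * coeff q n)
      * (LINT z|sph. (w \<bullet> z) ^ k * (x \<bullet> z) ^ n))"
      by (subst Bochner_Integration.integral_sum, intro integrable_sphere continuous_intros, rule sum.cong, rule refl,
          subst Bochner_Integration.integral_sum, intro integrable_sphere continuous_intros, simp)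
    also have "\<dots> = poly R (w \<bullet> x)" by (simp add: R_def poly_sum r that)
    finally show ?thesis .
  qed
  moreover have "degree R \<le> degree q" unfolding R_def
    by (intro degree_sum_le order_trans[OF degree_smult_le] order_trans[OF deg]) auto
  ultimately show ?thesis by blast
qed

text \<open>Convolution with \<open>q\<close> is self-adjoint for the weight: up to the factor
  \<open>equator e\<close>, both sides are one double integral over the sphere with a fixed pole
  \<open>x\<close>, taken in the two orders.\<close>

lemma zonal_convolution_adjoint:
  assumes r1: "\<And>w x::'a. norm w = 1 \<Longrightarrow> norm x = 1
    \<Longrightarrow> (LINT z|sph. poly q (w \<bullet> z) * poly p (x \<bullet> z)) = poly r1 (w \<bullet> x)"
    and r2: "\<And>w x::'a. norm w = 1 \<Longrightarrow> norm x = 1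
      \<Longrightarrow> (LINT z|sph. poly q (w \<bullet> z) * poly g (x \<bullet> z)) = poly r2 (w \<bullet> x)"
  shows "wint e (r1 * g) = wint e (p * r2)"
proof -
  obtain x :: 'a where "x \<in> Basis" using nonempty_Basis by blast
  then have x: "norm x = 1" by simp
  have "equator e * wint e (r1 * g) = (LINT w|sph. LINT z|sph. poly q (w \<bullet> z) * poly p (x \<bullet> z)
    * poly g (x \<bullet> w))"
    unfolding integral_zonal[OF x, symmetric]
  proof (rule lint_cong)
    fix w :: 'a assume "w \<in> space sph"
    then have "norm w = 1" by simp
    then have "(LINT z|sph. poly q (w \<bullet> z) * poly p (x \<bullet> z) * poly g (x \<bullet> w))
      = poly r1 (w \<bullet> x) * poly g (x \<bullet> w)"
      by (simp add: r1 x)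
    then show "poly (r1 * g) (x \<bullet> w) = (LINT z|sph. poly q (w \<bullet> z) * poly p (x \<bullet> z)
      * poly g (x \<bullet> w))"
      by (simp only: poly_mult inner_commute[of w x])
  qed simp
  also have "\<dots> = (LINT z|sph. LINT w|sph. poly q (w \<bullet> z) * poly p (x \<bullet> z)
    * poly g (x \<bullet> w))"
    by (rule sphere_fubini)
      (auto simp: case_prod_unfold intro!: continuous_intros)
  also have "\<dots> = (LINT z|sph. poly p (x \<bullet> z) * (LINT w|sph. poly q (z \<bullet> w)
    * poly g (x \<bullet> w)))"
  proof (rule lint_cong)
    fix z :: 'a
    show "(LINT w|sph. poly q (w \<bullet> z) * poly p (x \<bullet> z) * poly g (x \<bullet> w))
      = poly p (x \<bullet> z) * (LINT w|sph. poly q (z \<bullet> w) * poly g (x \<bullet> w))"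
      unfolding integral_mult_right_zero[symmetric]
      by (intro lint_cong) (simp_all add: inner_commute[of z])
  qed simp
  also have "\<dots> = equator e * wint e (p * r2)"
    unfolding integral_zonal[OF x, symmetric]
  proof (rule lint_cong)
    fix z :: 'a assume "z \<in> space sph"
    then have "norm z = 1" by simp
    then show "poly p (x \<bullet> z) * (LINT w|sph. poly q (z \<bullet> w) * poly g (x \<bullet> w)) = poly (p
      * r2) (x \<bullet> z)"
      by (simp add: r2 x inner_commute[of z x])
  qed simp
  finally show ?thesis using sphere_area_pos[of "2 * e + 2"] by simp
qed

text \<open>Convolution with \<open>q\<close> is self-adjoint and does not raise degrees, so the
  image of \<open>leg e n\<close> is orthogonal to lower degrees and \<open>orth_imp_leg\<close>
  applies; \<open>w = x\<close> yields the factor.\<close>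

theorem funk_hecke_zonal:
  fixes w x :: 'a
  assumes w: "norm w = 1" and x: "norm x = 1"
  shows "(LINT z|sph. poly q (w \<bullet> z) * poly (leg e n) (x \<bullet> z)) = equator e * wint e (q * leg e n)
    * poly (leg e n) (w \<bullet> x)"
proof -
  obtain r where deg: "degree r \<le> n" and
    r: "\<And>w x::'a. norm w = 1 \<Longrightarrow> norm x = 1 \<Longrightarrow> (LINT z|sph. poly q (w \<bullet> z)
      * poly (leg e n) (x \<bullet> z)) = poly r (w \<bullet> x)"
    using zonal_convolution[of "leg e n" q] by auto
  have "r = smult (poly r 1) (leg e n)"
  proof (rule orth_imp_leg[OF deg])
    fix g :: "real poly" assume g: "degree g < n"
    obtain r2 where r2: "degree r2 \<le> degree g"
      "\<And>w x::'a. norm w = 1 \<Longrightarrow> norm x = 1 \<Longrightarrow> (LINT z|sph. poly q (w \<bullet> z)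
        * poly g (x \<bullet> z)) = poly r2 (w \<bullet> x)"
      using zonal_convolution[of g q] by auto
    have "wint e (r * g) = wint e (leg e n * r2)" by (rule zonal_convolution_adjoint[OF r r2(2)])
    also have "\<dots> = 0" using r2(1) g by (simp add: wint_leg_lower)
    finally show "wint e (r * g) = 0" .
  qed
  moreover have "poly r 1 = equator e * wint e (q * leg e n)"
    using r[OF x x] x integral_zonal[OF x, of "q * leg e n"] by (simp add: dot_square_norm)
  ultimately have "r = smult (equator e * wint e (q * leg e n)) (leg e n)" by (simp only:)
  then show ?thesis using r[OF w x] by simp
qed

text \<open>By adjointness the convolution \<open>r\<close> of \<open>p\<close> with
  \<open>t ^ k\<close> has squared norm \<open>wint e (p * r2)\<close> with \<open>r2\<close> of
  degree at most \<open>k\<close>; so \<open>r\<close> is zero.\<close>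

lemma zonal_orthogonal_power:
  fixes w y :: 'a
  assumes w: "norm w = 1" and orth: "\<And>g. degree g \<le> N \<Longrightarrow> wint e (p * g)
    = 0" and k: "k \<le> N"
  shows "(LINT z|sph. poly p (w \<bullet> z) * (y \<bullet> z) ^ k) = 0"
proof (cases "y = 0")
  case True
  then show ?thesis using integral_zonal[OF w, of p] orth[of 1] by (cases "k = 0") auto
next
  case False
  define x where "x = y /\<^sub>R norm y"
  have x: "norm x = 1" and y: "y = norm y *\<^sub>R x" using False by (simp_all add: x_def)
  obtain r where deg: "degree r \<le> degree (monom 1 k :: real poly)" and
    r: "\<And>w x::'a. norm w = 1 \<Longrightarrow> norm x = 1 \<Longrightarrow> (LINT z|sph. poly p (w \<bullet> z)
      * poly (monom 1 k) (x \<bullet> z)) = poly r (w \<bullet> x)"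
    using zonal_convolution[of "monom 1 k" p] by auto
  obtain r2 where r2: "degree r2 \<le> degree r"
    "\<And>w x::'a. norm w = 1 \<Longrightarrow> norm x = 1 \<Longrightarrow> (LINT z|sph. poly (monom 1 k) (w
      \<bullet> z) * poly r (x \<bullet> z)) = poly r2 (w \<bullet> x)"
    using zonal_convolution[of r "monom 1 k"] by auto
  have r': "(LINT z|sph. poly (monom 1 k) (w \<bullet> z) * poly p (x \<bullet> z))
    = poly r (w \<bullet> x)" if "norm w = 1" "norm x = 1" for w x :: 'a
    using r[OF that(2,1)] by (simp add: mult.commute inner_commute)
  have "wint e (r * r) = wint e (p * r2)" by (rule zonal_convolution_adjoint[OF r' r2(2)])
  also have "\<dots> = 0" using r2(1) deg k by (intro orth) (simp add: degree_monom_eq)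
  finally have "r = 0" using wint_sq_pos[of r e] by force
  then have "(LINT z|sph. poly p (w \<bullet> z) * (x \<bullet> z) ^ k) = 0" using r[OF w x] by (simp add: poly_monom)
  moreover have "poly p (w \<bullet> z) * (y \<bullet> z) ^ k = norm y ^ k * (poly p (w \<bullet> z)
    * (x \<bullet> z) ^ k)" for z
    by (subst y) (simp add: power_mult_distrib)
  ultimately show ?thesis by (simp only: integral_mult_right_zero mult_zero_right)
qed

end

section \<open>Polynomial functions as sums of powers of linear forms\<close>

definition ridge_sum :: "(complex \<times> 'a::euclidean_space \<times> nat) list \<Rightarrow> 'a \<Rightarrow>
  complex" where
  "ridge_sum L z = (\<Sum>(c, y, k)\<leftarrow>L. c * of_real ((y \<bullet> z) ^ k))"

lemma ridge_sum_Nil [simp]: "ridge_sum [] z = 0"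
  and ridge_sum_Cons [simp]: "ridge_sum ((c, y, k) # L) z = c * of_real ((y \<bullet> z) ^ k) + ridge_sum L z"
  and ridge_sum_append: "ridge_sum (L @ L') z = ridge_sum L z + ridge_sum L' z"
  by (simp_all add: ridge_sum_def)

text \<open>The degree bound is on the powers of linear forms. In this shape, integrals against
  zonal functions and differences under reflections are handled one power at a time; products return
  to it by polarization (\<open>poly_fun_mult\<close>).\<close>

definition poly_fun :: "nat \<Rightarrow> ('a::euclidean_space \<Rightarrow> complex) \<Rightarrow> bool" where
  "poly_fun N f \<longleftrightarrow> (\<exists>L. f = ridge_sum L \<and> (\<forall>(c, y, k)\<in>set L. k \<le> N))"

lemma poly_fun_mono: "poly_fun N f \<Longrightarrow> N \<le> N' \<Longrightarrow> poly_fun N' f"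
  unfolding poly_fun_def by fastforce

lemma poly_fun_power: "k \<le> N \<Longrightarrow> poly_fun N (\<lambda>z. c * of_real ((y \<bullet> z) ^ k))"
  unfolding poly_fun_def by (rule exI[of _ "[(c, y, k)]"]) (auto simp: fun_eq_iff)

lemma poly_fun_const: "poly_fun N (\<lambda>z::'a::euclidean_space. c)"
  using poly_fun_power[of 0 N c "0::'a"] by simp

lemma poly_fun_add: "poly_fun N f \<Longrightarrow> poly_fun N g \<Longrightarrow> poly_fun N (\<lambda>z. f z + g z)"
proof -
  assume "poly_fun N f" "poly_fun N g"
  then obtain L L' where "f = ridge_sum L" "\<forall>(c, y, k)\<in>set L. k \<le> N" "g
    = ridge_sum L'" "\<forall>(c, y, k)\<in>set L'. k \<le> N"
    unfolding poly_fun_def by blast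
  then show ?thesis unfolding poly_fun_def
    by (intro exI[of _ "L @ L'"]) (auto simp: fun_eq_iff ridge_sum_append)
qed

lemma poly_fun_sum: "(\<And>i. i \<in> A \<Longrightarrow> poly_fun N (f i))
  \<Longrightarrow> poly_fun N (\<lambda>z. \<Sum>i\<in>A. f i z)"
  by (induction A rule: infinite_finite_induct) (auto intro: poly_fun_const poly_fun_add)

lemma poly_fun_induct [consumes 1, case_names zero add]:
  assumes "poly_fun N f" "P (\<lambda>_. 0)"
    and "\<And>c y k g. k \<le> N \<Longrightarrow> poly_fun N g \<Longrightarrow> P g
      \<Longrightarrow> P (\<lambda>z. c * of_real ((y \<bullet> z) ^ k) + g z)"
  shows "P f"
proof -
  obtain L where L: "f = ridge_sum L" "\<forall>(c, y, k)\<in>set L. k \<le> N" using assms(1) unfolding poly_fun_def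
    by blast
  from L(2) have "P (ridge_sum L) \<and> poly_fun N (ridge_sum L)"
  proof (induction L)
    case Nil
    have "ridge_sum [] = (\<lambda>_::'a. 0)" by (simp add: fun_eq_iff)
    then show ?case using assms(2) poly_fun_const[of N 0] by simp
  next
    case (Cons a L)
    obtain c y k where a: "a = (c, y, k)" by (cases a)
    have eq: "ridge_sum (a # L) = (\<lambda>z. c * of_real ((y \<bullet> z) ^ k)
      + ridge_sum L z)" by (simp add: fun_eq_iff a)
    have "k \<le> N" using Cons.prems a by simp
    moreover have "P (ridge_sum L)" "poly_fun N (ridge_sum L)" using Cons by auto
    ultimately show ?case unfolding eq
      by (intro conjI assms(3) poly_fun_add poly_fun_power)
  qed
  with L show ?thesis by simp
qed

lemma continuous_on_poly_fun: "poly_fun N f \<Longrightarrow> continuous_on S f"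
  by (induction rule: poly_fun_induct) (auto intro!: continuous_intros)

(* Applied to powers of X + s Y, this polarizes: X^n Y^m is a combination of powers of linear forms. *)
lemma coeff_interpolation:
  "\<exists>a. \<forall>q::real poly. degree q \<le> K \<longrightarrow> coeff q m = (\<Sum>s\<le>K. a s
    * poly q (real s))"
proof -
  define l where "l s = smult (1 / (\<Prod>r\<in>{..K} - {s}. real s - real r)) (\<Prod>r\<in>{..K}
    - {s}. [:- real r, 1:])" for s
  have l: "poly (l s) (real t) = (if s = t then 1 else 0)" if "s \<le> K" "t \<le> K" for s t
  proof (cases "s = t")
    case True
    then show ?thesis by (simp add: l_def poly_prod)
  next
    case False
    then have "(\<Prod>r\<in>{..K} - {s}. real t - real r) = 0" using that by (auto intro!: prod_zero)
    with False show ?thesis by (simp add: l_def poly_prod)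
  qed
  have "coeff q m = (\<Sum>s\<le>K. coeff (l s) m * poly q (real s))" if q: "degree q \<le> K" for q
  proof -
    define r where "r = q - (\<Sum>s\<le>K. smult (poly q (real s)) (l s))"
    have degl: "degree (l s) \<le> K" if "s \<le> K" for s
    proof -
      have "degree (l s) \<le> degree (\<Prod>r\<in>{..K} - {s}. [:- real r, 1:])" unfolding l_def by (rule
        degree_smult_le)
      also have "\<dots> \<le> (\<Sum>r\<in>{..K} - {s}. degree [:- real r, 1:])"
        using degree_prod_sum_le[of "{..K} - {s}" "\<lambda>r. [:- real r, 1:]"] by (simp add: comp_def)
      also have "\<dots> = K" using that by simp
      finally show ?thesis .
    qed
    have "r = 0"
    proof (rule ccontr)
      assume "r \<noteq> 0"
      have "poly r (real t) = 0" if "t \<le> K" for t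
      proof -
        have "(\<Sum>s\<le>K. poly q (real s) * poly (l s) (real t)) = (\<Sum>s\<le>K. if s
          = t then poly q (real t) else 0)"
          using that by (intro sum.cong) (auto simp: l)
        then show ?thesis using that by (simp add: r_def poly_sum)
      qed
      then have "real ` {..K} \<subseteq> {x. poly r x = 0}" by auto
      then have "card (real ` {..K}) \<le> card {x. poly r x = 0}"
        by (rule card_mono[OF poly_roots_finite[OF \<open>r \<noteq> 0\<close>]])
      also have "\<dots> \<le> degree r" by (rule card_poly_roots_bound[OF \<open>r \<noteq> 0\<close>])
      also have "\<dots> \<le> K" unfolding r_def using q degl
        by (intro degree_diff_le degree_sum_le order_trans[OF degree_smult_le]) auto
      finally show False by (simp add: card_image)
    qed
    then have "q = (\<Sum>s\<le>K. smult (poly q (real s)) (l s))" by (simp add: r_def)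
    then have "coeff q m = coeff (\<Sum>s\<le>K. smult (poly q (real s)) (l s)) m" by (rule arg_cong)
    then show ?thesis by (simp add: coeff_sum mult.commute)
  qed
  then show ?thesis by (intro exI[of _ "\<lambda>s. coeff (l s) m"]) blast
qed

lemma poly_fun_power_power: "n + m \<le> N \<Longrightarrow> poly_fun N (\<lambda>z. c * of_real ((x \<bullet> z) ^ n
  * (y \<bullet> z) ^ m))"
proof -
  assume N: "n + m \<le> N"
  let ?K = "n + m"
  obtain a where a: "\<And>q::real poly. degree q \<le> ?K \<Longrightarrow> coeff q m = (\<Sum>s\<le>?K. a s
    * poly q (real s))"
    using coeff_interpolation[of ?K m] by blast
  have "(x \<bullet> z) ^ n * (y \<bullet> z) ^ m = (\<Sum>s\<le>?K. a s / real (?K choose m) * ((x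
    + real s *\<^sub>R y) \<bullet> z) ^ ?K)" for z
  proof -
    let ?q = "[:x \<bullet> z, y \<bullet> z:] ^ ?K"
    have "degree ?q \<le> 1 * ?K" by (rule order_trans[OF degree_power_le]) (simp add: degree_pCons_le)
    then have "coeff ?q m = (\<Sum>s\<le>?K. a s * poly ?q (real s))" by (intro a) simp
    moreover have "coeff ?q m = real (?K choose m) * ((x \<bullet> z) ^ n * (y \<bullet> z) ^ m)"
      by (simp add: coeff_linear_poly_power)
    moreover have "real (?K choose m) > 0" by simp
    ultimately have "(x \<bullet> z) ^ n * (y \<bullet> z) ^ m = (\<Sum>s\<le>?K. a s * poly ?q (real s))
      / real (?K choose m)"
      by (simp add: field_simps)
    then show ?thesis by (simp add: sum_divide_distrib inner_add_left)
  qed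
  then have eq: "(\<lambda>z. c * of_real ((x \<bullet> z) ^ n * (y \<bullet> z) ^ m))
    = (\<lambda>z. \<Sum>s\<le>?K. (c * of_real (a s / real (?K choose m))) * of_real (((x + real s *\<^sub>R y)
      \<bullet> z) ^ ?K))"
    by (simp add: fun_eq_iff sum_distrib_left mult.assoc)
  show ?thesis unfolding eq using N by (intro poly_fun_sum poly_fun_power)
qed

lemma poly_fun_mult:
  assumes f: "poly_fun N f" and g: "poly_fun M g"
  shows "poly_fun (N + M) (\<lambda>z. f z * g z)"
  using f
proof (induction rule: poly_fun_induct)
  case zero
  show ?case using poly_fun_const[of "N + M" 0] by simp
next
  case (add c y k f)
  from g have "poly_fun (N + M) (\<lambda>z. c * of_real ((y \<bullet> z) ^ k) * g z)"
  proof (induction rule: poly_fun_induct)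
    case zero
    show ?case using poly_fun_const[of "N + M" 0] by simp
  next
    case (add c' y' k' g)
    have "poly_fun (N + M) (\<lambda>z. (c * c') * of_real ((y \<bullet> z) ^ k * (y' \<bullet> z) ^ k'))"
      using \<open>k \<le> N\<close> \<open>k' \<le> M\<close> by (intro poly_fun_power_power) simp
    from poly_fun_add[OF this add.IH] show ?case by (simp add: algebra_simps)
  qed
  from poly_fun_add[OF this add.IH] show ?case by (simp add: distrib_right)
qed

lemma poly_fun_cmult: "poly_fun N f \<Longrightarrow> poly_fun N (\<lambda>z. c * f z)"
  using poly_fun_mult[OF poly_fun_const[of 0 c]] by simp

lemma poly_fun_poly:
  assumes "degree p \<le> N"
  shows "poly_fun N (\<lambda>z. of_real (poly p (x \<bullet> z)))"
  unfolding poly_altdef of_real_sum of_real_mult using assms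
  by (intro poly_fun_sum poly_fun_power) simp

text \<open>For one power of a linear form this is the factorization of
  \<open>a ^ k - b ^ k\<close>, since \<open>y\<close> and \<open>reflect w y\<close> differ by a
  multiple of \<open>w\<close>; the quotient loses one degree.\<close>

lemma poly_fun_reflect_diff:
  assumes "poly_fun N f"
  shows "\<exists>g. poly_fun (N - 1) g \<and> (\<forall>z. f z - f (reflect w z) = of_real (w \<bullet> z) * g z)"
  using assms
proof (induction rule: poly_fun_induct)
  case zero
  show ?case using poly_fun_const[of "N - 1" 0] by (intro exI[of _ "\<lambda>_. 0"]) simp
next
  case (add c y k f)
  then obtain g where g: "poly_fun (N - 1) g" "\<And>z. f z - f (reflect w z) = of_real (w \<bullet> z)
    * g z" by blast
  define h where "h z = (\<Sum>i<k. (c * of_real (2 * (w \<bullet> y))) * of_real ((reflect w y \<bullet> z) ^ (k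
    - Suc i) * (y \<bullet> z) ^ i))" for z
  have "poly_fun (N - 1) h" unfolding h_def using \<open>k \<le> N\<close>
    by (intro poly_fun_sum poly_fun_power_power) auto
  moreover have "c * of_real ((y \<bullet> z) ^ k) - c * of_real ((y \<bullet> reflect w z) ^ k)
    = of_real (w \<bullet> z) * h z" for z
  proof -
    let ?S = "\<Sum>i<k. (reflect w y \<bullet> z) ^ (k - Suc i) * (y \<bullet> z) ^ i"
    have "c * of_real ((y \<bullet> z) ^ k) - c * of_real ((y \<bullet> reflect w z) ^ k) = c
      * of_real ((y \<bullet> z) ^ k - (reflect w y \<bullet> z) ^ k)"
      by (simp add: inner_reflect right_diff_distrib)
    also have "(y \<bullet> z) ^ k - (reflect w y \<bullet> z) ^ k = (y \<bullet> z - reflect w y \<bullet> z) * ?S"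
      by (rule power_diff_sumr2)
    also have "y \<bullet> z - reflect w y \<bullet> z = (w \<bullet> z) * (2 * (w \<bullet> y))"
      by (simp add: reflect_def inner_diff_left)
    also have "c * of_real ((w \<bullet> z) * (2 * (w \<bullet> y)) * ?S) = of_real (w \<bullet> z) * ((c
      * of_real (2 * (w \<bullet> y))) * of_real ?S)"
      by (simp only: of_real_mult mult_ac)
    also have "(c * of_real (2 * (w \<bullet> y))) * of_real ?S = h z"
      by (simp only: h_def sum_distrib_left of_real_sum)
    finally show ?thesis .
  qed
  ultimately have "poly_fun (N - 1) (\<lambda>z. h z + g z)" "c * of_real ((y \<bullet> z) ^ k) + f z - (c
    * of_real ((y \<bullet> reflect w z) ^ k) + f (reflect w z)) = of_real (w \<bullet> z) * (h z + g z)" for z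
    using g by (simp_all only: add_diff_add distrib_left poly_fun_add)
  then show ?case by (intro exI[of _ "\<lambda>z. h z + g z"]) blast
qed

lemma real_polynomial_imp_poly_fun:
  assumes "real_polynomial_function f"
  shows "\<exists>N. poly_fun N (\<lambda>z::'a::euclidean_space. of_real (f z))"
  using assms
proof (induction rule: real_polynomial_function.induct)
  case (linear f)
  define y where "y = (\<Sum>b\<in>Basis. f b *\<^sub>R b)"
  interpret bounded_linear f by fact
  have "f z = y \<bullet> z" for z
  proof -
    have "f z = f (\<Sum>b\<in>Basis. (z \<bullet> b) *\<^sub>R b)" by (simp add: euclidean_representation)
    also have "\<dots> = (\<Sum>b\<in>Basis. (z \<bullet> b) * f b)" by (simp add: sum scaleR)
    also have "\<dots> = (\<Sum>b\<in>Basis. f b * (b \<bullet> z))" by (intro sum.cong) (simp_all add: inner_commute)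
    also have "\<dots> = y \<bullet> z" by (simp add: y_def inner_sum_left)
    finally show ?thesis .
  qed
  then show ?case using poly_fun_power[of 1 1 1 y] by auto
next
  case (const c)
  show ?case using poly_fun_const by blast
next
  case (add f g)
  then obtain N M where NM: "poly_fun N (\<lambda>z. of_real (f z))" "poly_fun M (\<lambda>z. of_real (g z))" by blast
  have "poly_fun (max N M) (\<lambda>z. of_real (f z) + of_real (g z))"
    by (rule poly_fun_add[OF poly_fun_mono[OF NM(1)] poly_fun_mono[OF NM(2)]]) simp_all
  then show ?case by auto
next
  case (mult f g)
  then obtain N M where "poly_fun N (\<lambda>z. of_real (f z))" "poly_fun M (\<lambda>z. of_real (g z))" by blast
  from poly_fun_mult[OF this] show ?case by auto
qed

lemma polynomial_imp_poly_fun: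
  fixes p :: "'a::euclidean_space \<Rightarrow> complex"
  assumes "polynomial_function p"
  shows "\<exists>N. poly_fun N p"
proof -
  have "real_polynomial_function (Re \<circ> p)" "real_polynomial_function (Im \<circ> p)"
    using assms bounded_linear_Re bounded_linear_Im by (auto simp: polynomial_function_def)
  from this[THEN real_polynomial_imp_poly_fun]
  obtain N M where NM: "poly_fun N (\<lambda>z. of_real (Re (p z)))" "poly_fun M (\<lambda>z. of_real (Im (p z)))"
    unfolding comp_def by blast
  have "poly_fun (max N M) (\<lambda>z. of_real (Re (p z)))" "poly_fun (max N M) (\<lambda>z. of_real (Im (p z)))"
    by (rule poly_fun_mono[OF NM(1)], simp, rule poly_fun_mono[OF NM(2)], simp)
  then have "poly_fun (max N M) (\<lambda>z. of_real (Re (p z)) + \<i> * of_real (Im (p z)))"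
    by (rule poly_fun_add[OF _ poly_fun_cmult])
  moreover have "(\<lambda>z. of_real (Re (p z)) + \<i> * of_real (Im (p z))) = p"
    by (rule ext) (rule complex_eq[symmetric])
  ultimately have "poly_fun (max N M) p" by (simp only:)
  then show ?thesis by (rule exI)
qed

section \<open>Harmonic polynomials and the Funk-Hecke formula\<close>

definition ridge_hom :: "nat \<Rightarrow> (complex \<times> 'a::euclidean_space) list \<Rightarrow> 'a \<Rightarrow>
  complex" where
  "ridge_hom n L z = (\<Sum>(c, y)\<leftarrow>L. c * of_real ((y \<bullet> z) ^ n))"

lemma ridge_hom_Nil [simp]: "ridge_hom n [] z = 0"
  and ridge_hom_Cons [simp]: "ridge_hom n ((c, y) # L) z = c * of_real ((y \<bullet> z) ^ n) + ridge_hom n L z"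
  by (simp_all add: ridge_hom_def)

lemma poly_fun_ridge_hom: "poly_fun n (ridge_hom n L)"
proof (induction L)
  case Nil
  have "ridge_hom n [] = (\<lambda>_::'a. 0)" by (simp add: fun_eq_iff)
  then show ?case using poly_fun_const[of n 0] by simp
next
  case (Cons a L)
  obtain c y where a: "a = (c, y)" by (cases a)
  have "ridge_hom n (a # L) = (\<lambda>z. c * of_real ((y \<bullet> z) ^ n)
    + ridge_hom n L z)" by (simp add: fun_eq_iff a)
  then show ?case using poly_fun_add[OF poly_fun_power[of n n c y] Cons] by simp
qed

text \<open>On the ray through \<open>z\<close>, a sum of powers of linear forms is a polynomial in
  the scaling factor. Homogeneity equates it with \<open>p z\<close> times the \<open>n\<close>-th
  power, so the terms of exponent \<open>n\<close> alone represent \<open>p\<close>.\<close>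

lemma homogeneous_ridge_hom:
  fixes p :: "'a::euclidean_space \<Rightarrow> complex"
  assumes p: "polynomial_function p" and hom: "\<And>c x. p (c *\<^sub>R x) = of_real (c ^ n) * p x"
  shows "\<exists>L. p = ridge_hom n L"
proof -
  obtain N where "poly_fun N p" using polynomial_imp_poly_fun[OF p] by blast
  then obtain L where L: "p = ridge_sum L" unfolding poly_fun_def by blast
  define H where "H = map (\<lambda>(c, y, k). (c, y)) (filter (\<lambda>(c, y, k). k = n) L)"
  have "p z = ridge_hom n H z" for z
  proof -
    define P where "P L = (\<Sum>(c, y, k)\<leftarrow>L. monom (c
      * of_real ((y \<bullet> z) ^ k)) k)" for L :: "(complex \<times> 'a \<times> nat) list"
    have "poly (P L) (of_real r) = ridge_sum L (r *\<^sub>R z)" for r L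
      by (induction L) (auto simp: P_def poly_monom power_mult_distrib)
    then have "poly (P L) (of_real r) = poly (monom (p z) n) (of_real r)" for r
      by (simp add: L[symmetric] hom poly_monom mult.commute)
    then have "range (of_real :: real \<Rightarrow> complex) \<subseteq> {v. poly (P L - monom (p z) n) v
      = 0}" by auto
    moreover have "infinite (range (of_real :: real \<Rightarrow> complex))"
      using finite_imageD[of "of_real :: real \<Rightarrow> complex" UNIV] infinite_UNIV_char_0
      by (auto simp: inj_on_def)
    ultimately have "P L - monom (p z) n = 0"
      using poly_roots_finite[of "P L - monom (p z) n"] finite_subset by blast
    then have "coeff (P L) n = p z" by simp
    moreover have "coeff (P L) n = ridge_hom n (map (\<lambda>(c, y, k). (c, y)) (filter (\<lambda>(c, y, k). k
      = n) L)) z" for L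
      by (induction L) (auto simp: P_def)
    ultimately show ?thesis by (simp add: H_def)
  qed
  then show ?thesis by blast
qed

lemma ridge_hom_vector_derivative:
  "((\<lambda>t. ridge_hom n L (x + t *\<^sub>R b)) has_vector_derivative
     ridge_hom (n - 1) (map (\<lambda>(c, y). (c * of_real (real n * (y \<bullet> b)), y)) L) x) (at 0)"
proof (induction L)
  case (Cons a L)
  obtain c y where a: "a = (c, y)" by (cases a)
  have "((\<lambda>t. (y \<bullet> (x + t *\<^sub>R b)) ^ n) has_real_derivative real n * (y \<bullet> x) ^ (n - 1)
    * (y \<bullet> b)) (at 0)"
    by (auto intro!: derivative_eq_intros simp: inner_add_right)
  then have "((\<lambda>t. of_real ((y \<bullet> (x + t *\<^sub>R b)) ^ n)) has_vector_derivative complex_of_real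
    (real n * (y \<bullet> x) ^ (n - 1) * (y \<bullet> b))) (at 0)"
    by (intro has_vector_derivative_of_real) (simp add: has_real_derivative_iff_has_vector_derivative)
  then have "((\<lambda>t. c * of_real ((y \<bullet> (x + t *\<^sub>R b)) ^ n)) has_vector_derivative c
    * complex_of_real (real n * (y \<bullet> x) ^ (n - 1) * (y \<bullet> b))) (at 0)"
    by (rule has_vector_derivative_mult_right)
  from has_vector_derivative_add[OF this Cons] show ?case by (simp add: a mult_ac)
qed simp

lemma partial_deriv_ridge_hom:
  "partial_deriv b (ridge_hom n L) = ridge_hom (n - 1) (map (\<lambda>(c, y). (c * of_real (real n
    * (y \<bullet> b)), y)) L)"
  unfolding partial_deriv_def by (rule ext) (rule vector_derivative_at[OF ridge_hom_vector_derivative])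

lemma laplacian_ridge_hom:
  "laplacian (ridge_hom n L) x = of_real (real n * real (n - 1)) * ridge_hom (n - 2) (map (\<lambda>(c, y). (c
    * of_real (y \<bullet> y), y)) L) x"
proof -
  have "laplacian (ridge_hom n L) x = (\<Sum>b\<in>Basis. ridge_hom (n - 2) (map (\<lambda>(c, y). (c
    * of_real (real n * (y \<bullet> b) * (real (n - 1) * (y \<bullet> b))), y)) L) x)"
    by (simp add: laplacian_def partial_deriv_ridge_hom case_prod_unfold comp_def mult_ac numeral_2_eq_2)
  also have "\<dots> = of_real (real n * real (n - 1)) * ridge_hom (n - 2) (map (\<lambda>(c, y). (c
    * of_real (y \<bullet> y), y)) L) x"
  proof (induction L)
    case (Cons a L)
    obtain c y where a: "a = (c, y)" by (cases a)
    have "(\<Sum>b\<in>Basis. c * of_real (real n * (y \<bullet> b) * (real (n - 1) * (y \<bullet> b)))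
      * of_real ((y \<bullet> x) ^ (n - 2)))
      = c * of_real (real n * real (n - 1) * (\<Sum>b\<in>Basis. (y \<bullet> b) * (y \<bullet> b))) * of_real ((y
        \<bullet> x) ^ (n - 2))"
      by (simp only: sum_distrib_left sum_distrib_right of_real_sum of_real_mult mult_ac)
    also have "(\<Sum>b\<in>Basis. (y \<bullet> b) * (y \<bullet> b))
      = y \<bullet> y" by (rule euclidean_inner[symmetric])
    finally show ?case using Cons by (simp add: a sum.distrib) (simp add: algebra_simps)
  qed simp
  finally show ?thesis .
qed

text \<open>For \<open>2 * j \<le> n\<close>, \<open>ridge_hom (n - 2 * j) (ridge_lap j L)\<close>
  is the \<open>j\<close>-th iterated Laplacian of \<open>ridge_hom n L\<close> without its
  numerical factor, because each Laplacian multiplies a power of \<open>y \<bullet> z\<close> by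
  \<open>y \<bullet> y\<close> and lowers it by two.\<close>

definition ridge_lap :: "nat \<Rightarrow> (complex \<times> 'a::euclidean_space) list \<Rightarrow> (complex
  \<times> 'a) list" where
  "ridge_lap j L = map (\<lambda>(c, y). (c * of_real ((y \<bullet> y) ^ j), y)) L"

lemma ridge_lap_0 [simp]: "ridge_lap 0 L = L"
  by (simp add: ridge_lap_def case_prod_unfold)

lemma ridge_lap_Suc: "ridge_lap (Suc j) L = map (\<lambda>(c, y). (c * of_real (y \<bullet> y), y)) (ridge_lap j L)"
  by (simp add: ridge_lap_def case_prod_unfold comp_def mult_ac)

lemma ridge_lap_harmonic:
  assumes "\<And>x. laplacian (ridge_hom n L) x = 0" "1 \<le> j" "2 * j \<le> n"
  shows "ridge_hom (n - 2 * j) (ridge_lap j L) x = 0"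
  using assms(2,3)
proof (induction j arbitrary: x)
  case (Suc j)
  have zero: "laplacian (ridge_hom (n - 2 * j) (ridge_lap j L)) x = 0"
  proof (cases "j = 0")
    case True
    then show ?thesis using assms(1) by simp
  next
    case False
    then have "ridge_hom (n - 2 * j) (ridge_lap j L) = ridge_hom 0 []" using Suc by (auto simp: fun_eq_iff)
    then show ?thesis by (simp only: laplacian_ridge_hom) simp
  qed
  have "complex_of_real (real (n - 2 * j) * real (n - 2 * j - 1)) \<noteq> 0"
    using Suc.prems by (simp only: of_real_eq_0_iff mult_eq_0_iff of_nat_eq_0_iff) simp
  with zero have "ridge_hom (n - 2 * j - 2) (ridge_lap (Suc j) L) x = 0"
    by (simp only: laplacian_ridge_hom ridge_lap_Suc mult_eq_0_iff simp_thms)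
  then show ?case by simp
qed simp

definition harmonic_on_sphere :: "nat \<Rightarrow> ('a::euclidean_space \<Rightarrow> complex) \<Rightarrow> bool"
  where
  "harmonic_on_sphere n Y \<longleftrightarrow> (\<exists>p\<in>harmonic_homogeneous n. \<forall>u\<in>sphere 0 1. Y
    u = p u)"

lemma harmonic_ridge_hom:
  assumes "p \<in> harmonic_homogeneous n"
  shows "\<exists>L. p = ridge_hom n L \<and> (\<forall>x. laplacian (ridge_hom n L) x = 0)"
  using assms homogeneous_ridge_hom[of p n] unfolding harmonic_homogeneous_def by blast

text \<open>The \<open>j = 0\<close> term of the moment expansion in
  \<open>integral_power_ridge_hom\<close>; for a harmonic form the others vanish
  (\<open>ridge_lap_harmonic\<close>).\<close>

definition funk_hecke_const :: "nat \<Rightarrow> nat \<Rightarrow> nat \<Rightarrow> real" where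
  "funk_hecke_const e k n = (if even (k + n) then equator e * wint e (monom 1 (k + n)) / real (k + n choose n)
    * real (((k + n) div 2 choose n) * 2 ^ n) else 0)"

lemma funk_hecke_const_lower: "k < n \<Longrightarrow> funk_hecke_const e k n = 0"
proof -
  assume "k < n"
  then have "(k + n) div 2 < n" by linarith
  then show ?thesis by (simp add: funk_hecke_const_def)
qed

lemma funk_hecke_const_diag: "funk_hecke_const e n n > 0"
proof -
  have "wint e (monom 1 n * monom 1 n) > 0" by (intro wint_sq_pos) simp
  then have "wint e (monom 1 (n + n)) > 0" by (simp add: mult_monom)
  then show ?thesis using sphere_area_pos[of "2 * e + 2"] by (simp add: funk_hecke_const_def)
qed

context
  fixes e :: nat and T :: "'a::euclidean_space itself"
  assumes dim: "DIM('a) = 2 * e + 3"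
begin

lemma integral_power_ridge_hom:
  fixes w :: 'a
  assumes w: "norm w = 1"
  shows "(LINT z|sph. of_real ((w \<bullet> z) ^ k) * ridge_hom n L z)
    = (if even (k + n) then of_real (equator e * wint e (monom 1 (k + n)) / real (k + n choose n)) *
        (\<Sum>j\<le>n div 2. of_real (real (((k + n) div 2 choose j) * (((k + n) div 2 - j) choose (n - 2 * j)) * 2
          ^ (n - 2 * j)))
          * ridge_hom (n - 2 * j) (ridge_lap j L) w) else 0)"
    (is "_ = ?R L")
proof (induction L)
  case Nil
  show ?case by (simp add: ridge_lap_def)
next
  case (Cons a L)
  obtain c y where a: "a = (c, y)" by (cases a)
  have ww: "w \<bullet> w = 1" using w by (simp add: dot_square_norm)
  have "(LINT z|sph. of_real ((w \<bullet> z) ^ k) * ridge_hom n (a # L) z)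
    = (LINT z|sph. c * of_real ((w \<bullet> z) ^ k * (y \<bullet> z) ^ n) + of_real ((w \<bullet> z) ^ k) *
      ridge_hom n L z)"
    by (simp add: a algebra_simps)
  also have "\<dots> = (LINT z|sph. c * of_real ((w \<bullet> z) ^ k * (y \<bullet> z) ^ n))
    + (LINT z|sph. of_real ((w \<bullet> z) ^ k) * ridge_hom n L z)"
    by (intro Bochner_Integration.integral_add integrable_sphere continuous_intros continuous_on_poly_fun[OF
      poly_fun_ridge_hom])
  also have "(LINT z|sph. c * of_real ((w \<bullet> z) ^ k * (y \<bullet> z) ^ n)) = c
    * of_real (LINT z|sph. (w \<bullet> z) ^ k * (y \<bullet> z) ^ n)"
    by (simp only: integral_mult_right_zero integral_complex_of_real)
  also have "\<dots> = ?R [(c, y)]"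
    unfolding moment_product[OF dim] ww coeff_quadratic_power
    by (simp add: ridge_lap_def sum_distrib_left inner_commute mult_ac del: of_nat_mult of_nat_add of_nat_power)
  also have "?R [(c, y)] + (LINT z|sph. of_real ((w \<bullet> z) ^ k) * ridge_hom n L z) = ?R (a # L)"
    unfolding Cons a
    by (simp add: ridge_lap_def sum.distrib sum_distrib_left distrib_left del: of_nat_mult of_nat_add of_nat_power)
  finally show ?case .
qed

lemma integral_power_harmonic:
  fixes w :: 'a
  assumes w: "norm w = 1" and harm: "\<And>x. laplacian (ridge_hom n L) x = 0"
  shows "(LINT z|sph. of_real ((w \<bullet> z) ^ k) * ridge_hom n L z) = of_real (funk_hecke_const e k n)
    * ridge_hom n L w"
proof -
  have "(\<Sum>j\<le>n div 2. of_real (real (((k + n) div 2 choose j) * (((k + n) div 2 - j) choose (n - 2 * j))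
    * 2 ^ (n - 2 * j)))
          * ridge_hom (n - 2 * j) (ridge_lap j L) w)
      = (\<Sum>j\<in>{0}. of_real (real (((k + n) div 2 choose j) * (((k + n) div 2 - j) choose (n - 2 * j)) * 2 ^ (n
        - 2 * j)))
          * ridge_hom (n - 2 * j) (ridge_lap j L) w)"
    by (rule sum.mono_neutral_right) (auto simp: ridge_lap_harmonic[OF harm])
  then show ?thesis unfolding integral_power_ridge_hom[OF w] by (simp add: funk_hecke_const_def)
qed

text \<open>That \<open>Y\<close> is reproduced up to a factor \<open>\<alpha> q\<close> follows
  from the case of powers. To identify the factor, \<open>q\<close> is convolved with
  \<open>leg e n\<close> and integrated against \<open>Y\<close> in both orders: the zonal formula
  gives the claimed constant times \<open>\<alpha> (leg e n)\<close>, Fubini gives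
  \<open>\<alpha> q\<close> times it.\<close>

theorem funk_hecke:
  fixes w :: 'a and Y :: "'a \<Rightarrow> complex"
  assumes w: "norm w = 1" and Y: "harmonic_on_sphere n Y"
  shows "(LINT z|sph. of_real (poly q (w \<bullet> z)) * Y z) = of_real (equator e * wint e (q * leg e n)) * Y w"
proof -
  obtain p where p: "p \<in> harmonic_homogeneous n" "\<And>u. norm u = 1 \<Longrightarrow> Y u = p u"
    using Y by (auto simp: harmonic_on_sphere_def)
  obtain L where L: "p = ridge_hom n L" "\<And>x. laplacian (ridge_hom n L) x = 0"
    using harmonic_ridge_hom[OF p(1)] by blast
  have cont: "continuous_on S p" for S unfolding L by (rule continuous_on_poly_fun[OF poly_fun_ridge_hom])
  define \<alpha> where "\<alpha> q = (\<Sum>k\<le>degree q. coeff q k * funk_hecke_const e k n)" for q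
  have \<alpha>: "(LINT z|sph. of_real (poly q (w \<bullet> z)) * p z) = of_real (\<alpha> q) * p w" if "norm w
    = 1" for q and w :: 'a
  proof -
    have "(LINT z|sph. of_real (poly q (w \<bullet> z)) * p z)
      = (LINT z|sph. (\<Sum>k\<le>degree q. of_real (coeff q k) * (of_real ((w \<bullet> z) ^ k) * p z)))"
      by (simp only: poly_altdef of_real_sum of_real_mult sum_distrib_right mult.assoc)
    also have "\<dots> = (\<Sum>k\<le>degree q. of_real (coeff q k) * (LINT z|sph. of_real ((w \<bullet> z) ^ k)
      * p z))"
      by (subst Bochner_Integration.integral_sum, intro integrable_sphere continuous_intros cont)
        (simp only: integral_mult_right_zero)
    also have "\<dots> = of_real (\<alpha> q) * p w"
      unfolding L integral_power_harmonic[OF that L(2)] \<alpha>_def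
      by (simp only: of_real_sum of_real_mult sum_distrib_right mult.assoc)
    finally show ?thesis .
  qed
  \<comment> \<open>Powers below \<open>n\<close> contribute zero, so only the leading coefficient
    counts and \<open>\<alpha> (leg e n)\<close> is nonzero.\<close>
  have "\<alpha> (leg e n) = (\<Sum>k\<in>{n}. coeff (leg e n) k * funk_hecke_const e k n)"
    unfolding \<alpha>_def degree_leg by (rule sum.mono_neutral_right) (auto simp: funk_hecke_const_lower)
  then have nz: "\<alpha> (leg e n) \<noteq> 0" using funk_hecke_const_diag[of e n] leg_lead_pos[of e n] by simp
  have "of_real (equator e * wint e (q * leg e n)) * (of_real (\<alpha> (leg e n)) * p w)
      = of_real (equator e * wint e (q * leg e n)) * (LINT z|sph. of_real (poly (leg e n) (w \<bullet> z)) * p z)"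
    by (simp only: \<alpha>[OF w])
  also have "\<dots> = (LINT z|sph. of_real (LINT \<eta>|sph. poly q (w \<bullet> \<eta>)
    * poly (leg e n) (z \<bullet> \<eta>)) * p z)"
    unfolding integral_mult_right_zero[symmetric]
  proof (rule lint_cong)
    fix z :: 'a assume "z \<in> space sph"
    then have "norm z = 1" by simp
    then show "of_real (equator e * wint e (q * leg e n)) * (of_real (poly (leg e n) (w \<bullet> z)) * p z)
      = of_real (LINT \<eta>|sph. poly q (w \<bullet> \<eta>) * poly (leg e n) (z \<bullet> \<eta>)) * p z"
      by (simp only: funk_hecke_zonal[OF dim w] of_real_mult mult.assoc)
  qed simp
  also have "\<dots> = (LINT z|sph. LINT \<eta>|sph. of_real (poly q (w \<bullet> \<eta>)
    * poly (leg e n) (z \<bullet> \<eta>)) * p z)"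
    by (simp only: integral_mult_left_zero integral_complex_of_real)
  also have "\<dots> = (LINT \<eta>|sph. LINT z|sph. of_real (poly q (w \<bullet> \<eta>)
    * poly (leg e n) (z \<bullet> \<eta>)) * p z)"
    by (rule sphere_fubini)
      (auto simp: case_prod_unfold intro!: continuous_intros continuous_on_compose2[OF cont[of UNIV]])
  also have "\<dots> = (LINT \<eta>|sph. of_real (poly q (w \<bullet> \<eta>))
    * (LINT z|sph. of_real (poly (leg e n) (\<eta> \<bullet> z)) * p z))"
    by (simp only: of_real_mult mult.assoc integral_mult_right_zero inner_commute)
  also have "\<dots> = (LINT \<eta>|sph. of_real (\<alpha> (leg e n)) * (of_real (poly q (w \<bullet> \<eta>))
    * p \<eta>))"
    by (rule lint_cong) (auto simp: \<alpha>)
  also have "\<dots> = of_real (\<alpha> (leg e n)) * (of_real (\<alpha> q) * p w)"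
    by (simp only: integral_mult_right_zero \<alpha>[OF w])
  finally have "of_real (equator e * wint e (q * leg e n)) * p w = of_real (\<alpha> q) * p w" using nz by simp
  moreover have "(LINT z|sph. of_real (poly q (w \<bullet> z)) * Y z) = (LINT z|sph. of_real (poly q (w \<bullet> z))
    * p z)"
    by (rule lint_cong) (auto simp: p(2))
  ultimately show ?thesis by (simp only: \<alpha>[OF w] p(2)[OF w])
qed

lemma zonal_orthogonal_poly_fun:
  fixes w :: 'a
  assumes w: "norm w = 1" and orth: "\<And>g. degree g \<le> N \<Longrightarrow> wint e (p * g)
    = 0" and f: "poly_fun N f"
  shows "(LINT z|sph. of_real (poly p (w \<bullet> z)) * f z) = 0"
  using f
proof (induction rule: poly_fun_induct)
  case (add c y k g)
  have "(LINT z|sph. of_real (poly p (w \<bullet> z)) * (c * of_real ((y \<bullet> z) ^ k) + g z))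
    = (LINT z|sph. c * of_real (poly p (w \<bullet> z) * (y \<bullet> z) ^ k) + of_real (poly p (w \<bullet> z)) * g
      z)"
    by (simp add: algebra_simps)
  also have "\<dots> = (LINT z|sph. c * of_real (poly p (w \<bullet> z) * (y \<bullet> z) ^ k))
    + (LINT z|sph. of_real (poly p (w \<bullet> z)) * g z)"
    by (intro Bochner_Integration.integral_add integrable_sphere continuous_intros continuous_on_poly_fun[OF
      add.hyps(2)])
  also have "(LINT z|sph. c * of_real (poly p (w \<bullet> z) * (y \<bullet> z) ^ k)) = c
    * of_real (LINT z|sph. poly p (w \<bullet> z) * (y \<bullet> z) ^ k)"
    by (simp only: integral_mult_right_zero integral_complex_of_real)
  finally show ?case by (simp add: add.IH zonal_orthogonal_power[OF dim w orth add.hyps(1)])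
qed simp

end

section \<open>Reduction of the beam transform to a smooth kernel\<close>

lemma legendre_triple_W: "legendre_triple (2 * e + 3) i j n = wint e (leg e i * leg e j * leg e n)"
  by (simp add: legendre_triple_def wint_def pint_def leg_def power2_eq_square)

(* The quotient (p (X + t Z) - p X) / Z, in a form that is also correct for Z = 0. *)
definition beam_kernel :: "real poly \<Rightarrow> real \<Rightarrow> real \<Rightarrow> real \<Rightarrow> real"
  where
  "beam_kernel p X Z t = (\<Sum>k\<le>degree p. coeff p k * (t * (\<Sum>i<k. X ^ (k - Suc i) * (X + t * Z) ^ i)))"

lemma beam_kernel_0 [simp]: "beam_kernel p X Z 0 = 0"
  by (simp add: beam_kernel_def)

lemma beam_kernel_minus: "beam_kernel p X (- Z) (- t) = - beam_kernel p X Z t"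
  by (simp add: beam_kernel_def sum_negf)

lemma beam_kernel_mult: "Z * beam_kernel p X Z t = poly p (X + t * Z) - poly p X"
proof -
  have "Z * (coeff p k * (t * (\<Sum>i<k. X ^ (k - Suc i) * (X + t * Z) ^ i))) = coeff p k * (X + t * Z) ^ k
    - coeff p k * X ^ k" for k
    using power_diff_sumr2[of "X + t * Z" k X] by (simp add: right_diff_distrib[symmetric])
  then show ?thesis
    unfolding beam_kernel_def sum_distrib_left poly_altdef by (simp add: sum_subtractf)
qed

lemma beam_kernel_DERIV:
  "((\<lambda>t. beam_kernel p X Z t) has_real_derivative poly (pderiv p) (X + t * Z)) (at t within S)"
proof (cases "Z = 0")
  case True
  \<comment> \<open>For \<open>Z = 0\<close> the kernel is linear in \<open>t\<close>, with slope
    the derivative of \<open>p\<close> at \<open>X\<close> written out in coefficients.\<close>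
  define c where "c = (\<Sum>k\<le>degree p. coeff p k * (\<Sum>i<k. X ^ (k - Suc i) * X ^ i))"
  have "((\<lambda>x. \<Sum>k\<le>degree p. coeff p k * x ^ k) has_real_derivative (\<Sum>k\<le>degree p. coeff p k
    * (real k * X ^ (k - Suc 0)))) (at X)"
    by (auto intro!: derivative_eq_intros sum.cong)
  moreover have "(\<lambda>x. \<Sum>k\<le>degree p. coeff p k * x ^ k) = poly p"
    by (rule ext) (simp add: poly_altdef)
  ultimately have "(poly p has_real_derivative (\<Sum>k\<le>degree p. coeff p k * (real k * X ^ (k - Suc 0)))) (at X)"
    by (simp only:)
  then have "poly (pderiv p) X = (\<Sum>k\<le>degree p. coeff p k * (real k * X ^ (k - Suc 0)))"
    by (rule DERIV_unique[OF poly_DERIV])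
  also have "\<dots> = c"
    unfolding c_def by (intro sum.cong refl arg_cong2[where f = "(*)"]) (simp flip: power_add)
  finally have c: "poly (pderiv p) X = c" .
  have "beam_kernel p X 0 = (\<lambda>t. t * c)"
    by (simp add: fun_eq_iff beam_kernel_def c_def sum_distrib_left mult_ac)
  then show ?thesis unfolding True by (auto intro!: derivative_eq_intros simp: c)
next
  case False
  then have "beam_kernel p X Z = (\<lambda>t. (poly p (X + t * Z) - poly p X) / Z)"
    using beam_kernel_mult[of Z p X] by (simp add: fun_eq_iff field_simps)
  then show ?thesis using False
    by (auto intro!: derivative_eq_intros DERIV_chain2[OF poly_DERIV])
qed

lemma integral_beam_kernel:
  assumes "0 \<le> \<tau>"
  shows "(LINT t|restrict_space lborel {0..\<tau>}. poly (pderiv p) (X + t * Z)) = beam_kernel p X Z \<tau>"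
proof -
  have "(LINT t|lborel. indicator {0..\<tau>} t *\<^sub>R poly (pderiv p) (X + t * Z)) = beam_kernel p X Z \<tau>
    - beam_kernel p X Z 0"
    using assms by (intro integral_FTC_Icc)
      (auto intro!: continuous_intros beam_kernel_DERIV simp flip: has_real_derivative_iff_has_vector_derivative)
  then show ?thesis by (simp add: integral_restrict_space)
qed

lemma compact_measure_Icc: "compact_measure (restrict_space lborel {0..\<tau>::real}) {0..\<tau>}"
proof -
  have "finite_measure (restrict_space lborel {0..\<tau>})"
    by (rule finite_measureI) (simp add: emeasure_restrict_space space_restrict_space emeasure_lborel_Icc_eq)
  moreover have "(\<lambda>t. t) \<in> borel_measurable (restrict_space lborel {0..\<tau>})"
    by (intro measurable_restrict_space1) simp
  ultimately show ?thesis by (simp add: compact_measure_def space_restrict_space)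
qed

lemma norm_scaleR_direction: "norm x *\<^sub>R direction x = (x :: 'a::euclidean_space)"
  by (simp add: direction_def)

lemma harmonic_on_sphere_cases:
  assumes "harmonic_on_sphere n Y"
  obtains p where "poly_fun n p" "\<And>u. norm u = 1 \<Longrightarrow> Y u = p u"
proof -
  obtain p where p: "p \<in> harmonic_homogeneous n" "\<And>u. norm u = 1 \<Longrightarrow> Y u = p u"
    using assms by (auto simp: harmonic_on_sphere_def)
  from harmonic_ridge_hom[OF p(1)] obtain L where "p = ridge_hom n L" by blast
  then show thesis using that[of p] p(2) poly_fun_ridge_hom by auto
qed

lemma continuous_on_harmonic:
  assumes "harmonic_on_sphere n Y"
  shows "continuous_on (sphere 0 1) Y"
proof -
  obtain p where p: "poly_fun n p" "\<And>u. norm u = 1 \<Longrightarrow> Y u = p u"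
    by (rule harmonic_on_sphere_cases[OF assms]) blast
  have "continuous_on (sphere 0 1) p" by (rule continuous_on_poly_fun[OF p(1)])
  then show ?thesis by (rule continuous_on_eq) (simp add: p(2))
qed

lemma area_eq: "equator e * wint e 1 = sphere_area (2 * e + 3)"
  by (simp add: sphere_area_odd)

lemma harmonic_dim_pos: "harmonic_dim n (2 * e + 3) > 0"
proof -
  have "hdim e n > 0" by (subst of_nat_harmonic_dim) auto
  then show ?thesis by simp
qed

text \<open>\<open>sqrt (2 m + d)\<close> divided by the constant
  \<open>equator e * wint e (P' (m + 1) * P l)\<close> from Funk-Hecke; by
  \<open>wint_pderiv_leg\<close> that constant is the same for all admissible
  \<open>l\<close>.\<close>

definition radial_const :: "nat \<Rightarrow> nat \<Rightarrow> real" where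
  "radial_const e m = hdim e (Suc m) / (sphere_area (2 * e + 3) * sqrt (real (2 * m + 2 * e + 3)))"

(* A polynomial that acts as 1 / t on polynomials of degree at most 2 m + 2 vanishing at 0. *)
definition hilbert_kernel :: "nat \<Rightarrow> nat \<Rightarrow> real poly" where
  "hilbert_kernel e m = poly_shift 1 (1 - smult (1 / poly (leg e (2 * m + 2)) 0) (leg e (2 * m + 2)))"

lemma hilbert_kernel:
  "pCons 0 (hilbert_kernel e m) = 1 - smult (1 / poly (leg e (2 * m + 2)) 0) (leg e (2 * m + 2))"
proof -
  have "poly (leg e (2 * m + 2)) 0 \<noteq> 0" using poly_leg_even_0[of e "m + 1"] by simp
  then show ?thesis unfolding hilbert_kernel_def
    by (intro pCons_0_poly_shift) (simp add: poly_0_coeff_0 flip: poly_0_coeff_0)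
qed

lemma hilbert_kernel_reflect: "pcompose (hilbert_kernel e m) [:0, -1:] = - hilbert_kernel e m"
proof -
  have "pcompose (pCons 0 (hilbert_kernel e m)) [:0, -1:] = pCons 0 (hilbert_kernel e m)"
    unfolding hilbert_kernel by (simp add: pcompose_diff pcompose_smult leg_reflect pcompose_1)
  then have "pCons 0 (- pcompose (hilbert_kernel e m) [:0, -1:]) = pCons 0 (hilbert_kernel e m)"
    by (simp add: pcompose_pCons)
  then show ?thesis by (metis minus_minus pCons_eq_iff)
qed

lemma poly_hilbert_kernel_minus: "poly (hilbert_kernel e m) (- t) = - poly (hilbert_kernel e m) t"
  using arg_cong[OF hilbert_kernel_reflect, of "\<lambda>p. poly p t" e m] by (simp add: poly_pcompose)

lemma degree_hilbert_kernel: "degree (hilbert_kernel e m) \<le> 2 * m + 1"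
proof -
  have "degree (pCons 0 (hilbert_kernel e m)) \<le> 2 * m + 2"
    unfolding hilbert_kernel by (intro degree_diff_le order_trans[OF degree_smult_le]) auto
  then show ?thesis by (simp split: if_splits)
qed

lemma wint_hilbert_kernel:
  assumes "degree g < 2 * m + 2"
  shows "wint e (pCons 0 (hilbert_kernel e m) * g) = wint e g"
  unfolding hilbert_kernel left_diff_distrib wint_diff using assms by (simp add: wint_smult wint_leg_lower)

text \<open>The Legendre coefficients of the formal expansion of \<open>1 / t\<close>. They do not
  depend on \<open>m\<close>; only the cut-off in \<open>hilbert_kernel_expansion\<close>
  does.\<close>

definition hilbert_coeff :: "nat \<Rightarrow> nat \<Rightarrow> real" where
  "hilbert_coeff e n = (if odd n then - real (double_fact (2 * e + 1)) * nu n (2 * e + 3) * hdim e n else 0)"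

text \<open>For odd \<open>n\<close>, \<open>h P n = (t h) (P n / t)\<close>, and
  \<open>P n / t\<close> has degree below \<open>2 m + 2\<close>, where \<open>t h\<close> acts as
  1; what remains is \<open>wint_legdiv\<close>. Even \<open>n\<close> drop out by parity.\<close>

lemma hilbert_kernel_expansion:
  "hilbert_kernel e m = (\<Sum>n\<le>2 * m + 1. smult (hilbert_coeff e n) (leg e n))"
proof -
  have "wint e (hilbert_kernel e m * leg e n) / wint e (leg e n * leg e n) = hilbert_coeff e n" if n: "n \<le> 2 * m
    + 1" for n
  proof (cases "odd n")
    case True
    have "hilbert_kernel e m * leg e n = pCons 0 (hilbert_kernel e m) * legdiv e n"
      unfolding legdiv[OF True, symmetric] by simp
    moreover have "degree (legdiv e n) < 2 * m + 2"
    proof -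
      have "degree (pCons 0 (legdiv e n)) = n" unfolding legdiv[OF True] by simp
      then show ?thesis using n by (simp split: if_splits)
    qed
    ultimately have "wint e (hilbert_kernel e m * leg e n) = wint e (legdiv e n)"
      by (simp only: wint_hilbert_kernel)
    moreover have "wint e 1 > 0" using wint_sq_pos[of 1 e] by simp
    ultimately show ?thesis using True harmonic_dim_pos[of n e]
      by (simp add: wint_legdiv wint_leg_sq hilbert_coeff_def)
  next
    case False
    then have "wint e (hilbert_kernel e m * leg e n) = 0"
      by (intro wint_odd) (simp add: pcompose_mult hilbert_kernel_reflect leg_reflect)
    then show ?thesis using False by (simp add: hilbert_coeff_def)
  qed
  then show ?thesis using leg_expansion[where e = e, OF degree_hilbert_kernel[of e m]] by simp
qed

text \<open>Kept general in \<open>i\<close> and \<open>h\<close>: with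
  \<open>h = hilbert_kernel e m\<close> it is the transform up to a constant, with
  \<open>h = leg e n\<close> its Gram integral proves that triple products are nonnegative.\<close>

definition beam_form :: "nat \<Rightarrow> nat \<Rightarrow> real poly \<Rightarrow> ('a::euclidean_space
  \<Rightarrow> complex) \<Rightarrow> 'a \<Rightarrow> 'a \<Rightarrow> complex" where
  "beam_form e i h u a w = (LINT z|sph. of_real (poly (leg e i) (a \<bullet> z) * poly h (w \<bullet> z)) * u z)"

context
  fixes e :: nat and T :: "'a::euclidean_space itself"
  assumes dim: "DIM('a) = 2 * e + 3"
begin

text \<open>With \<open>x = |x| u\<close>, Funk-Hecke at \<open>u\<close> yields \<open>Y u\<close>
  times the radial integral of \<open>wint_leg_radial\<close>, which is the Jacobi factor of
  \<open>V_fun\<close>; \<open>radial_const\<close> adjusts the constant.\<close>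

lemma V_fun_ridge:
  fixes Y :: "nat \<Rightarrow> nat \<Rightarrow> 'a \<Rightarrow> complex"
  assumes Y: "harmonic_on_sphere l (Y l k)" and lm: "l \<le> m" "even (l + m)" and x: "norm x \<le> 1"
  shows "V_fun Y m l k x = of_real (radial_const e m) * (LINT z|sph. of_real (poly (pderiv (leg e (Suc m))) (x
    \<bullet> z)) * Y l k z)"
proof -
  define u where "u = direction x"
  have u: "norm u = 1" by (simp add: u_def)
  let ?Q = "pderiv (leg e (Suc m))"
  let ?J = "norm x ^ l * jacobi ((m - l) div 2) 0 (real l + real e + 1 / 2) (2 * (norm x)\<^sup>2 - 1)"
  let ?N = "hdim e (Suc m)"
  \<comment> \<open>Valid at the origin too, where \<open>V_fun\<close> and this argument use the
    same arbitrary \<open>direction\<close>.\<close>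
  have "x \<bullet> z = norm x * (u \<bullet> z)" for z
    by (metis norm_scaleR_direction inner_scaleR_left u_def)
  then have "(LINT z|sph. of_real (poly ?Q (x \<bullet> z)) * Y l k z)
    = (LINT z|sph. of_real (poly (pcompose ?Q [:0, norm x:]) (u \<bullet> z)) * Y l k z)"
    by (simp add: poly_pcompose mult.commute)
  also have "\<dots> = of_real (equator e * (wint e (?Q * leg e l) * ?J)) * Y l k u"
    by (simp only: funk_hecke[OF dim u Y] wint_leg_radial[OF lm])
  also have "wint e (?Q * leg e l) = wint e 1 * real (2 * m + 2 * e + 3) / ?N"
  proof -
    have "(-1 :: real) ^ l = (-1) ^ m" using lm(2) by (cases "even l") auto
    then have "pcompose (leg e l) [:0, -1:] = smult ((-1) ^ m) (leg e l)" by (simp add: leg_reflect)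
    from wint_pderiv_leg[OF _ this, of e] lm(1) show ?thesis by simp
  qed
  finally have I: "(LINT z|sph. of_real (poly ?Q (x \<bullet> z)) * Y l k z)
     = of_real (equator e * (wint e 1 * real (2 * m + 2 * e + 3) / ?N * ?J)) * Y l k u" .
  have "radial_const e m * (equator e * (wint e 1 * real (2 * m + 2 * e + 3) / ?N * ?J)) = sqrt (real (2 * m + 2 * e
    + 3)) * ?J"
  proof -
    have *: "N / (A * sqrt D) * (s * (w * D / N * J)) = sqrt D * J"
      if "N > 0" "A = s * w" "A > 0" "D > 0" for N A D s w J :: real
    proof -
      have "s * w \<noteq> 0" using that by (metis less_irrefl)
      then have "s \<noteq> 0" "w \<noteq> 0" by auto
      have "sqrt D * sqrt D = D" using \<open>D > 0\<close> by simp
      then have "D / sqrt D = sqrt D" using \<open>D > 0\<close> by (simp add: real_div_sqrt)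
      then show ?thesis using that \<open>s \<noteq> 0\<close> \<open>w \<noteq> 0\<close> by (simp add: field_simps)
    qed
    show ?thesis unfolding radial_const_def
      by (rule *) (use harmonic_dim_pos[of "Suc m" e] area_eq sphere_area_pos[of "2 * e + 3"] in auto)
  qed
  then have "of_real (radial_const e m) * (of_real (equator e * (wint e 1 * real (2 * m + 2 * e + 3) / ?N * ?J))
    * Y l k u)
      = of_real (sqrt (real (2 * m + 2 * e + 3)) * ?J) * Y l k u"
    by (simp only: mult.assoc[symmetric] of_real_mult[symmetric])
  moreover have "real l + (real DIM('a) - 2) / 2 = real l + real e + 1 / 2" by (simp add: dim field_simps)
  moreover have "2 * m + DIM('a) = 2 * m + 2 * e + 3" by (simp add: dim)
  ultimately show ?thesis using x unfolding I V_fun_def u_def[symmetric]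
    by (simp only: if_True mult.assoc)
qed

section \<open>Integration along the chord\<close>

lemma norm_add_scaleR_le_1:
  fixes a w :: 'a
  assumes "norm a = 1" "norm w = 1" "t \<ge> 0"
  shows "norm (a + t *\<^sub>R w) \<le> 1 \<longleftrightarrow> t = 0 \<or> t \<le> - 2 * (a \<bullet> w)"
proof -
  have "norm (a + t *\<^sub>R w) \<le> 1 \<longleftrightarrow> (norm (a + t *\<^sub>R w))\<^sup>2 \<le> 1"
    by (simp add: abs_square_le_1)
  also have "(norm (a + t *\<^sub>R w))\<^sup>2 = 1 + t * (2 * (a \<bullet> w) + t)"
  proof -
    have "a \<bullet> a = 1" "w \<bullet> w = 1" using assms by (simp_all add: dot_square_norm)
    then show ?thesis unfolding power2_norm_eq_inner
      by (simp add: inner_add_left inner_add_right inner_commute algebra_simps)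
  qed
  also have "1 + t * (2 * (a \<bullet> w) + t) \<le> 1 \<longleftrightarrow> t = 0 \<or> t \<le> - 2
    * (a \<bullet> w)"
    using assms(3) by (auto simp: mult_le_0_iff)
  finally show ?thesis .
qed

text \<open>For \<open>a \<bullet> w < 0\<close> the ray is in the ball exactly for \<open>t\<close>
  up to \<open>- 2 (a \<bullet> w)\<close>; Fubini brings the \<open>t\<close>-integral inside,
  where \<open>beam_kernel\<close> is the primitive. Otherwise the ray meets the ball only at
  \<open>a\<close>, a null set of parameters.\<close>

lemma divergent_beam_ridge:
  fixes a w :: 'a and f u :: "'a \<Rightarrow> complex"
  assumes a: "norm a = 1" and w: "norm w = 1" and u: "continuous_on (sphere 0 1) u"
    and out: "\<And>x. norm x > 1 \<Longrightarrow> f x = 0"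
    and inside: "\<And>x. norm x \<le> 1 \<Longrightarrow> f x = c
      * (LINT z|sph. of_real (poly (pderiv p) (x \<bullet> z)) * u z)"
  shows "divergent_beam f a w = (if a \<bullet> w < 0 then c * (LINT z|sph. of_real (beam_kernel p (a \<bullet> z) (w
    \<bullet> z) (- 2 * (a \<bullet> w))) * u z) else 0)"
proof (cases "a \<bullet> w < 0")
  case True
  define \<tau> where "\<tau> = - 2 * (a \<bullet> w)"
  have \<tau>: "\<tau> > 0" using True by (simp add: \<tau>_def)
  have "divergent_beam f a w = (LINT t|lborel. indicator {0..\<tau>} t *\<^sub>R (c
    * (LINT z|sph. of_real (poly (pderiv p) ((a + t *\<^sub>R w) \<bullet> z)) * u z)))"
    unfolding divergent_beam_def set_lebesgue_integral_def
  proof (rule lint_cong)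
    fix t :: real
    show "indicator {0..} t *\<^sub>R f (a + t *\<^sub>R w) = indicator {0..\<tau>} t *\<^sub>R (c
      * (LINT z|sph. of_real (poly (pderiv p) ((a + t *\<^sub>R w) \<bullet> z)) * u z))"
    proof (cases "t \<in> {0..\<tau>}")
      case True
      then have "norm (a + t *\<^sub>R w) \<le> 1" using norm_add_scaleR_le_1[OF a w, of t] by (simp add: \<tau>_def)
      then show ?thesis using True by (simp add: inside)
    next
      case False
      then have "f (a + t *\<^sub>R w) = 0 \<or> t < 0" using norm_add_scaleR_le_1[OF a w, of t] out[of "a
        + t *\<^sub>R w"] \<tau>
        by (auto simp: \<tau>_def)
      then show ?thesis using False by (auto simp: indicator_def)
    qed
  qed simp
  also have "\<dots> = (LINT t|restrict_space lborel {0..\<tau>}. c * (LINT z|sph. of_real (poly (pderiv p) ((a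
    + t *\<^sub>R w) \<bullet> z)) * u z))"
    by (rule integral_restrict_space[symmetric]) simp
  also have "\<dots> = c * (LINT t|restrict_space lborel {0..\<tau>}. LINT z|sph. of_real (poly (pderiv p) ((a
    + t *\<^sub>R w) \<bullet> z)) * u z)"
    by (simp only: integral_mult_right_zero)
  also have "(LINT t|restrict_space lborel {0..\<tau>}. LINT z|sph. of_real (poly (pderiv p) ((a
    + t *\<^sub>R w) \<bullet> z)) * u z)
      = (LINT z|sph. LINT t|restrict_space lborel {0..\<tau>}. of_real (poly (pderiv p) ((a + t *\<^sub>R w)
        \<bullet> z)) * u z)"
    by (rule compact_measure_fubini[OF compact_measure_Icc compact_measure_sphere])
      (auto simp: case_prod_unfold intro!: continuous_intros continuous_on_compose2[OF u])
  also have "\<dots> = (LINT z|sph. of_real (beam_kernel p (a \<bullet> z) (w \<bullet> z) \<tau>) * u z)"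
    by (simp only: inner_add_left inner_scaleR_left integral_mult_left_zero integral_complex_of_real
        integral_beam_kernel[OF less_imp_le[OF \<tau>]])
  finally show ?thesis using True by (simp add: \<tau>_def)
next
  case False
  have "AE t in lborel. indicator {0..} t *\<^sub>R f (a + t *\<^sub>R w) = 0"
  proof -
    have "AE t in lborel. t \<noteq> (0::real)" by (rule AE_lborel_singleton)
    then show ?thesis
    proof eventually_elim
      case (elim t)
      show ?case
      proof (cases "t > 0")
        case True
        then have "norm (a + t *\<^sub>R w) > 1" using norm_add_scaleR_le_1[OF a w, of t] False by linarith
        then show ?thesis by (simp add: out)
      qed (use elim in auto)
    qed
  qed
  then show ?thesis using False unfolding divergent_beam_def set_lebesgue_integral_def
    by (simp add: integral_eq_zero_AE)
qed

text \<open>At most one of the directions \<open>w\<close> and \<open>- w\<close> enters the ball.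
  \<open>beam_kernel_minus\<close> turns the contribution of \<open>- w\<close> into the formula for
  \<open>w\<close>, and for \<open>a \<bullet> w = 0\<close> both sides vanish.\<close>

lemma divergent_beam_odd_ridge:
  fixes a w :: 'a and f u :: "'a \<Rightarrow> complex"
  assumes a: "norm a = 1" and w: "norm w = 1" and u: "continuous_on (sphere 0 1) u"
    and out: "\<And>x. norm x > 1 \<Longrightarrow> f x = 0"
    and inside: "\<And>x. norm x \<le> 1 \<Longrightarrow> f x = c
      * (LINT z|sph. of_real (poly (pderiv p) (x \<bullet> z)) * u z)"
  shows "divergent_beam_odd f a w = c / 2 * (LINT z|sph. of_real (beam_kernel p (a \<bullet> z) (w \<bullet> z) (- 2
    * (a \<bullet> w))) * u z)"
proof -
  have w': "norm (- w) = 1" using w by simp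
  have "beam_kernel p (a \<bullet> z) (- (w \<bullet> z)) (2 * (a \<bullet> w)) =
    - beam_kernel p (a \<bullet> z) (w \<bullet> z) (- 2 * (a \<bullet> w))" for z
    using beam_kernel_minus[of p "a \<bullet> z" "w \<bullet> z" "- 2 * (a \<bullet> w)"] by simp
  moreover have "divergent_beam f a v = (if a \<bullet> v < 0 then c
    * (LINT z|sph. of_real (beam_kernel p (a \<bullet> z) (v \<bullet> z) (- 2 * (a \<bullet> v))) * u z) else 0)"
    if "norm v = 1" for v
    by (rule divergent_beam_ridge[OF a that u]) (fact out, fact inside)
  note this[OF w] this[OF w']
  ultimately show ?thesis
    unfolding divergent_beam_odd_def
    by (cases "a \<bullet> w" "0::real" rule: linorder_cases) auto
qed

(* Replacing the beam kernel by t h(t) times it leaves a reflected and an unreflected term; they agree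
   since their difference involves only polynomials of degree less than m + 1 times P (m + 1). *)
lemma beam_kernel_hilbert:
  fixes a w :: 'a and Y :: "'a \<Rightarrow> complex"
  assumes a: "norm a = 1" and w: "norm w = 1" and Y: "harmonic_on_sphere l Y" and lm: "l \<le> m"
  shows "(LINT z|sph. of_real (beam_kernel (leg e (Suc m)) (a \<bullet> z) (w \<bullet> z) (- 2 * (a \<bullet> w)))
    * Y z)
     = - 2 * (LINT z|sph. of_real (poly (leg e (Suc m)) (a \<bullet> z) * poly (hilbert_kernel e m) (w \<bullet> z))
       * Y z)"
proof -
  obtain p where p: "poly_fun l p" "\<And>u. norm u = 1 \<Longrightarrow> Y u = p u"
    by (rule harmonic_on_sphere_cases[OF Y]) blast
  define P where "P = leg e (Suc m)"
  define h where "h = hilbert_kernel e m"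
  define B where "B z = complex_of_real (beam_kernel P (a \<bullet> z) (w \<bullet> z) (- 2 * (a \<bullet> w)))" for z
  have refl: "a \<bullet> z + - 2 * (a \<bullet> w) * (w \<bullet> z) = reflect w a \<bullet> z" for z
    by (simp add: reflect_def inner_diff_left inner_commute[of w a])
  have contp: "continuous_on S p" for S by (rule continuous_on_poly_fun[OF p(1)])
  \<comment> \<open>At the far end of the chord the argument is
    \<open>reflect w a \<bullet> z\<close>, so the kernel is a polynomial in \<open>z\<close>, of
    one degree less than \<open>P\<close>.\<close>
  have B: "poly_fun m B"
  proof -
    have "B = (\<lambda>z. \<Sum>k\<le>degree P. \<Sum>i<k. of_real (coeff P k * (- 2 * (a \<bullet> w)))
      * of_real ((a \<bullet> z) ^ (k - Suc i) * (reflect w a \<bullet> z) ^ i))"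
      unfolding B_def beam_kernel_def refl
      by (simp only: of_real_sum of_real_mult sum_distrib_left mult.assoc)
    then show ?thesis
      by (simp only:) (intro poly_fun_sum poly_fun_power_power, auto simp: P_def)
  qed
  have contB: "continuous_on S B" for S by (rule continuous_on_poly_fun[OF B])
  \<comment> \<open>\<open>1 - t h\<close> is a multiple of \<open>P (2 m + 2)\<close>, which
    annihilates polynomial functions of lower degree. The factor inserted in this way cancels the
    division by \<open>w \<bullet> z\<close> in the kernel.\<close>
  have kill: "(LINT z|sph. f z) = (LINT z|sph. of_real (poly (pCons 0 h) (w \<bullet> z))
    * f z)" if f: "poly_fun N f" "N < 2 * m + 2" for f N
  proof -
    have cont: "continuous_on S f" for S by (rule continuous_on_poly_fun[OF f(1)])
    have "(LINT z|sph. of_real (poly (1 - pCons 0 h) (w \<bullet> z)) * f z) = 0"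
    proof (rule zonal_orthogonal_poly_fun[OF dim w _ f(1)])
      fix g :: "real poly" assume "degree g \<le> N"
      then show "wint e ((1 - pCons 0 h) * g) = 0"
        using wint_hilbert_kernel[of g m e] f(2) by (simp add: left_diff_distrib wint_diff h_def del: mult_pCons_left)
    qed
    moreover have "(LINT z|sph. of_real (poly (1 - pCons 0 h) (w \<bullet> z)) * f z)
        = (LINT z|sph. f z - of_real (poly (pCons 0 h) (w \<bullet> z)) * f z)"
      by (simp add: algebra_simps)
    also have "\<dots> = (LINT z|sph. f z) - (LINT z|sph. of_real (poly (pCons 0 h) (w \<bullet> z)) * f z)"
      by (intro Bochner_Integration.integral_diff integrable_sphere continuous_intros cont)
    ultimately show ?thesis by simp
  qed
  let ?I = "\<lambda>f. LINT z|sph. of_real (poly h (w \<bullet> z)) * (of_real (poly P (a \<bullet> z)) * f z)"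
  have "(LINT z|sph. B z * p z) = (LINT z|sph. of_real (poly (pCons 0 h) (w \<bullet> z)) * (B z * p z))"
    using poly_fun_mult[OF B p(1)] lm by (intro kill[of "m + l"]) auto
  also have "\<dots> = (LINT z|sph. of_real (poly h (w \<bullet> z)) * (of_real (poly P (a \<bullet> reflect w z))
    * p z)
      - of_real (poly h (w \<bullet> z)) * (of_real (poly P (a \<bullet> z)) * p z))"
  proof (rule lint_cong)
    fix z :: 'a
    have "(w \<bullet> z) * beam_kernel P (a \<bullet> z) (w \<bullet> z) (- 2 * (a \<bullet> w))
      = poly P (a \<bullet> reflect w z) - poly P (a \<bullet> z)"
      unfolding beam_kernel_mult refl inner_reflect ..
    then have "of_real (w \<bullet> z) * B z = of_real (poly P (a \<bullet> reflect w z))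
      - of_real (poly P (a \<bullet> z))"
      unfolding B_def by (simp only: of_real_mult[symmetric] of_real_diff[symmetric])
    then have "of_real (poly h (w \<bullet> z)) * ((of_real (w \<bullet> z) * B z) * p z)
      = of_real (poly h (w \<bullet> z)) * (of_real (poly P (a \<bullet> reflect w z)) * p z)
      - of_real (poly h (w \<bullet> z)) * (of_real (poly P (a \<bullet> z)) * p z)"
      by (simp only: left_diff_distrib right_diff_distrib)
    then show "of_real (poly (pCons 0 h) (w \<bullet> z)) * (B z * p z) = of_real (poly h (w \<bullet> z))
      * (of_real (poly P (a \<bullet> reflect w z)) * p z)
      - of_real (poly h (w \<bullet> z)) * (of_real (poly P (a \<bullet> z)) * p z)"
      by (simp add: mult_ac)
  qed simp
  also have "\<dots> = (LINT z|sph. of_real (poly h (w \<bullet> z)) * (of_real (poly P (a \<bullet> reflect w z))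
    * p z)) - ?I p"
    by (intro Bochner_Integration.integral_diff integrable_sphere continuous_intros contp)
  \<comment> \<open>Substituting \<open>reflect w z\<close> for \<open>z\<close> moves the
    reflection from \<open>P\<close> to \<open>p\<close>; the sign is that of the odd polynomial
    \<open>h\<close>.\<close>
  also have "(LINT z|sph. of_real (poly h (w \<bullet> z)) * (of_real (poly P (a \<bullet> reflect w z)) * p z)) =
    - ?I (\<lambda>z. p (reflect w z))"
  proof -
    have "w \<bullet> reflect w z = - (w \<bullet> z)" for z
      using w by (simp add: reflect_def inner_diff_right dot_square_norm)
    then have "(LINT z|sph. of_real (poly h (w \<bullet> reflect w z))
      * (of_real (poly P (a \<bullet> reflect w (reflect w z))) * p (reflect w z))) = - ?I (\<lambda>z. p (reflect w
        z))"
      using w by (simp add: h_def poly_hilbert_kernel_minus)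
    moreover have "(LINT z|sph. of_real (poly h (w \<bullet> reflect w z))
      * (of_real (poly P (a \<bullet> reflect w (reflect w z))) * p (reflect w z)))
        = (LINT z|sph. of_real (poly h (w \<bullet> z)) * (of_real (poly P (a \<bullet> reflect w z)) * p z))"
      by (rule integral_sphere_reflect[OF w, of "\<lambda>z. of_real (poly h (w \<bullet> z))
        * (of_real (poly P (a \<bullet> reflect w z)) * p z)"])
        (intro continuous_intros contp)
    ultimately show ?thesis by simp
  qed
  also have "?I (\<lambda>z. p (reflect w z)) = ?I p"
  proof -
    obtain g where g: "poly_fun (l - 1) g" "\<And>z. p z - p (reflect w z) = of_real (w \<bullet> z) * g z"
      using poly_fun_reflect_diff[OF p(1), of w] by blast
    have "?I p - ?I (\<lambda>z. p (reflect w z)) = (LINT z|sph. of_real (poly h (w \<bullet> z))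
      * (of_real (poly P (a \<bullet> z)) * p z) - of_real (poly h (w \<bullet> z)) * (of_real (poly P (a \<bullet>
        z)) * p (reflect w z)))"
      by (intro Bochner_Integration.integral_diff[symmetric] integrable_sphere continuous_intros contp
        continuous_on_compose2[OF contp[of UNIV]]) auto
    also have "\<dots> = (LINT z|sph. of_real (poly (pCons 0 h) (w \<bullet> z)) * (of_real (poly P (a \<bullet> z))
      * g z))"
    proof (rule lint_cong)
      fix z
      have "of_real (poly h (w \<bullet> z)) * (of_real (poly P (a \<bullet> z)) * p z)
        - of_real (poly h (w \<bullet> z)) * (of_real (poly P (a \<bullet> z)) * p (reflect w z))
        = of_real (poly h (w \<bullet> z)) * (of_real (poly P (a \<bullet> z)) * (p z - p (reflect w z)))"
        by (simp only: right_diff_distrib)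
      then show "of_real (poly h (w \<bullet> z)) * (of_real (poly P (a \<bullet> z)) * p z)
        - of_real (poly h (w \<bullet> z)) * (of_real (poly P (a \<bullet> z)) * p (reflect w z))
        = of_real (poly (pCons 0 h) (w \<bullet> z)) * (of_real (poly P (a \<bullet> z)) * g z)"
        unfolding g(2) by (simp add: mult_ac)
    qed simp
    also have "\<dots> = (LINT z|sph. of_real (poly P (a \<bullet> z)) * g z)"
    proof (rule kill[symmetric])
      show "poly_fun (Suc m + (l - 1)) (\<lambda>z. of_real (poly P (a \<bullet> z)) * g z)"
        by (intro poly_fun_mult g(1) poly_fun_poly) (simp add: P_def)
    qed (use lm in simp)
    also have "\<dots> = 0"
      by (rule zonal_orthogonal_poly_fun[OF dim a _ g(1)]) (use lm in \<open>auto simp: P_def intro!: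
        wint_leg_lower\<close>)
    finally show ?thesis by simp
  qed
  finally have "(LINT z|sph. B z * p z) = - 2 * ?I p" by simp
  moreover have "(LINT z|sph. B z * p z) = (LINT z|sph. B z * Y z)"
    by (rule lint_cong) (auto simp: p(2))
  moreover have "?I p = (LINT z|sph. of_real (poly P (a \<bullet> z) * poly h (w \<bullet> z)) * Y z)"
    by (rule lint_cong) (auto simp: p(2) mult_ac)
  ultimately show ?thesis by (simp add: B_def P_def h_def)
qed

theorem divergent_beam_odd_V:
  fixes Y :: "nat \<Rightarrow> nat \<Rightarrow> 'a \<Rightarrow> complex"
  assumes Y: "harmonic_on_sphere l (Y l k)" and lm: "l \<le> m" "even (l + m)"
    and a: "norm a = 1" and w: "norm w = 1"
  shows "divergent_beam_odd (V_fun Y m l k) a w = - of_real (radial_const e m)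
    * beam_form e (Suc m) (hilbert_kernel e m) (Y l k) a w"
proof -
  have "divergent_beam_odd (V_fun Y m l k) a w = of_real (radial_const e m) / 2
    * (LINT z|sph. of_real (beam_kernel (leg e (Suc m)) (a \<bullet> z) (w \<bullet> z) (- 2 * (a \<bullet> w))) * Y
      l k z)"
  proof (rule divergent_beam_odd_ridge[OF a w continuous_on_harmonic[OF Y]])
    show "V_fun Y m l k x = 0" if "norm x > 1" for x using that by (simp add: V_fun_def)
    show "V_fun Y m l k x = of_real (radial_const e m) * (LINT z|sph. of_real (poly (pderiv (leg e (Suc m))) (x
      \<bullet> z)) * Y l k z)"
      if "norm x \<le> 1" for x
      using V_fun_ridge[where Y = Y and l = l and k = k and m = m, OF Y lm that] .
  qed
  then show ?thesis by (simp only: beam_kernel_hilbert[OF a w Y lm(1)] beam_form_def) simp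
qed

end

section \<open>Orthonormality\<close>

lemma integral_norm_sq_nonneg:
  fixes F :: "'b \<Rightarrow> complex"
  assumes "(LINT z|M. F z * cnj (F z)) = of_real r"
  shows "r \<ge> 0"
proof -
  have "(LINT z|M. F z * cnj (F z)) = of_real (LINT z|M. (norm (F z))\<^sup>2)"
    by (simp only: complex_norm_square[symmetric] integral_complex_of_real)
  then have "r = (LINT z|M. (norm (F z))\<^sup>2)" using assms by (simp only: of_real_eq_iff)
  then show ?thesis by (simp only:) (rule Bochner_Integration.integral_nonneg, simp)
qed

lemma nu_nonzero: "nu n d \<noteq> 0"
  using double_fact_pos[of "n - 1"] double_fact_pos[of "n + d - 3"] unfolding nu_def by simp

text \<open>Explains \<open>mu\<close>: in the square of \<open>lambda_sv\<close> the quotient of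
  \<open>2 ^ (d + 1) * pi ^ (d - 1)\<close> by the squared area is just the square of
  \<open>(d - 2)!!\<close>, the factor carried by \<open>hilbert_coeff\<close>.\<close>

lemma area_double_fact:
  "2 ^ (2 * e + 4) * pi ^ (2 * e + 2) = (real (double_fact (2 * e + 1)))\<^sup>2 * (sphere_area (2 * e + 3))\<^sup>2"
proof -
  have df: "real (double_fact (2 * e + 1)) * (2 ^ e * fact e) = fact (2 * e + 1)"
  proof (induction e)
    case (Suc e)
    have "2 * Suc e + 1 = Suc (Suc (2 * e + 1))" by simp
    then have "double_fact (2 * Suc e + 1) = (2 * e + 3) * double_fact (2 * e + 1)"
      by (simp only: double_fact.simps) (simp add: algebra_simps)
    then have "real (double_fact (2 * Suc e + 1)) * (2 ^ Suc e * fact (Suc e)) = real (2 * e + 3) * real (2 * e + 2)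
      * (real (double_fact (2 * e + 1)) * (2 ^ e * fact e))"
      by (simp add: algebra_simps)
    also have "\<dots> = fact (2 * Suc e + 1)" unfolding Suc by (simp add: algebra_simps)
    finally show ?case .
  qed simp
  have "real (2 * e + 3) / 2 = real e + 3 / 2" by simp
  then have A: "sphere_area (2 * e + 3) = 2 * pi powr (real e + 3 / 2) / (fact (2 * e + 1) * sqrt pi / (2 ^ (2 * e
    + 1) * fact e))"
    unfolding sphere_area_def by (simp only: Gamma_half_odd)
  have p: "pi powr (real e + 3 / 2) = pi ^ (e + 1) * sqrt pi"
  proof -
    have "real e + 3 / 2 = real (e + 1) + 1 / 2" by simp
    then show ?thesis by (simp only: powr_add powr_realpow pi_gt_zero) (simp add: powr_half_sqrt)
  qed
  have "2 * (P * q) / (F * q / (t * E)) = 2 * P * (t * E) / F" if "q \<noteq> 0" for P q F t E :: real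
    using that by simp
  note aux = this
  have "sphere_area (2 * e + 3) = 2 * pi ^ (e + 1) * (2 ^ (2 * e + 1) * fact e) / fact (2 * e + 1)"
    unfolding A p by (rule aux) simp
  moreover have "(2::real) ^ (2 * e + 1) = 2 ^ e * (2 * 2 ^ e)"
  proof -
    have "2 * e + 1 = e + Suc e" by simp
    then show ?thesis by (simp only: power_add power_Suc)
  qed
  ultimately have area: "sphere_area (2 * e + 3)
      = 2 * pi ^ (e + 1) * (2 ^ e * (2 * 2 ^ e) * fact e) / (real (double_fact (2 * e + 1)) * (2 ^ e * fact e))"
    by (simp only: df)
  have "D * (2 * P * (t * (2 * t) * E) / (D * (t * E))) = 2 * P * (2 * t)"
    if "D > 0" "t \<noteq> 0" "E \<noteq> 0" for D P t E :: real
    using that by simp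
  note aux = this
  have "real (double_fact (2 * e + 1)) * sphere_area (2 * e + 3) = 2 * pi ^ (e + 1) * (2 * 2 ^ e)"
    unfolding area by (rule aux) (use double_fact_pos in auto)
  then have "(real (double_fact (2 * e + 1)))\<^sup>2 * (sphere_area (2 * e + 3))\<^sup>2 = (2 * pi ^ (e + 1) * (2
    * 2 ^ e))\<^sup>2"
    by (simp only: power_mult_distrib[symmetric])
  also have "\<dots> = 2 ^ (2 * e + 4) * pi ^ (2 * e + 2)"
  proof -
    have "2 * e + 4 = e + e + 4" "2 * e + 2 = (e + 1) + (e + 1)" by simp_all
    then show ?thesis by (simp only: power_add power2_eq_square) simp
  qed
  finally show ?thesis by simp
qed

text \<open>The convolution on the sphere of the zonal polynomial with Legendre coefficients
  \<open>c\<close> with itself (\<open>integral_zonal_square\<close>).\<close>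

definition conv_square :: "nat \<Rightarrow> (nat \<Rightarrow> real) \<Rightarrow> nat \<Rightarrow> real poly" where
  "conv_square e c N = (\<Sum>n\<le>N. smult ((c n)\<^sup>2 * (equator e * wint e (leg e n * leg e n))) (leg e n))"

lemma wint_conv_square:
  "wint e (p * conv_square e c N * r) = (\<Sum>n\<le>N. ((c n)\<^sup>2 * (equator e * wint e (leg e n * leg e n)))
    * wint e (p * r * leg e n))"
proof -
  have "p * conv_square e c N * r = (\<Sum>n\<le>N. smult ((c n)\<^sup>2 * (equator e * wint e (leg e n
    * leg e n))) (p * r * leg e n))"
    unfolding conv_square_def sum_distrib_left sum_distrib_right
    by (intro sum.cong refl) (simp only: mult_smult_left mult_smult_right mult_ac)
  then show ?thesis by (simp only: wint_sum wint_smult)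
qed

section \<open>Triple products of Legendre polynomials and the singular value\<close>

definition triple_index :: "nat \<Rightarrow> nat \<Rightarrow> nat set" where
  "triple_index m l = {n. n \<in> {m + 1 - l..m + 1 + l} \<and> odd n}"

abbreviation (input) triple :: "nat \<Rightarrow> nat \<Rightarrow> nat \<Rightarrow> nat \<Rightarrow> real" where
  "triple e m l n \<equiv> wint e (leg e (Suc m) * leg e l * leg e n)"

text \<open>Orthogonality to lower degrees, applied to the factor of too large degree, gives the
  triangle condition; for even \<open>n\<close> the product is odd.\<close>

lemma wint_triple_outside:
  assumes lm: "l \<le> m" "even (l + m)" and n: "n \<notin> triple_index m l"
  shows "triple e m l n = 0"
proof -
  consider "n < m + 1 - l" | "n > m + 1 + l" | "even n" using n by (auto simp: triple_index_def)
  then show ?thesis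
  proof cases
    case 1
    have "degree (leg e l * leg e n) < Suc m" using 1 lm by (subst degree_mult_eq) auto
    from wint_leg_lower[OF this, of e] show ?thesis by (simp only: mult_ac)
  next
    case 2
    have "degree (leg e (Suc m) * leg e l) < n" using 2 by (subst degree_mult_eq) auto
    from wint_leg_lower[OF this, of e] show ?thesis by (simp only: mult_ac)
  next
    case 3
    have "(-1 :: real) ^ Suc m * ((-1) ^ l * (-1) ^ n) = -1" using 3 lm(2) by (cases "even l") auto
    then show ?thesis
      by (intro wint_odd) (simp add: pcompose_mult leg_reflect mult_ac)
  qed
qed

lemma sum_triple_index:
  assumes lm: "l \<le> m" "even (l + m)" and N: "m + 1 + l \<le> N"
  shows "(\<Sum>n\<le>N. f n * triple e m l n) = (\<Sum>n\<in>triple_index m l. f n * triple e m l n)"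
  by (rule sum.mono_neutral_right) (use N wint_triple_outside[OF lm] in \<open>auto simp: triple_index_def\<close>)

text \<open>The Legendre expansion of \<open>P (m + 1) P l\<close> at \<open>t = 1\<close>. The
  positive total shows that the triple products do not all vanish.\<close>

lemma sum_triple_total:
  assumes lm: "l \<le> m" "even (l + m)"
  shows "(\<Sum>n\<in>triple_index m l. hdim e n * triple e m l n) = wint e 1"
proof -
  have "degree (leg e (Suc m) * leg e l) \<le> m + 1 + l" by (subst degree_mult_eq) auto
  from leg_expansion[OF this, of e]
  have "poly (leg e (Suc m) * leg e l) 1 = poly (\<Sum>n\<le>m + 1 + l. smult (triple e m l n / wint e (leg e n
    * leg e n)) (leg e n)) 1"
    by (rule arg_cong)
  then have "1 = (\<Sum>n\<le>m + 1 + l. hdim e n / wint e 1 * triple e m l n)"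
    by (simp add: poly_sum wint_leg_sq mult_ac)
  also have "\<dots> = (\<Sum>n\<in>triple_index m l. hdim e n / wint e 1 * triple e m l n)"
    by (rule sum_triple_index[OF lm]) simp
  also have "\<dots> = (\<Sum>n\<in>triple_index m l. hdim e n * triple e m l n) / wint e 1"
    by (simp add: sum_divide_distrib)
  finally show ?thesis using wint_sq_pos[of 1 e] by (simp add: field_simps)
qed

definition triple_sum :: "nat \<Rightarrow> nat \<Rightarrow> nat \<Rightarrow> real" where
  "triple_sum e m l = (\<Sum>n\<in>triple_index m l. (nu n (2 * e + 3))\<^sup>2 * hdim e n * triple e m l n)"

text \<open>Positivity of the radicand undoes the square root and permits division by
  \<open>lambda_sv\<close>; the constants of \<open>mu\<close> simplify by
  \<open>area_double_fact\<close>.\<close>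

lemma lambda_sv_square:
  assumes "triple_sum e m l > 0"
  shows "(lambda_sv m l (2 * e + 3))\<^sup>2 = hdim e (Suc m) * (real (double_fact (2 * e + 1)))\<^sup>2 * equator e
    / real (2 * m + 2 * e + 3) * triple_sum e m l"
    and "lambda_sv m l (2 * e + 3) > 0"
proof -
  let ?N = "hdim e (Suc m)"
  have mu: "(mu m (2 * e + 3))\<^sup>2 = 2 ^ (2 * e + 4) * pi ^ (2 * e + 2) / real (2 * m + 2 * e + 3)"
    by (simp add: mu_def add.assoc)
  have "(2 * e + 3) - 1 = 2 * e + 2" by simp
  then have l: "lambda_sv m l (2 * e + 3) = sqrt (?N * (mu m (2 * e + 3))\<^sup>2 * equator e / (sphere_area (2 * e
    + 3))\<^sup>2 * triple_sum e m l)"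
    unfolding lambda_sv_def triple_sum_def triple_index_def by (simp add: legendre_triple_W)
  have eq: "?N * (mu m (2 * e + 3))\<^sup>2 * equator e / (sphere_area (2 * e + 3))\<^sup>2 * triple_sum e m l
      = ?N * (real (double_fact (2 * e + 1)))\<^sup>2 * equator e / real (2 * m + 2 * e + 3) * triple_sum e m l"
  proof -
    have "N * (D * A / M) * s / A * S = N * D * s / M * S" if "A \<noteq> 0" for N D A M s S :: real
      using that by simp
    note aux = this
    have "(sphere_area (2 * e + 3))\<^sup>2 \<noteq> 0" using sphere_area_pos[of "2 * e + 3"] by simp
    then show ?thesis unfolding mu area_double_fact by (rule aux)
  qed
  have "?N * (real (double_fact (2 * e + 1)))\<^sup>2 * equator e / real (2 * m + 2 * e + 3) * triple_sum e m l > 0"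
    using assms harmonic_dim_pos[of "Suc m" e] double_fact_pos[of "2 * e + 1"] sphere_area_pos[of "2 * e + 2"]
    by (intro mult_pos_pos divide_pos_pos) auto
  then show "(lambda_sv m l (2 * e + 3))\<^sup>2 = ?N * (real (double_fact (2 * e + 1)))\<^sup>2 * equator e
    / real (2 * m + 2 * e + 3) * triple_sum e m l"
    "lambda_sv m l (2 * e + 3) > 0" unfolding l eq by simp_all
qed

text \<open>The left side is the diagonal Gram entry from \<open>beam_form_gram\<close>, with the
  constant of \<open>divergent_beam_odd_V\<close>; so \<open>lambda_sv\<close> is the norm that the
  family has to be divided by.\<close>

lemma hilbert_gram_constant:
  assumes lm: "l \<le> m" "even (l + m)" and pos: "triple_sum e m l > 0"
  shows "(radial_const e m)\<^sup>2 * (equator e * wint e (leg e (Suc m) * leg e (Suc m)) * (equator e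
    * wint e (leg e (Suc m) * conv_square e (hilbert_coeff e) (2 * m + 1) * leg e l)))
     = (lambda_sv m l (2 * e + 3))\<^sup>2"
proof -
  let ?N = "hdim e (Suc m)" and ?A = "sphere_area (2 * e + 3)"
  let ?D = "real (double_fact (2 * e + 1))"
  have "wint e (leg e (Suc m) * conv_square e (hilbert_coeff e) (2 * m + 1) * leg e l)
     = (\<Sum>n\<le>2 * m + 1. ((hilbert_coeff e n)\<^sup>2 * (equator e * wint e (leg e n * leg e n))) * triple e m
       l n)"
    by (rule wint_conv_square)
  \<comment> \<open>\<open>l \<le> m\<close> gives \<open>m + 1 + l \<le> 2 * m + 1\<close>, so the
    cut-off of the kernel loses no term.\<close>
  also have "\<dots> = (\<Sum>n\<in>triple_index m l. ((hilbert_coeff e n)\<^sup>2 * (equator e * wint e (leg e n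
    * leg e n))) * triple e m l n)"
    by (rule sum_triple_index[OF lm]) (use lm in simp)
  also have "\<dots> = (\<Sum>n\<in>triple_index m l. (?D\<^sup>2 * ?A) * ((nu n (2 * e + 3))\<^sup>2 * hdim e n
    * triple e m l n))"
  proof (rule sum.cong)
    fix n assume "n \<in> triple_index m l"
    then have "odd n" by (simp add: triple_index_def)
    have "equator e * wint e (leg e n * leg e n) = ?A / hdim e n"
      using area_eq[of e] by (simp add: wint_leg_sq)
    then have "(hilbert_coeff e n)\<^sup>2 * (equator e * wint e (leg e n * leg e n)) = (?D\<^sup>2 * ?A) * ((nu n (2
      * e + 3))\<^sup>2 * hdim e n)"
      using \<open>odd n\<close> harmonic_dim_pos[of n e] by (simp add: hilbert_coeff_def power_mult_distrib
        power2_eq_square)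
    then show "((hilbert_coeff e n)\<^sup>2 * (equator e * wint e (leg e n * leg e n))) * triple e m l n
      = (?D\<^sup>2 * ?A) * ((nu n (2 * e + 3))\<^sup>2 * hdim e n * triple e m l n)"
      by (simp only: mult.assoc)
  qed simp
  also have "\<dots> = ?D\<^sup>2 * ?A * triple_sum e m l" by (simp only: triple_sum_def sum_distrib_left)
  finally have 1: "wint e (leg e (Suc m) * conv_square e (hilbert_coeff e) (2 * m + 1) * leg e l) = ?D\<^sup>2 * ?A
    * triple_sum e m l" .
  have 2: "equator e * wint e (leg e (Suc m) * leg e (Suc m)) = ?A / ?N"
    using area_eq[of e] by (simp add: wint_leg_sq)
  have 3: "(radial_const e m)\<^sup>2 = ?N\<^sup>2 / (?A\<^sup>2 * real (2 * m + 2 * e + 3))"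
    by (simp add: radial_const_def power_divide power_mult_distrib)
  have "N\<^sup>2 / (A\<^sup>2 * M) * (A / N * (s * (D\<^sup>2 * A * S))) = N * D\<^sup>2 * s / M
    * S" if "N > 0" "A > 0" for N A M s D S :: real
    using that by (simp add: power2_eq_square)
  then show ?thesis unfolding 1 2 3 lambda_sv_square(1)[OF pos]
    using harmonic_dim_pos[of "Suc m" e] sphere_area_pos[of "2 * e + 3"] by simp
qed

section \<open>The Gram matrix of the beam forms\<close>

context
  fixes e :: nat and T :: "'a::euclidean_space itself"
  assumes dim: "DIM('a) = 2 * e + 3"
begin

abbreviation (input) "pairs \<equiv> (sph :: 'a measure) \<Otimes>\<^sub>M (sph :: 'a measure)"

lemmas compact_pairs = compact_measure_pair[OF compact_measure_sphere compact_measure_sphere]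

lemma beam_form_borel:
  assumes u: "continuous_on (sphere 0 1) (u :: 'a \<Rightarrow> complex)"
  shows "(\<lambda>z. beam_form e i h u (fst z) (snd z)) \<in> borel_measurable pairs"
  unfolding beam_form_def
  by (rule borel_measurable_integrable, rule compact_measure_fubini(3)[OF compact_pairs compact_measure_sphere])
    (auto simp: case_prod_unfold intro!: continuous_intros continuous_on_compose2[OF u])

text \<open>Fubini takes the integration over \<open>(a, w)\<close> inside that over the pair
  \<open>(z, \<eta>)\<close>, where the integrand splits into a factor in \<open>a\<close> and one
  in \<open>w\<close>.\<close>

lemma beam_form_product:
  fixes u v :: "'a \<Rightarrow> complex"
  assumes u: "continuous_on (sphere 0 1) u" and v: "continuous_on (sphere 0 1) v"
  shows "(LINT z|pairs. beam_form e i h u (fst z) (snd z) * cnj (beam_form e j g v (fst z) (snd z)))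
     = (LINT z|sph. u z * (LINT \<eta>|sph. of_real ((LINT a|sph. poly (leg e i) (a \<bullet> z) * poly (leg e j) (a
       \<bullet> \<eta>))
          * (LINT w|sph. poly h (w \<bullet> z) * poly g (w \<bullet> \<eta>))) * cnj (v \<eta>)))" (is ?eq)
    and "integrable pairs (\<lambda>z. beam_form e i h u (fst z) (snd z)
      * cnj (beam_form e j g v (fst z) (snd z)))" (is ?int)
proof -
  let ?A = "\<lambda>a z \<eta>. poly (leg e i) (a \<bullet> z) * poly (leg e j) (a \<bullet> \<eta>)"
  let ?H = "\<lambda>w z \<eta>. poly h (w \<bullet> z) * poly g (w \<bullet> \<eta>)"
  define \<Phi> where "\<Phi> z \<zeta> = of_real (?A (fst z) (fst \<zeta>) (snd \<zeta>)
    * ?H (snd z) (fst \<zeta>) (snd \<zeta>)) * (u (fst \<zeta>) * cnj (v (snd \<zeta>)))" for z \<zeta> :: "'a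
      \<times> 'a"
  have form: "beam_form e i h u a w * cnj (beam_form e j g v a w)
    = (LINT \<zeta>|pairs. \<Phi> (a, w) \<zeta>)" for a w :: 'a
  proof -
    have "beam_form e i h u a w * cnj (beam_form e j g v a w)
      = (LINT z|sph. LINT \<eta>|sph. (of_real (poly (leg e i) (a \<bullet> z) * poly h (w \<bullet> z)) * u z) *
        (of_real (poly (leg e j) (a \<bullet> \<eta>) * poly g (w \<bullet> \<eta>)) * cnj (v \<eta>)))"
    proof -
      have "cnj (beam_form e j g v a w) = (LINT \<eta>|sph. cnj (of_real (poly (leg e j) (a \<bullet> \<eta>)
        * poly g (w \<bullet> \<eta>)) * v \<eta>))"
        unfolding beam_form_def by (rule Bochner_Integration.integral_cnj[symmetric])
      then show ?thesis
        by (simp only: beam_form_def complex_cnj_mult complex_cnj_complex_of_real integral_mult_right_zero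
          integral_mult_left_zero)
    qed
    also have "\<dots> = (LINT z|sph. LINT \<eta>|sph. \<Phi> (a, w) (z, \<eta>))"
      by (simp add: \<Phi>_def mult_ac)
    also have "\<dots> = (LINT \<zeta>|pairs. \<Phi> (a, w) (fst \<zeta>, snd \<zeta>))"
      unfolding \<Phi>_def fst_conv snd_conv
      by (rule sphere_fubini(2))
        (auto simp: case_prod_unfold intro!: continuous_intros continuous_on_compose2[OF u] continuous_on_compose2[OF
          v])
    finally show ?thesis by simp
  qed
  have cont: "continuous_on ((sphere 0 1 \<times> sphere 0 1) \<times> (sphere 0 1 \<times> sphere 0 1))
    (\<lambda>(z, \<zeta>). \<Phi> z \<zeta>)"
    unfolding \<Phi>_def by (auto simp: case_prod_unfold intro!: continuous_intros continuous_on_compose2[OF u]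
      continuous_on_compose2[OF v])
  show ?int
    using compact_measure_fubini(3)[OF compact_pairs compact_pairs cont] by (simp add: form)
  have "(LINT z|pairs. beam_form e i h u (fst z) (snd z) * cnj (beam_form e j g v (fst z) (snd z)))
    = (LINT z|pairs. LINT \<zeta>|pairs. \<Phi> z \<zeta>)"
    by (simp add: form)
  also have "\<dots> = (LINT \<zeta>|pairs. LINT z|pairs. \<Phi> z \<zeta>)"
    by (rule compact_measure_fubini(1)[OF compact_pairs compact_pairs cont])
  also have "\<dots> = (LINT \<zeta>|pairs. of_real ((LINT a|sph. ?A a (fst \<zeta>) (snd \<zeta>))
    * (LINT w|sph. ?H w (fst \<zeta>) (snd \<zeta>))) * (u (fst \<zeta>) * cnj (v (snd \<zeta>))))"
  proof (rule lint_cong)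
    fix \<zeta> :: "'a \<times> 'a"
    have "(LINT z|pairs. ?A (fst z) (fst \<zeta>) (snd \<zeta>) * ?H (snd z) (fst \<zeta>) (snd \<zeta>))
       = (LINT a|sph. LINT w|sph. ?A a (fst \<zeta>) (snd \<zeta>) * ?H w (fst \<zeta>) (snd \<zeta>))"
      by (rule sphere_fubini(2)[symmetric])
        (auto simp: case_prod_unfold intro!: continuous_intros)
    also have "\<dots> = (LINT a|sph. ?A a (fst \<zeta>) (snd \<zeta>))
      * (LINT w|sph. ?H w (fst \<zeta>) (snd \<zeta>))"
      by (simp only: integral_mult_right_zero integral_mult_left_zero)
    finally show "(LINT z|pairs. \<Phi> z \<zeta>) = of_real ((LINT a|sph. ?A a (fst \<zeta>) (snd \<zeta>))
      * (LINT w|sph. ?H w (fst \<zeta>) (snd \<zeta>))) * (u (fst \<zeta>) * cnj (v (snd \<zeta>)))"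
      unfolding \<Phi>_def integral_mult_left_zero integral_complex_of_real by (simp only:)
  qed simp
  also have "\<dots> = (LINT z|sph. LINT \<eta>|sph. of_real ((LINT a|sph. ?A a z \<eta>)
    * (LINT w|sph. ?H w z \<eta>)) * (u z * cnj (v \<eta>)))"
  proof (rule sphere_fubini(2)[symmetric])
    \<comment> \<open>Returning to iterated integrals needs continuity in
      \<open>(z, \<eta>)\<close>; both inner integrals are polynomials in
      \<open>z \<bullet> \<eta>\<close> on the spheres.\<close>
    have conv: "\<exists>r. \<forall>x y::'a. norm x = 1 \<longrightarrow> norm y
      = 1 \<longrightarrow> (LINT a|sph. poly p (a \<bullet> x) * poly q (a \<bullet> y)) = poly r (x \<bullet> y)"
        for p q
    proof -
      have "(LINT a|sph. poly p (a \<bullet> x) * poly q (a \<bullet> y)) = (LINT a|sph. poly p (x \<bullet> a)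
        * poly q (y \<bullet> a))" for x y :: 'a
        by (simp only: inner_commute)
      then show ?thesis using zonal_convolution[OF dim, of q p] by auto
    qed
    obtain r1 where r1: "\<And>x y::'a. norm x = 1 \<Longrightarrow> norm y = 1
      \<Longrightarrow> (LINT a|sph. ?A a x y) = poly r1 (x \<bullet> y)" using conv by blast
    obtain r2 where r2: "\<And>x y::'a. norm x = 1 \<Longrightarrow> norm y = 1
      \<Longrightarrow> (LINT a|sph. ?H a x y) = poly r2 (x \<bullet> y)" using conv by blast
    have "continuous_on (sphere 0 1 \<times> sphere 0 1) (\<lambda>(z, \<eta>). of_real (poly r1 (z \<bullet> \<eta>)
      * poly r2 (z \<bullet> \<eta>)) * (u z * cnj (v \<eta>)))"
      by (auto simp: case_prod_unfold intro!: continuous_intros continuous_on_compose2[OF u]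
        continuous_on_compose2[OF v])
    then show "continuous_on (sphere 0 1 \<times> sphere 0 1) (\<lambda>(z, \<eta>). of_real ((LINT a|sph. ?A a z
      \<eta>) * (LINT w|sph. ?H w z \<eta>)) * (u z * cnj (v \<eta>)))"
      by (rule continuous_on_eq) (auto simp: r1 r2)
  qed
  also have "\<dots> = (LINT z|sph. u z * (LINT \<eta>|sph. of_real ((LINT a|sph. ?A a z \<eta>)
    * (LINT w|sph. ?H w z \<eta>)) * cnj (v \<eta>)))"
    unfolding integral_mult_right_zero[symmetric] by (simp only: mult.left_commute)
  finally show ?eq .
qed

lemma funk_hecke_cnj:
  fixes w :: 'a and Y :: "'a \<Rightarrow> complex"
  assumes w: "norm w = 1" and Y: "harmonic_on_sphere n Y"
  shows "(LINT z|sph. of_real (poly q (w \<bullet> z)) * cnj (Y z)) = of_real (equator e * wint e (q * leg e n))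
    * cnj (Y w)"
proof -
  have "(LINT z|sph. of_real (poly q (w \<bullet> z)) * cnj (Y z))
    = (LINT z|sph. cnj (of_real (poly q (w \<bullet> z)) * Y z))"
    by (simp only: complex_cnj_mult complex_cnj_complex_of_real)
  also have "\<dots> = cnj (LINT z|sph. of_real (poly q (w \<bullet> z))
    * Y z)" by (rule Bochner_Integration.integral_cnj)
  finally show ?thesis
    by (simp only: funk_hecke[OF dim w Y] complex_cnj_mult complex_cnj_complex_of_real)
qed

text \<open>Pair \<open>u\<close> and \<open>v\<close> through the kernel \<open>leg e l\<close> at
  \<open>z \<bullet> \<eta>\<close>: acting on \<open>v\<close> it gives zero, acting on
  \<open>u\<close> a nonzero multiple of \<open>u\<close>.\<close>

lemma harmonic_orthogonal:
  fixes u v :: "'a \<Rightarrow> complex"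
  assumes u: "harmonic_on_sphere l u" and v: "harmonic_on_sphere l' v" and "l \<noteq> l'"
  shows "(LINT z|sph. u z * cnj (v z)) = 0"
proof -
  let ?P = "leg e l" and ?I = "LINT z|sph. u z * cnj (v z)"
  have "0 = (LINT z|sph. u z * (LINT \<eta>|sph. of_real (poly ?P (z \<bullet> \<eta>)) * cnj (v \<eta>)))"
  proof -
    have "(LINT z|sph. u z * (LINT \<eta>|sph. of_real (poly ?P (z \<bullet> \<eta>)) * cnj (v \<eta>)))
      = (LINT z|(sph :: 'a measure). 0)"
      by (rule lint_cong) (auto simp: funk_hecke_cnj[OF _ v] wint_leg_leg[OF \<open>l \<noteq> l'\<close>])
    then show ?thesis by simp
  qed
  also have "\<dots> = (LINT z|sph. LINT \<eta>|sph. u z * (of_real (poly ?P (z \<bullet> \<eta>)) * cnj (v \<eta>)))"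
    by (simp only: integral_mult_right_zero)
  also have "\<dots> = (LINT \<eta>|sph. LINT z|sph. u z * (of_real (poly ?P (z \<bullet> \<eta>)) * cnj (v \<eta>)))"
    by (rule sphere_fubini(1))
      (auto simp: case_prod_unfold intro!: continuous_intros continuous_on_compose2[OF continuous_on_harmonic[OF u]]
        continuous_on_compose2[OF continuous_on_harmonic[OF v]])
  also have "\<dots> = (LINT \<eta>|sph. (LINT z|sph. of_real (poly ?P (\<eta> \<bullet> z)) * u z) * cnj (v \<eta>))"
    unfolding integral_mult_left_zero[symmetric] by (simp add: inner_commute mult_ac)
  also have "\<dots> = (LINT \<eta>|sph. of_real (equator e * wint e (?P * ?P)) * (u \<eta> * cnj (v \<eta>)))"
    by (rule lint_cong) (auto simp: funk_hecke[OF dim _ u])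
  also have "\<dots> = of_real (equator e * wint e (?P * ?P)) * ?I" by (simp only: integral_mult_right_zero)
  finally show ?thesis using wint_leg_leg_pos[of e l] sphere_area_pos[of "2 * e + 2"] by simp
qed

lemma integral_leg_leg:
  fixes x y :: 'a
  assumes "norm x = 1" "norm y = 1"
  shows "(LINT a|sph. poly (leg e i) (a \<bullet> x) * poly (leg e j) (a \<bullet> y)) = equator e * wint e (leg e i
    * leg e j) * poly (leg e j) (x \<bullet> y)"
  using funk_hecke_zonal[OF dim assms, of "leg e i" j] by (simp add: inner_commute)

lemma integral_zonal_square:
  fixes x y :: 'a
  assumes x: "norm x = 1" and y: "norm y = 1" and h: "h = (\<Sum>n\<le>N. smult (c n) (leg e n))"
  shows "(LINT w|sph. poly h (w \<bullet> x) * poly h (w \<bullet> y)) = poly (conv_square e c N) (x \<bullet> y)"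
proof -
  have "(LINT w|sph. poly h (w \<bullet> x) * poly h (w \<bullet> y))
    = (LINT w|sph. (\<Sum>n\<le>N. \<Sum>k\<le>N. (c n * c k) * (poly (leg e n) (w \<bullet> x) * poly (leg e k) (w
      \<bullet> y))))"
    by (simp add: h poly_sum sum_product mult_ac)
  also have "\<dots> = (\<Sum>n\<le>N. \<Sum>k\<le>N. (c n * c k) * (LINT w|sph. poly (leg e n) (w \<bullet> x)
    * poly (leg e k) (w \<bullet> y)))"
    by (subst Bochner_Integration.integral_sum, intro integrable_sphere continuous_intros, rule sum.cong, rule refl,
        subst Bochner_Integration.integral_sum, intro integrable_sphere continuous_intros, simp)
  also have "\<dots> = (\<Sum>n\<le>N. \<Sum>k\<le>N. if k = n then (c n)\<^sup>2 * (equator e * wint e (leg e n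
    * leg e n)) * poly (leg e n) (x \<bullet> y) else 0)"
    by (intro sum.cong refl) (auto simp: integral_leg_leg x y wint_leg_leg power2_eq_square)
  finally show ?thesis by (simp add: conv_square_def poly_sum)
qed

text \<open>Integrating out \<open>a\<close> already gives zero, whatever the kernels in
  \<open>w\<close> are; this separates different \<open>m\<close>.\<close>

lemma beam_form_orthogonal:
  fixes u v :: "'a \<Rightarrow> complex"
  assumes u: "continuous_on (sphere 0 1) u" and v: "continuous_on (sphere 0 1) v" and "i \<noteq> j"
  shows "(LINT z|pairs. beam_form e i h u (fst z) (snd z) * cnj (beam_form e j g v (fst z) (snd z))) = 0"
proof -
  have "(LINT z|pairs. beam_form e i h u (fst z) (snd z) * cnj (beam_form e j g v (fst z) (snd z)))
    = (LINT z|sph. u z * (LINT \<eta>|(sph :: 'a measure). 0))"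
    unfolding beam_form_product(1)[OF u v]
    by (intro lint_cong refl arg_cong2[where f = "(*)"])
      (auto simp: integral_leg_leg wint_leg_leg[OF \<open>i \<noteq> j\<close>])
  then show ?thesis by simp
qed

text \<open>Integrating out \<open>a\<close> and \<open>w\<close> leaves, up to a constant, the
  single zonal polynomial \<open>leg e i * conv_square e c N\<close>, to which Funk-Hecke for the
  conjugate of \<open>v\<close> applies.\<close>

lemma beam_form_gram:
  fixes u v :: "'a \<Rightarrow> complex"
  assumes u: "harmonic_on_sphere l u" and v: "harmonic_on_sphere l' v"
    and h: "h = (\<Sum>n\<le>N. smult (c n) (leg e n))"
  shows "(LINT z|pairs. beam_form e i h u (fst z) (snd z) * cnj (beam_form e i h v (fst z) (snd z)))
    = of_real (equator e * wint e (leg e i * leg e i) * (equator e * wint e (leg e i * conv_square e c N * leg e l)))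
      * (LINT z|sph. u z * cnj (v z))"
proof -
  let ?c = "\<lambda>l. equator e * wint e (leg e i * leg e i) * (equator e * wint e (leg e i * conv_square e c N
    * leg e l))"
  have "(LINT z|pairs. beam_form e i h u (fst z) (snd z) * cnj (beam_form e i h v (fst z) (snd z)))
     = (LINT z|sph. of_real (?c l') * (u z * cnj (v z)))"
    unfolding beam_form_product(1)[OF continuous_on_harmonic[OF u] continuous_on_harmonic[OF v]]
  proof (rule lint_cong)
    fix z :: 'a assume "z \<in> space sph"
    then have z: "norm z = 1" by simp
    have "(LINT \<eta>|sph. of_real ((LINT a|sph. poly (leg e i) (a \<bullet> z)
      * poly (leg e i) (a \<bullet> \<eta>)) * (LINT w|sph. poly h (w \<bullet> z) * poly h (w \<bullet> \<eta>))) *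
        cnj (v \<eta>))
      = (LINT \<eta>|sph. of_real (equator e * wint e (leg e i * leg e i)) * (of_real (poly (leg e i * conv_square e
        c N) (z \<bullet> \<eta>)) * cnj (v \<eta>)))"
      by (rule lint_cong) (auto simp: integral_leg_leg integral_zonal_square[OF z _ h] z)
    also have "\<dots> = of_real (?c l') * cnj (v z)"
      by (simp only: integral_mult_right_zero funk_hecke_cnj[OF z v] of_real_mult mult.assoc)
    finally show "u z * (LINT \<eta>|sph. of_real ((LINT a|sph. poly (leg e i) (a \<bullet> z)
      * poly (leg e i) (a \<bullet> \<eta>)) * (LINT w|sph. poly h (w \<bullet> z) * poly h (w \<bullet> \<eta>))) *
        cnj (v \<eta>))
      = of_real (?c l') * (u z * cnj (v z))" by (simp only: mult.left_commute)
  qed simp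
  also have "\<dots> = of_real (?c l') * (LINT z|sph. u z * cnj (v z))" by (simp only: integral_mult_right_zero)
  \<comment> \<open>For \<open>l \<noteq> l'\<close> both sides are zero, so the constant may be
    stated with either degree.\<close>
  also have "\<dots> = of_real (?c l) * (LINT z|sph. u z * cnj (v z))"
    using harmonic_orthogonal[OF u v] by (cases "l = l'") auto
  finally show ?thesis .
qed

text \<open>With \<open>h = leg e n\<close> the Gram integral of one form with itself is a squared
  norm and equals a positive multiple of the triple product.\<close>

lemma legendre_triple_nonneg:
  fixes u :: "'a \<Rightarrow> complex"
  assumes u: "harmonic_on_sphere l u" and "(LINT z|sph. u z * cnj (u z)) = 1"
  shows "wint e (leg e i * leg e l * leg e n) \<ge> 0"
proof -
  let ?c = "\<lambda>k. if k = n then 1 else 0 :: real"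
  have single: "(\<Sum>k\<le>n. smult (a k * ?c k) (leg e k)) = smult (a n) (leg e n)" for a
  proof -
    have "(\<Sum>k\<le>n. smult (a k * ?c k) (leg e k)) = (\<Sum>k\<le>n. if k = n then smult (a n) (leg e n) else 0)"
      by (intro sum.cong) auto
    then show ?thesis by simp
  qed
  have h: "leg e n = (\<Sum>k\<le>n. smult (?c k) (leg e k))" using single[of "\<lambda>_. 1"] by simp
  have cs: "conv_square e ?c n = smult (equator e * wint e (leg e n * leg e n)) (leg e n)"
  proof -
    have "conv_square e ?c n = (\<Sum>k\<le>n. smult (equator e * wint e (leg e k * leg e k) * ?c k) (leg e k))"
      unfolding conv_square_def by (intro sum.cong) auto
    then show ?thesis by (simp only: single)
  qed
  have "(LINT z|pairs. beam_form e i (leg e n) u (fst z) (snd z) * cnj (beam_form e i (leg e n) u (fst z) (snd z)))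
    = of_real (equator e * wint e (leg e i * leg e i) * (equator e * wint e (leg e i * conv_square e ?c n * leg e
      l)))"
    using beam_form_gram[OF u u h, of i] assms(2) by simp
  then have "0 \<le> equator e * wint e (leg e i * leg e i) * (equator e * wint e (leg e i * conv_square e ?c n
    * leg e l))"
    by (rule integral_norm_sq_nonneg)
  also have "wint e (leg e i * conv_square e ?c n * leg e l) = (equator e * wint e (leg e n * leg e n))
    * wint e (leg e i * leg e l * leg e n)"
    unfolding cs by (simp add: wint_smult mult_ac)
  finally have *: "0 \<le> equator e * wint e (leg e i * leg e i) * (equator e * ((equator e * wint e (leg e n
    * leg e n)) * wint e (leg e i * leg e l * leg e n)))" .
  have "x \<ge> 0" if "0 \<le> s * a * (s * ((s * b) * x))" "s > 0" "a > 0" "b > 0" for s a b x :: real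
  proof (rule ccontr)
    assume "\<not> x \<ge> 0"
    then have "s * a * (s * ((s * b) * x)) < 0"
      using that by (intro mult_pos_neg mult_pos_pos) auto
    with that(1) show False by simp
  qed
  from this[OF * sphere_area_pos wint_leg_leg_pos wint_leg_leg_pos] show ?thesis by simp
qed

text \<open>All terms are nonnegative and, by \<open>sum_triple_total\<close>, one of those weighted
  with \<open>N\<close> is positive; the extra factor \<open>\<nu> ^ 2\<close> keeps it positive
  because \<open>nu\<close> never vanishes.\<close>

lemma triple_sum_pos:
  fixes u :: "'a \<Rightarrow> complex"
  assumes lm: "l \<le> m" "even (l + m)" and u: "harmonic_on_sphere l u" "(LINT z|sph. u z * cnj (u z)) = 1"
  shows "triple_sum e m l > 0"
proof -
  let ?t = "\<lambda>n. hdim e n * triple e m l n"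
  have fin: "finite (triple_index m l)" by (rule finite_subset[of _ "{..m + 1 + l}"]) (auto simp: triple_index_def)
  have nonneg: "?t n \<ge> 0" for n using legendre_triple_nonneg[OF u, of "Suc m" n] by simp
  have "sum ?t (triple_index m l) > 0" unfolding sum_triple_total[OF lm] using wint_sq_pos[of 1 e] by simp
  then have "sum ?t (triple_index m l) \<noteq> 0" by simp
  then obtain n where n: "n \<in> triple_index m l" "?t n \<noteq> 0" by (rule sum.not_neutral_contains_not_neutral)
  have "?t n > 0" using n(2) nonneg[of n] by linarith
  moreover have "(nu n (2 * e + 3))\<^sup>2 > 0" using nu_nonzero by (simp only: zero_less_power2) simp
  ultimately have "(nu n (2 * e + 3))\<^sup>2 * ?t n > 0" by (rule mult_pos_pos[rotated])
  then have "0 < (\<Sum>n\<in>triple_index m l. (nu n (2 * e + 3))\<^sup>2 * ?t n)"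
    by (rule sum_pos2[OF fin n(1)]) (intro mult_nonneg_nonneg nonneg zero_le_power2)
  then show ?thesis unfolding triple_sum_def by (simp only: mult.assoc)
qed

end

theorem theorem4p5:
  fixes Y :: "nat \<Rightarrow> nat \<Rightarrow> 'a::euclidean_space \<Rightarrow> complex"
    and d :: nat
  assumes dim: "DIM('a) = d" and d3: "d \<ge> 3" and d_odd: "odd d"
    and Y: "\<And>n. spherical_harmonic_basis n (Y n)"
  shows "orthonormal_L2 (sphere_measure \<Otimes>\<^sub>M sphere_measure)
    {(m, l, k). l \<le> m \<and> even (l + m) \<and> k \<in> {1..harmonic_dim l d}}
    (\<lambda>(m, l, k) (a, w). of_real (1 / lambda_sv m l d) * divergent_beam_odd (V_fun Y m l k) a w)"
proof -
  obtain e where d: "d = 2 * e + 3"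
  proof -
    obtain j where "d = 2 * j + 1" using d_odd by (rule oddE)
    then show thesis using d3 that[of "j - 1"] by simp
  qed
  have dim': "DIM('a) = 2 * e + 3" using dim d by simp
  let ?I = "{(m, l, k). l \<le> m \<and> even (l + m) \<and> k \<in> {1..harmonic_dim l d}}"
  let ?pairs = "sphere_measure \<Otimes>\<^sub>M (sphere_measure :: 'a measure)"
  define h where "h m = hilbert_kernel e m" for m
  define F where "F m l k z = beam_form e (Suc m) (h m) (Y l k) (fst z) (snd z)" for m l k and z :: "'a \<times> 'a"
  \<comment> \<open>Collects the sign and the ridge constant of \<open>divergent_beam_odd_V\<close>
    together with the normalization.\<close>
  define c where "c m l = - radial_const e m / lambda_sv m l d" for m l
  define G where "G = (\<lambda>(m, l, k) (a, w). of_real (1 / lambda_sv m l d)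
    * divergent_beam_odd (V_fun Y m l k) a w)"
  have harm: "harmonic_on_sphere l (Y l k)" if "k \<in> {1..harmonic_dim l d}" for l k
    using Y[of l] that dim unfolding spherical_harmonic_basis_def harmonic_on_sphere_def by auto
  have ortho: "(LINT z|sph. Y l k z * cnj (Y l k' z)) = (if k = k' then 1 else 0)"
    if "k \<in> {1..harmonic_dim l d}" "k' \<in> {1..harmonic_dim l d}" for l k k'
    using Y[of l] that dim unfolding spherical_harmonic_basis_def orthonormal_L2_def by blast
  have cont: "continuous_on (sphere 0 1) (Y l k)" if "k \<in> {1..harmonic_dim l d}" for l k
    using continuous_on_harmonic[OF harm[OF that]] .
  have space: "space ?pairs = sphere 0 1 \<times> sphere 0 1" by (simp add: space_pair_measure)
  \<comment> \<open>The reduction to \<open>beam_form\<close> is available for unit vectors only,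
    and the measure space contains no other points.\<close>
  have G: "G (m, l, k) z = of_real (c m l) * F m l k z"
    if "(m, l, k) \<in> ?I" "z \<in> space ?pairs" for m l k z
    using that divergent_beam_odd_V[OF dim', where Y = Y and l = l and k = k and m = m and a = "fst z" and w = "snd
      z", OF harm]
    by (auto simp: G_def F_def c_def h_def space)
  have G_cong: "G (m, l, k) \<in> borel_measurable ?pairs \<longleftrightarrow> (\<lambda>z. of_real (c m l)
    * F m l k z) \<in> borel_measurable ?pairs"
    if "(m, l, k) \<in> ?I" for m l k
    using G[OF that] by (intro measurable_cong) auto
  have sq: "square_integrable ?pairs (G (m, l, k))" if i: "(m, l, k) \<in> ?I" for m l k
  proof -
    have k: "k \<in> {1..harmonic_dim l d}" using i by simp
    have "F m l k \<in> borel_measurable ?pairs"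
      unfolding F_def by (rule beam_form_borel[OF dim' cont[OF k]])
    then have "G (m, l, k) \<in> borel_measurable ?pairs" unfolding G_cong[OF i] by measurable
    moreover have "integrable ?pairs (\<lambda>z. (norm (G (m, l, k) z))\<^sup>2)"
    proof -
      have "integrable ?pairs (\<lambda>z. F m l k z * cnj (F m l k z))"
        unfolding F_def by (rule beam_form_product(2)[OF dim' cont[OF k] cont[OF k]])
      then have "integrable ?pairs (\<lambda>z. (c m l)\<^sup>2 * Re (F m l k z * cnj (F m l k z)))"
        by (intro integrable_mult_right integrable_Re)
      moreover have "(norm (G (m, l, k) z))\<^sup>2 = (c m l)\<^sup>2 * Re (F m l k z
        * cnj (F m l k z))" if "z \<in> space ?pairs" for z
        unfolding G[OF i that] by (simp only: norm_mult norm_of_real power_mult_distrib power2_abs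
          complex_norm_square[symmetric] Re_complex_of_real)
      ultimately show ?thesis
        by (subst Bochner_Integration.integrable_cong[OF refl])
    qed
    ultimately show ?thesis by (simp add: square_integrable_def)
  qed
  have inner: "(LINT z|?pairs. G (m, l, k) z * cnj (G (m', l', k') z)) = (if (m, l, k) = (m', l', k') then 1 else 0)"
    if i: "(m, l, k) \<in> ?I" and j: "(m', l', k') \<in> ?I" for m l k m' l' k'
  proof -
    have k: "k \<in> {1..harmonic_dim l d}" and k': "k' \<in> {1..harmonic_dim l' d}"
      and lm: "l \<le> m" "even (l + m)" using i j by auto
    have "(LINT z|?pairs. G (m, l, k) z * cnj (G (m', l', k') z))
        = (LINT z|?pairs. of_real (c m l * c m' l') * (F m l k z * cnj (F m' l' k' z)))"
      by (rule lint_cong) (simp_all add: G[OF i] G[OF j] mult_ac)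
    also have "\<dots> = of_real (c m l * c m' l') * (LINT z|?pairs. F m l k z * cnj (F m' l' k' z))"
      by (simp only: integral_mult_right_zero)
    finally have eq: "(LINT z|?pairs. G (m, l, k) z * cnj (G (m', l', k') z))
        = of_real (c m l * c m' l') * (LINT z|?pairs. F m l k z * cnj (F m' l' k' z))" .
    show ?thesis
    proof (cases "m = m'")
      case False
      then have "(LINT z|?pairs. F m l k z * cnj (F m' l' k' z)) = 0"
        unfolding F_def by (intro beam_form_orthogonal[OF dim'] cont k k') simp
      with eq False show ?thesis by simp
    next
      case True
      have F: "(LINT z|?pairs. F m l k z * cnj (F m' l' k' z)) = of_real (equator e * wint e (leg e (Suc m)
        * leg e (Suc m)) *
          (equator e * wint e (leg e (Suc m) * conv_square e (hilbert_coeff e) (2 * m + 1) * leg e l))) * (LINT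
            z|sph. Y l k z * cnj (Y l' k' z))"
        unfolding F_def True[symmetric] h_def
        by (rule beam_form_gram[OF dim' harm[OF k] harm[OF k'] hilbert_kernel_expansion])
      show ?thesis
      proof (cases "l = l' \<and> k = k'")
        case False
        then have "(LINT z|sph. Y l k z * cnj (Y l' k' z)) = 0"
          using harmonic_orthogonal[OF dim' harm[OF k] harm[OF k']] ortho[OF k] k' by (cases "l = l'") auto
        then show ?thesis unfolding eq F using False by auto
      next
        case same: True
        have one: "(LINT z|sph. Y l k z * cnj (Y l k z)) = 1" using ortho[OF k k] by simp
        have pos: "triple_sum e m l > 0" by (rule triple_sum_pos[OF dim' lm harm[OF k] one])
        define K where "K = equator e * wint e (leg e (Suc m) * leg e (Suc m)) *
          (equator e * wint e (leg e (Suc m) * conv_square e (hilbert_coeff e) (2 * m + 1) * leg e l))"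
        have "(radial_const e m)\<^sup>2 * K = (lambda_sv m l d)\<^sup>2"
          using hilbert_gram_constant[OF lm pos] unfolding K_def d .
        moreover have "c m l * c m l * K = ((radial_const e m)\<^sup>2 * K) / (lambda_sv m l d)\<^sup>2"
          by (simp add: c_def power2_eq_square)
        ultimately have "c m l * c m l * K = 1"
          using lambda_sv_square(2)[OF pos] by (simp add: d)
        then have "complex_of_real (c m l * c m l) * of_real K = 1"
          by (simp only: of_real_mult[symmetric] of_real_1)
        then show ?thesis unfolding eq F K_def[symmetric] using same True one by simp
      qed
    qed
  qed
  show ?thesis unfolding orthonormal_L2_def G_def[symmetric]
    using sq inner by auto
qed

end
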